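(* Let $H\in(0,1/2)$, $T>0$, let $B^H$ be a fractional Brownian motion with Hurst index $H$, and let $W$ be a Wiener process independent of $B^H$, both defined on a filtered probability space $(\Omega,\mathcal F,\{\mathcal F_t\}_{t\ge 0},\mathbb P)$. Let $g\in AC([0,T])$, $g(t)=\int_0^t g'(s)\,ds$, with $g'\in L_2([0,T])$, and let $f:[0,T]\to\mathbb R_+$ be a positive measurable function. Let $g_B'$ be the unique $L_2([0,T])$-solution $x$ of the Fredholm equation $$x(t)+C_2\int_0^T\kappa(z,t)x(z)\,dz=g'(t),\qquad t\in[0,T],$$ put $g_B(t)=\int_0^t g_B'(s)\,ds$, $g_W=g-g_B$, and $h(t)=(K^{H,*}_0 g_B')(t)$. Then for any $\varepsilon>0$ $$\mathbb P(A_{T,g,\varepsilon})\ \ge\ \exp\left\{-\frac12\int_0^T\left((g_W'(t))^2+(h(t))^2\right)dt\right\}\mathbb P(A_{T,0,\varepsilon}).$$ This lower bound is optimal in the sense that $$\frac12\int_0^T\left((\widetilde g_W'(t))^2+(\widetilde h(t))^2\right)dt\ \ge\ \frac12\int_0^T\left((g_W'(t))^2+(h(t))^2\right)dt$$ for any other suitable expansion $g=\widetilde g_W+\widetilde g_B$, where $\widetilde h=K^{H,*}_0\widetilde g_B'$.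
   Context: For a trend $g$ and $\varepsilon>0$, $A_{T,g,\varepsilon}=\{|B^H(t)+W(t)+g(t)|\le \varepsilon f(t),\ 0\le t\le T\}$, and $A_{T,0,\varepsilon}$ is this event with $g\equiv 0$. A fractional Brownian motion with Hurst index $H$ is a centered Gaussian process with covariance $\frac12(t^{2H}+s^{2H}-|t-s|^{2H})$. An expansion $g=g_W+g_B$ is called suitable if $g_W,g_B\in AC([0,T])$, $g_W(t)=\int_0^t g_W'(s)ds$, $g_B(t)=\int_0^t g_B'(s)ds$, and $g_W',g_B'\in L_2([0,T])$. Constants: $C_1=\left(\frac{2H\Gamma(H+1/2)\Gamma(3/2-H)}{\Gamma(2-2H)}\right)^{1/2}$, $C_2=\frac{C_1^{-2}}{(\Gamma(1/2-H))^2}$. Operator: $(K^{H,*}_0\varphi)(t)=C_1^{-1}t^{H-1/2}\frac{1}{\Gamma(1/2-H)}\int_0^t (t-u)^{-1/2-H}u^{1/2-H}\varphi(u)\,du$; it maps $L_2([0,T])$ into $L_2([0,T])$. Kernel: $$\kappa(z,t)=(tz)^{1/2-H}\int_t^T(u-t)^{-1/2-H}u^{2H-1}(u-z)^{-1/2-H}du\,\mathbf 1_{\{0\le z<t\le T\}}+(tz)^{1/2-H}\int_z^T(u-t)^{-1/2-H}u^{2H-1}(u-z)^{-1/2-H}du\,\mathbf 1_{\{0\le t<z\le T\}}.$$ Equations between elements of $L_2([0,T])$ are understood almost everywhere.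
   Formalization: The fractional Brownian motion is additionally assumed to have almost surely continuous paths; with only the Gaussian law and covariance prescribed, the event A need not be measurable and the inequality can fail for a modification of the process. *)

theory Defs
  imports "HOL-Probability.Probability"
begin

text \<open>Processes are indexed by \<open>[0,\<infinity>)\<close>: for \<open>X :: real \<Rightarrow> 'a \<Rightarrow> real\<close> only the values at
  times \<open>t \<ge> 0\<close> matter.\<close>

definition filtered_prob_space :: "'a measure \<Rightarrow> (real \<Rightarrow> 'a measure) \<Rightarrow> bool" where
  "filtered_prob_space M F \<longleftrightarrow>
     prob_space M \<and>
     (\<forall>t\<ge>0. subalgebra M (F t)) \<and>
     (\<forall>s t. 0 \<le> s \<and> s \<le> t \<longrightarrow> subalgebra (F t) (F s))"

text \<open>Normal laws of variance \<open>0\<close> (point masses) count as Gaussian, since linear combinations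
  of values of a Gaussian process may be degenerate.\<close>

definition gaussian_rv :: "'a measure \<Rightarrow> ('a \<Rightarrow> real) \<Rightarrow> bool" where
  "gaussian_rv M X \<longleftrightarrow>
     X \<in> borel_measurable M \<and>
     ((\<exists>\<mu> \<sigma>. 0 < \<sigma> \<and> distributed M lborel X (\<lambda>x. ennreal (normal_density \<mu> \<sigma> x))) \<or>
      (\<exists>\<mu>. AE \<omega> in M. X \<omega> = \<mu>))"

definition gaussian_process :: "'a measure \<Rightarrow> (real \<Rightarrow> 'a \<Rightarrow> real) \<Rightarrow> bool" where
  "gaussian_process M X \<longleftrightarrow>
     (\<forall>J c. finite J \<and> J \<subseteq> {0..} \<longrightarrow> gaussian_rv M (\<lambda>\<omega>. \<Sum>t\<in>J. c t * X t \<omega>))"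

definition fractional_brownian_motion :: "'a measure \<Rightarrow> real \<Rightarrow> (real \<Rightarrow> 'a \<Rightarrow> real) \<Rightarrow> bool" where
  "fractional_brownian_motion M H B \<longleftrightarrow>
     gaussian_process M B \<and>
     (\<forall>t\<ge>0. prob_space.expectation M (B t) = 0) \<and>
     (\<forall>s\<ge>0. \<forall>t\<ge>0. prob_space.expectation M (\<lambda>\<omega>. B t \<omega> * B s \<omega>)
        = (t powr (2 * H) + s powr (2 * H) - \<bar>t - s\<bar> powr (2 * H)) / 2)"

text \<open>The covariance only fixes the finite-dimensional laws, so continuity of the paths has to be
  required separately when a continuous version is meant.\<close>

definition continuous_paths :: "'a measure \<Rightarrow> (real \<Rightarrow> 'a \<Rightarrow> real) \<Rightarrow> bool" where
  "continuous_paths M X \<longleftrightarrow> (AE \<omega> in M. continuous_on {0..} (\<lambda>t. X t \<omega>))"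

definition wiener_process :: "'a measure \<Rightarrow> (real \<Rightarrow> 'a \<Rightarrow> real) \<Rightarrow> bool" where
  "wiener_process M W \<longleftrightarrow>
     (\<forall>t\<ge>0. W t \<in> borel_measurable M) \<and>
     (AE \<omega> in M. W 0 \<omega> = 0) \<and>
     (\<forall>(n::nat) \<tau>. 0 \<le> \<tau> 0 \<and> (\<forall>i<n. \<tau> i \<le> \<tau> (Suc i)) \<longrightarrow>
        prob_space.indep_vars M (\<lambda>_. borel) (\<lambda>i \<omega>. W (\<tau> (Suc i)) \<omega> - W (\<tau> i) \<omega>) {..<n}) \<and>
     (\<forall>s t. 0 \<le> s \<and> s < t \<longrightarrow>
        distributed M lborel (\<lambda>\<omega>. W t \<omega> - W s \<omega>)
          (\<lambda>x. ennreal (normal_density 0 (sqrt (t - s)) x))) \<and>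
     continuous_paths M W"

definition independent_processes ::
    "'a measure \<Rightarrow> (real \<Rightarrow> 'a \<Rightarrow> real) \<Rightarrow> (real \<Rightarrow> 'a \<Rightarrow> real) \<Rightarrow> bool" where
  "independent_processes M X Y \<longleftrightarrow>
     prob_space.indep_var M
       (PiM {0..} (\<lambda>_. borel)) (\<lambda>\<omega>. \<lambda>t\<in>{0..}. X t \<omega>)
       (PiM {0..} (\<lambda>_. borel)) (\<lambda>\<omega>. \<lambda>t\<in>{0..}. Y t \<omega>)"

definition band_event ::
    "'a measure \<Rightarrow> (real \<Rightarrow> 'a \<Rightarrow> real) \<Rightarrow> (real \<Rightarrow> 'a \<Rightarrow> real) \<Rightarrow> (real \<Rightarrow> real) \<Rightarrow> real
      \<Rightarrow> (real \<Rightarrow> real) \<Rightarrow> real \<Rightarrow> 'a set" where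
  "band_event M B W f T g \<epsilon> =
     {\<omega> \<in> space M. \<forall>t\<in>{0..T}. \<bar>B t \<omega> + W t \<omega> + g t\<bar> \<le> \<epsilon> * f t}"

text \<open>The band event is an uncountable intersection. As paths are only required to be continuous
  almost surely, it is in general measurable only up to null sets, so its probability is taken in
  the completion; this is the ordinary probability whenever the event lies in \<open>sets M\<close>.\<close>

definition band_prob ::
    "'a measure \<Rightarrow> (real \<Rightarrow> 'a \<Rightarrow> real) \<Rightarrow> (real \<Rightarrow> 'a \<Rightarrow> real) \<Rightarrow> (real \<Rightarrow> real) \<Rightarrow> real
      \<Rightarrow> (real \<Rightarrow> real) \<Rightarrow> real \<Rightarrow> real" where
  "band_prob M B W f T g \<epsilon> = measure (completion M) (band_event M B W f T g \<epsilon>)"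

definition absolutely_continuous_on_Icc :: "real \<Rightarrow> (real \<Rightarrow> real) \<Rightarrow> bool" where
  "absolutely_continuous_on_Icc T f \<longleftrightarrow>
     (\<forall>e>0. \<exists>d>0. \<forall>(n::nat) a b.
        (\<forall>i<n. 0 \<le> a i \<and> a i \<le> b i \<and> b i \<le> T) \<and>
        disjoint_family_on (\<lambda>i. {a i<..<b i}) {..<n} \<and>
        (\<Sum>i<n. b i - a i) < d
        \<longrightarrow> (\<Sum>i<n. \<bar>f (b i) - f (a i)\<bar>) < e)"

text \<open>Representatives of the elements of \<open>L\<^sub>2([0,T])\<close>; equality in that space is
  equality almost everywhere with respect to \<open>lebesgue_on {0..T}\<close>.\<close>

definition L2 :: "real \<Rightarrow> (real \<Rightarrow> real) set" where
  "L2 T = {\<phi>. \<phi> \<in> borel_measurable (lebesgue_on {0..T}) \<and>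
              integrable (lebesgue_on {0..T}) (\<lambda>t. (\<phi> t)\<^sup>2)}"

text \<open>Here \<open>g'\<close> is any representative of the derivative of \<open>g\<close>, which is determined
  almost everywhere by the integral formula.\<close>

definition has_L2_derivative :: "real \<Rightarrow> (real \<Rightarrow> real) \<Rightarrow> (real \<Rightarrow> real) \<Rightarrow> bool" where
  "has_L2_derivative T g g' \<longleftrightarrow>
     absolutely_continuous_on_Icc T g \<and>
     g' \<in> L2 T \<and>
     (\<forall>t\<in>{0..T}. g t = (LINT s|lebesgue_on {0..t}. g' s))"

definition suitable_expansion ::
    "real \<Rightarrow> (real \<Rightarrow> real) \<Rightarrow> (real \<Rightarrow> real) \<Rightarrow> (real \<Rightarrow> real)
      \<Rightarrow> (real \<Rightarrow> real) \<Rightarrow> (real \<Rightarrow> real) \<Rightarrow> bool" where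
  "suitable_expansion T g g\<^sub>W g\<^sub>W' g\<^sub>B g\<^sub>B' \<longleftrightarrow>
     has_L2_derivative T g\<^sub>W g\<^sub>W' \<and>
     has_L2_derivative T g\<^sub>B g\<^sub>B' \<and>
     (\<forall>t\<in>{0..T}. g t = g\<^sub>W t + g\<^sub>B t)"

definition C1 :: "real \<Rightarrow> real" where
  "C1 H = sqrt (2 * H * Gamma (H + 1/2) * Gamma (3/2 - H) / Gamma (2 - 2 * H))"

definition C2 :: "real \<Rightarrow> real" where
  "C2 H = inverse ((C1 H)\<^sup>2) / (Gamma (1/2 - H))\<^sup>2"

definition K0 :: "real \<Rightarrow> (real \<Rightarrow> real) \<Rightarrow> real \<Rightarrow> real" where
  "K0 H \<phi> t =
     inverse (C1 H) * t powr (H - 1/2) * (1 / Gamma (1/2 - H)) *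
     (LINT u|lebesgue_on {0..t}. (t - u) powr (-1/2 - H) * u powr (1/2 - H) * \<phi> u)"

definition kappa :: "real \<Rightarrow> real \<Rightarrow> real \<Rightarrow> real \<Rightarrow> real" where
  "kappa H T z t =
     (t * z) powr (1/2 - H) *
       (LINT u|lebesgue_on {t..T}.
          (u - t) powr (-1/2 - H) * u powr (2 * H - 1) * (u - z) powr (-1/2 - H)) *
       of_bool (0 \<le> z \<and> z < t \<and> t \<le> T)
   + (t * z) powr (1/2 - H) *
       (LINT u|lebesgue_on {z..T}.
          (u - t) powr (-1/2 - H) * u powr (2 * H - 1) * (u - z) powr (-1/2 - H)) *
       of_bool (0 \<le> t \<and> t < z \<and> z \<le> T)"

definition fredholm_solution :: "real \<Rightarrow> real \<Rightarrow> (real \<Rightarrow> real) \<Rightarrow> (real \<Rightarrow> real) \<Rightarrow> bool" where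
  "fredholm_solution H T g' x \<longleftrightarrow>
     x \<in> L2 T \<and>
     (AE t in lebesgue_on {0..T}.
        x t + C2 H * (LINT z|lebesgue_on {0..T}. kappa H T z t * x z) = g' t)"

definition expansion_cost :: "real \<Rightarrow> real \<Rightarrow> (real \<Rightarrow> real) \<Rightarrow> (real \<Rightarrow> real) \<Rightarrow> real" where
  "expansion_cost H T g\<^sub>W' g\<^sub>B' =
     1/2 * (LINT t|lebesgue_on {0..T}. (g\<^sub>W' t)\<^sup>2 + (K0 H g\<^sub>B' t)\<^sup>2)"

end

theory Submission
  imports Defs
begin

text \<open>
  \<^emph>\<open>Variational part.\<close>  The kernel \<open>C2 * kappa\<close> is that of \<open>K\<^sup>* K\<close> for the weakly singular Volterra
  operator \<open>K = K0\<close>, which is bounded on \<open>L2\<close> by the Schur test.  So the Fredholm equation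
  reads \<open>(1 + K\<^sup>* K) x = g'\<close>: a coercive self-adjoint equation, and exactly the Euler--Lagrange
  equation of the convex cost \<open>x \<mapsto> (\<parallel>g' - x\<parallel>\<^sup>2 + \<parallel>K x\<parallel>\<^sup>2) / 2\<close>.

  \<^emph>\<open>Probabilistic part.\<close>  The functions \<open>m\<^sub>s\<close> of the Volterra representation of fractional Brownian
  motion satisfy \<open>\<langle>m\<^sub>r, m\<^sub>s\<rangle> = Cov(B\<^sub>r, B\<^sub>s)\<close> and \<open>\<langle>m\<^sub>s, K x\<rangle> = \<integral>\<^sub>0\<^sup>s x\<close>.  By the Cauchy--Schwarz inequality
  \<open>(\<Sum> c\<^sub>i g(t\<^sub>i))\<^sup>2 \<le> 2 cost * Var(\<Sum> c\<^sub>i (B + W)(t\<^sub>i))\<close>, so on every finite set of times \<open>g\<close> lies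
  in the Cameron--Martin space of \<open>B + W\<close> with squared norm at most \<open>2 cost\<close>.  Shifting a centred
  Gaussian vector by such a \<open>g\<close> multiplies its law by \<open>exp (\<xi> - Var \<xi> / 2)\<close> with \<open>\<xi>\<close> linear;
  averaging over the sign symmetry of the band replaces \<open>exp \<xi>\<close> by \<open>cosh \<xi> \<ge> 1\<close>.  Continuity of the
  paths reduces the band to countably many times.
\<close>

subsection \<open>Characteristic functions determine box probabilities\<close>

text \<open>Laws enter only through characteristic functions of linear combinations, which the
  definitions of the two processes determine; no stochastic integral is formed. Every event is
  compared on a box in finitely many coordinates, so a Cramer--Wold principle for boxes suffices,
  and it is derived from one-dimensional Levy uniqueness. On the analytic side the obstacle is the
  inner product of \<open>m r\<close> and \<open>m s\<close>, a product of two singular integrals.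
  Two one-sided identities avoid it: the adjoint of \<open>K\<close> sends \<open>m s\<close> to the
  indicator of \<open>(0, s)\<close>, and \<open>K\<close> sends \<open>\<rho> s\<close>, the
  derivative of the covariance, to \<open>m s\<close> on \<open>(0, s)\<close>. For
  \<open>r \<le> s\<close> the inner product then collapses to the integral of
  \<open>\<rho> s\<close> over \<open>[0, r]\<close>. All kernels are nonnegative, so these
  exchanges are instances of Tonelli's theorem, and square integrability of \<open>m s\<close> is a
  by-product. The normalisation \<open>C1\<close> is what lets one and the same \<open>m s\<close>
  satisfy both identities.\<close>

lemma char_distr_eq_Complex:
  fixes X :: "'a \<Rightarrow> real"
  assumes "prob_space M" and [measurable]: "X \<in> borel_measurable M"
  shows "char (distr M borel X) v = Complex (\<integral>\<omega>. cos (v * X \<omega>) \<partial>M) (\<integral>\<omega>. sin (v * X \<omega>) \<partial>M)"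
proof -
  interpret prob_space M by fact
  have int: "integrable M (\<lambda>\<omega>. iexp (v * X \<omega>))"
    by (rule integrable_iexp) auto
  have *: "char (distr M borel X) v = (CLINT \<omega>|M. iexp (v * X \<omega>))"
    by (simp add: char_def integral_distr)
  have "Re (char (distr M borel X) v) = (\<integral>\<omega>. cos (v * X \<omega>) \<partial>M)"
    unfolding * using integral_Re[OF int] by (simp add: Re_exp)
  moreover have "Im (char (distr M borel X) v) = (\<integral>\<omega>. sin (v * X \<omega>) \<partial>M)"
    unfolding * using integral_Im[OF int] by (simp add: Im_exp)
  ultimately show ?thesis by (simp add: complex_eq_iff)
qed

text \<open>Normalised, the weights are densities of probability measures under which
  \<open>X\<close> and \<open>Y\<close> have equal characteristic functions, so Levy uniqueness
  gives equal laws; this is why the weights have to be nonnegative. The function \<open>h\<close>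
  may be unbounded: both sides are integrals against one law, possibly both with the default value
  0. Total mass 0 cannot be normalised, but forces both weights to vanish almost everywhere.\<close>

lemma weighted_law_eqI:
  fixes h :: "real \<Rightarrow> real" and X :: "'a \<Rightarrow> real" and Y :: "'b \<Rightarrow> real" and w :: "'a \<Rightarrow> real" and w' :: "'b \<Rightarrow> real"
  assumes w: "integrable M w" "\<And>\<omega>. 0 \<le> w \<omega>" and w': "integrable N w'" "\<And>\<omega>. 0 \<le> w' \<omega>"
    and X[measurable]: "X \<in> borel_measurable M" and Y[measurable]: "Y \<in> borel_measurable N"
    and c: "\<And>v. (\<integral>\<omega>. w \<omega> * cos (v * X \<omega>) \<partial>M) = (\<integral>\<omega>. w' \<omega> * cos (v * Y \<omega>) \<partial>N)"
    and s: "\<And>v. (\<integral>\<omega>. w \<omega> * sin (v * X \<omega>) \<partial>M) = (\<integral>\<omega>. w' \<omega> * sin (v * Y \<omega>) \<partial>N)"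
    and h[measurable]: "h \<in> borel_measurable borel"
  shows "(\<integral>\<omega>. w \<omega> * h (X \<omega>) \<partial>M) = (\<integral>\<omega>. w' \<omega> * h (Y \<omega>) \<partial>N)"
proof -
  have [measurable]: "w \<in> borel_measurable M" "w' \<in> borel_measurable N" using w w' by auto
  define m where "m = (\<integral>\<omega>. w \<omega> \<partial>M)"
  have m': "m = (\<integral>\<omega>. w' \<omega> \<partial>N)" using c[of 0] by (simp add: m_def)
  have m0: "m \<ge> 0" unfolding m_def using w by simp
  show ?thesis
  proof (cases "m = 0")
    case True
    have "AE \<omega> in M. w \<omega> = 0" using True w integral_nonneg_eq_0_iff_AE[of M w] unfolding m_def by auto
    then have "(\<integral>\<omega>. w \<omega> * h (X \<omega>) \<partial>M) = (\<integral>\<omega>. 0 \<partial>M)" by (intro integral_cong_AE) auto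
    moreover have "AE \<omega> in N. w' \<omega> = 0" using True w' integral_nonneg_eq_0_iff_AE[of N w'] unfolding m' by auto
    then have "(\<integral>\<omega>. w' \<omega> * h (Y \<omega>) \<partial>N) = (\<integral>\<omega>. 0 \<partial>N)" by (intro integral_cong_AE) auto
    ultimately show ?thesis by simp
  next
    case False
    with m0 have mp: "m > 0" by simp
    define P where "P = density M (\<lambda>\<omega>. ennreal (w \<omega> / m))"
    define Q where "Q = density N (\<lambda>\<omega>. ennreal (w' \<omega> / m))"
    have P: "prob_space P"
    proof
      have "emeasure P (space P) = (\<integral>\<^sup>+\<omega>. ennreal (w \<omega> / m) \<partial>M)"
        unfolding P_def by (subst emeasure_density) (auto intro!: nn_integral_cong simp: space_density)
      also have "\<dots> = ennreal (\<integral>\<omega>. w \<omega> / m \<partial>M)" using w mp by (intro nn_integral_eq_integral) auto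
      also have "\<dots> = 1" using mp by (simp add: m_def)
      finally show "emeasure P (space P) = 1" .
    qed
    have Q: "prob_space Q"
    proof
      have "emeasure Q (space Q) = (\<integral>\<^sup>+\<omega>. ennreal (w' \<omega> / m) \<partial>N)"
        unfolding Q_def by (subst emeasure_density) (auto intro!: nn_integral_cong simp: space_density)
      also have "\<dots> = ennreal (\<integral>\<omega>. w' \<omega> / m \<partial>N)" using w' mp by (intro nn_integral_eq_integral) auto
      also have "\<dots> = 1" using mp by (simp add: m')
      finally show "emeasure Q (space Q) = 1" .
    qed
    interpret P: prob_space P by fact
    interpret Q: prob_space Q by fact
    have XP[measurable]: "X \<in> borel_measurable P" by (simp add: P_def)
    have YQ[measurable]: "Y \<in> borel_measurable Q" by (simp add: Q_def)
    have iP: "(\<integral>\<omega>. h (X \<omega>) \<partial>P) = (\<integral>\<omega>. w \<omega> * h (X \<omega>) \<partial>M) / m"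
      if [measurable]: "h \<in> borel_measurable borel" for h :: "real \<Rightarrow> real"
      unfolding P_def using w mp by (subst integral_density) auto
    have iQ: "(\<integral>\<omega>. h (Y \<omega>) \<partial>Q) = (\<integral>\<omega>. w' \<omega> * h (Y \<omega>) \<partial>N) / m"
      if [measurable]: "h \<in> borel_measurable borel" for h :: "real \<Rightarrow> real"
      unfolding Q_def using w' mp by (subst integral_density) auto
    have "char (distr P borel X) = char (distr Q borel Y)"
    proof
      fix v
      show "char (distr P borel X) v = char (distr Q borel Y) v"
        using c[of v] s[of v] iP[of "\<lambda>x. cos (v * x)"] iQ[of "\<lambda>x. cos (v * x)"]
          iP[of "\<lambda>x. sin (v * x)"] iQ[of "\<lambda>x. sin (v * x)"]
        by (simp add: char_distr_eq_Complex[OF P XP] char_distr_eq_Complex[OF Q YQ])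
    qed
    then have eq: "distr P borel X = distr Q borel Y"
      by (intro Levy_uniqueness P.real_distribution_distr Q.real_distribution_distr XP YQ)
    have "(\<integral>\<omega>. h (X \<omega>) \<partial>P) = (\<integral>x. h x \<partial>distr P borel X)"
      by (rule integral_distr[symmetric]) auto
    also have "\<dots> = (\<integral>\<omega>. h (Y \<omega>) \<partial>Q)" unfolding eq by (rule integral_distr) auto
    finally show ?thesis using iP[OF h] iQ[OF h] mp by simp
  qed
qed

text \<open>The coordinates in \<open>P\<close> have already been turned from Fourier modes into indicators.  The
  inductive step applies \<open>weighted_law_eqI\<close> to the nonnegative weights \<open>1 + cos U\<close> and \<open>1 + sin U\<close>.\<close>

lemma joint_char_eq_imp_box_weights:
  fixes X :: "'i \<Rightarrow> 'a \<Rightarrow> real" and Y :: "'i \<Rightarrow> 'b \<Rightarrow> real"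
  assumes "prob_space M" "prob_space N" and J: "finite J"
    and X: "\<And>j. j \<in> J \<Longrightarrow> X j \<in> borel_measurable M"
    and Y: "\<And>j. j \<in> J \<Longrightarrow> Y j \<in> borel_measurable N"
    and B: "\<And>j. j \<in> J \<Longrightarrow> B j \<in> sets borel"
    and char: "\<And>u. char (distr M borel (\<lambda>\<omega>. \<Sum>j\<in>J. u j * X j \<omega>)) 1
                 = char (distr N borel (\<lambda>\<omega>. \<Sum>j\<in>J. u j * Y j \<omega>)) 1"
    and "P \<subseteq> J"
  shows "(\<integral>\<omega>. (\<Prod>j\<in>P. indicator (B j) (X j \<omega>)) * cos (\<Sum>j\<in>J. u j * X j \<omega>) \<partial>M)
       = (\<integral>\<omega>. (\<Prod>j\<in>P. indicator (B j) (Y j \<omega>)) * cos (\<Sum>j\<in>J. u j * Y j \<omega>) \<partial>N)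
     \<and> (\<integral>\<omega>. (\<Prod>j\<in>P. indicator (B j) (X j \<omega>)) * sin (\<Sum>j\<in>J. u j * X j \<omega>) \<partial>M)
       = (\<integral>\<omega>. (\<Prod>j\<in>P. indicator (B j) (Y j \<omega>)) * sin (\<Sum>j\<in>J. u j * Y j \<omega>) \<partial>N)"
proof -
  interpret M: prob_space M by fact
  interpret N: prob_space N by fact
  have "finite P" using \<open>P \<subseteq> J\<close> J by (rule finite_subset)
  then show ?thesis using \<open>P \<subseteq> J\<close>
  proof (induction P arbitrary: u)
    case empty
    have mX: "(\<lambda>\<omega>. \<Sum>j\<in>J. u j * X j \<omega>) \<in> borel_measurable M" using X by measurable
    have mY: "(\<lambda>\<omega>. \<Sum>j\<in>J. u j * Y j \<omega>) \<in> borel_measurable N" using Y by measurable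
    show ?case using char[of u]
      by (simp add: char_distr_eq_Complex[OF assms(1) mX] char_distr_eq_Complex[OF assms(2) mY])
  next
    case (insert k P)
    then have k: "k \<in> J" "k \<notin> P" "finite P" "P \<subseteq> J" by auto
    define iX :: "'a \<Rightarrow> real" where "iX \<omega> = (\<Prod>j\<in>P. indicator (B j) (X j \<omega>))" for \<omega>
    define iY :: "'b \<Rightarrow> real" where "iY \<omega> = (\<Prod>j\<in>P. indicator (B j) (Y j \<omega>))" for \<omega>
    define UX where "UX \<omega> = (\<Sum>j\<in>J. u j * X j \<omega>)" for \<omega>
    define UY where "UY \<omega> = (\<Sum>j\<in>J. u j * Y j \<omega>)" for \<omega>
    have [measurable]: "X k \<in> borel_measurable M" "Y k \<in> borel_measurable N" "B k \<in> sets borel"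
      using k X Y B by auto
    have [measurable]: "iX \<in> borel_measurable M" unfolding iX_def
    proof (intro borel_measurable_prod)
      fix j assume "j \<in> P"
      then have [measurable]: "X j \<in> borel_measurable M" "B j \<in> sets borel" using k X B by auto
      show "(\<lambda>\<omega>. indicator (B j) (X j \<omega>) :: real) \<in> borel_measurable M" by measurable
    qed
    have [measurable]: "iY \<in> borel_measurable N" unfolding iY_def
    proof (intro borel_measurable_prod)
      fix j assume "j \<in> P"
      then have [measurable]: "Y j \<in> borel_measurable N" "B j \<in> sets borel" using k Y B by auto
      show "(\<lambda>\<omega>. indicator (B j) (Y j \<omega>) :: real) \<in> borel_measurable N" by measurable
    qed
    have [measurable]: "UX \<in> borel_measurable M" using X unfolding UX_def by measurable
    have [measurable]: "UY \<in> borel_measurable N" using Y unfolding UY_def by measurable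
    have iX: "0 \<le> iX \<omega>" "iX \<omega> \<le> 1" for \<omega> unfolding iX_def
      by (auto intro!: prod_nonneg prod_le_1 simp: indicator_def)
    have iY: "0 \<le> iY \<omega>" "iY \<omega> \<le> 1" for \<omega> unfolding iY_def
      by (auto intro!: prod_nonneg prod_le_1 simp: indicator_def)
    have intM: "integrable M (\<lambda>\<omega>. iX \<omega> * f \<omega>)"
      if "f \<in> borel_measurable M" "\<And>\<omega>. \<bar>f \<omega>\<bar> \<le> C" for f :: "'a \<Rightarrow> real" and C
    proof (rule M.integrable_const_bound[of _ C])
      show "AE \<omega> in M. norm (iX \<omega> * f \<omega>) \<le> C"
      proof (rule AE_I2)
        fix \<omega>
        have "\<bar>iX \<omega>\<bar> * \<bar>f \<omega>\<bar> \<le> 1 * C" by (intro mult_mono) (use iX[of \<omega>] that(2) in auto)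
        then show "norm (iX \<omega> * f \<omega>) \<le> C" by (simp add: abs_mult)
      qed
    qed (use that in simp)
    have intN: "integrable N (\<lambda>\<omega>. iY \<omega> * f \<omega>)"
      if "f \<in> borel_measurable N" "\<And>\<omega>. \<bar>f \<omega>\<bar> \<le> C" for f :: "'b \<Rightarrow> real" and C
    proof (rule N.integrable_const_bound[of _ C])
      show "AE \<omega> in N. norm (iY \<omega> * f \<omega>) \<le> C"
      proof (rule AE_I2)
        fix \<omega>
        have "\<bar>iY \<omega>\<bar> * \<bar>f \<omega>\<bar> \<le> 1 * C" by (intro mult_mono) (use iY[of \<omega>] that(2) in auto)
        then show "norm (iY \<omega> * f \<omega>) \<le> C" by (simp add: abs_mult)
      qed
    qed (use that in simp)
    \<comment> \<open>Moving the frequency vector in the direction of coordinate \<open>k\<close>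
      puts any multiple of \<open>X k\<close> into the phase; \<open>a = 0\<close> removes the other
      coordinates from it.\<close>
    have IH: "(\<integral>\<omega>. iX \<omega> * cos (a * UX \<omega> + v * X k \<omega>) \<partial>M) = (\<integral>\<omega>. iY \<omega> * cos (a * UY \<omega> + v * Y k \<omega>) \<partial>N)"
             "(\<integral>\<omega>. iX \<omega> * sin (a * UX \<omega> + v * X k \<omega>) \<partial>M) = (\<integral>\<omega>. iY \<omega> * sin (a * UY \<omega> + v * Y k \<omega>) \<partial>N)" for a v
    proof -
      have eX: "(\<Sum>j\<in>J. (a * u j + (if j = k then v else 0)) * X j \<omega>) = a * UX \<omega> + v * X k \<omega>" for \<omega>
        using J k by (simp add: UX_def distrib_right sum.distrib if_distrib[of "\<lambda>x. x * _"] sum_distrib_left sum.delta mult.assoc cong: if_cong)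
      have eY: "(\<Sum>j\<in>J. (a * u j + (if j = k then v else 0)) * Y j \<omega>) = a * UY \<omega> + v * Y k \<omega>" for \<omega>
        using J k by (simp add: UY_def distrib_right sum.distrib if_distrib[of "\<lambda>x. x * _"] sum_distrib_left sum.delta mult.assoc cong: if_cong)
      show "(\<integral>\<omega>. iX \<omega> * cos (a * UX \<omega> + v * X k \<omega>) \<partial>M) = (\<integral>\<omega>. iY \<omega> * cos (a * UY \<omega> + v * Y k \<omega>) \<partial>N)"
           "(\<integral>\<omega>. iX \<omega> * sin (a * UX \<omega> + v * X k \<omega>) \<partial>M) = (\<integral>\<omega>. iY \<omega> * sin (a * UY \<omega> + v * Y k \<omega>) \<partial>N)"
        using insert.IH[OF k(4), of "\<lambda>j. a * u j + (if j = k then v else 0)"]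
        unfolding eX eY iX_def iY_def by auto
    qed
    have lin: "(\<integral>\<omega>. iX \<omega> * (\<Sum>i\<in>I. c i * F i (a i * UX \<omega> + v i * X k \<omega>)) \<partial>M)
       = (\<integral>\<omega>. iY \<omega> * (\<Sum>i\<in>I. c i * F i (a i * UY \<omega> + v i * Y k \<omega>)) \<partial>N)"
      if "\<And>i. F i = cos \<or> F i = sin" for I :: "nat set" and c a v and F :: "nat \<Rightarrow> real \<Rightarrow> real"
    proof -
      have F[measurable]: "F i \<in> borel_measurable borel" and F1: "\<And>x. \<bar>F i x\<bar> \<le> 1" for i using that[of i] by auto
      have iM: "integrable M (\<lambda>\<omega>. c i * (iX \<omega> * F i (a i * UX \<omega> + v i * X k \<omega>)))" for i
        by (rule integrable_mult_right, rule intM[of _ 1]) (simp_all add: F1)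
      have iN: "integrable N (\<lambda>\<omega>. c i * (iY \<omega> * F i (a i * UY \<omega> + v i * Y k \<omega>)))" for i
        by (rule integrable_mult_right, rule intN[of _ 1]) (simp_all add: F1)
      have eq: "(\<integral>\<omega>. iX \<omega> * F i (a i * UX \<omega> + v i * X k \<omega>) \<partial>M) = (\<integral>\<omega>. iY \<omega> * F i (a i * UY \<omega> + v i * Y k \<omega>) \<partial>N)" for i
        using that[of i] by (rule disjE) (simp_all only: IH)
      have "(\<integral>\<omega>. iX \<omega> * (\<Sum>i\<in>I. c i * F i (a i * UX \<omega> + v i * X k \<omega>)) \<partial>M)
         = (\<integral>\<omega>. (\<Sum>i\<in>I. c i * (iX \<omega> * F i (a i * UX \<omega> + v i * X k \<omega>))) \<partial>M)"
        by (intro Bochner_Integration.integral_cong refl) (simp add: sum_distrib_left mult.left_commute)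
      also have "\<dots> = (\<Sum>i\<in>I. c i * (\<integral>\<omega>. iX \<omega> * F i (a i * UX \<omega> + v i * X k \<omega>) \<partial>M))"
        by (subst Bochner_Integration.integral_sum[OF iM]) simp
      also have "\<dots> = (\<Sum>i\<in>I. c i * (\<integral>\<omega>. iY \<omega> * F i (a i * UY \<omega> + v i * Y k \<omega>) \<partial>N))"
        by (simp only: eq)
      also have "\<dots> = (\<integral>\<omega>. (\<Sum>i\<in>I. c i * (iY \<omega> * F i (a i * UY \<omega> + v i * Y k \<omega>))) \<partial>N)"
        by (subst Bochner_Integration.integral_sum[OF iN]) simp
      also have "\<dots> = (\<integral>\<omega>. iY \<omega> * (\<Sum>i\<in>I. c i * F i (a i * UY \<omega> + v i * Y k \<omega>)) \<partial>N)"
        by (intro Bochner_Integration.integral_cong refl) (simp add: sum_distrib_left mult.left_commute)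
      finally show ?thesis .
    qed
    have base: "(\<integral>\<omega>. iX \<omega> * indicator (B k) (X k \<omega>) \<partial>M) = (\<integral>\<omega>. iY \<omega> * indicator (B k) (Y k \<omega>) \<partial>N)"
      using intM[of "\<lambda>_. 1" 1] intN[of "\<lambda>_. 1" 1] iX iY IH(1)[of 0] IH(2)[of 0]
      by (intro weighted_law_eqI[where h = "indicator (B k)" and X = "X k" and Y = "Y k"]) auto
    \<comment> \<open>The weight \<open>iX * G UX\<close> may change sign. Adding 1 to
      \<open>G\<close> makes it nonnegative, and \<open>fin\<close> removes the added part again by
      means of \<open>base\<close>.\<close>
    have step: "(\<integral>\<omega>. iX \<omega> * (1 + G (UX \<omega>)) * indicator (B k) (X k \<omega>) \<partial>M)
       = (\<integral>\<omega>. iY \<omega> * (1 + G (UY \<omega>)) * indicator (B k) (Y k \<omega>) \<partial>N)"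
      if G: "G = cos \<or> G = sin" for G :: "real \<Rightarrow> real"
    proof (rule weighted_law_eqI[where h = "indicator (B k)" and X = "X k" and Y = "Y k"])
      have G1: "\<bar>G x\<bar> \<le> 1" "G \<in> borel_measurable borel" for x using G by auto
      have Gg: "0 \<le> 1 + G x" for x using G1(1)[of x] by linarith
      have G2: "\<bar>1 + G x\<bar> \<le> 2" for x using G1(1)[of x] by linarith
      note [measurable] = G1(2)
      show "integrable M (\<lambda>\<omega>. iX \<omega> * (1 + G (UX \<omega>)))" using G2 by (intro intM[of _ 2]) auto
      show "integrable N (\<lambda>\<omega>. iY \<omega> * (1 + G (UY \<omega>)))" using G2 by (intro intN[of _ 2]) auto
      show "0 \<le> iX \<omega> * (1 + G (UX \<omega>))" for \<omega> using iX Gg by auto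
      show "0 \<le> iY \<omega> * (1 + G (UY \<omega>))" for \<omega> using iY Gg by auto
      fix v :: real
      have e: "\<exists>c a w F. (\<forall>i. F i = cos \<or> F i = sin) \<and>
          (\<forall>U x. (1 + G U) * K (v * x) = (\<Sum>i<3::nat. c i * F i (a i * U + w i * x :: real)))"
        if K: "K = cos \<or> K = sin" for K :: "real \<Rightarrow> real"
      proof -
        have p: "cos U * cos x = (cos (U + x) + cos (U - x)) / 2"
             "sin U * cos x = (sin (U + x) + sin (U - x)) / 2"
             "cos U * sin x = (sin (U + x) - sin (U - x)) / 2"
             "sin U * sin x = (cos (U - x) - cos (U + x)) / 2" for U x :: real
          by (simp_all add: sin_add cos_add sin_diff cos_diff)
        \<comment> \<open>Index 0 carries the phase \<open>v * x\<close> contributed by the constant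
          1, hence \<open>a 0 = 0\<close>. Indices 1 and 2 carry the phases \<open>U + v * x\<close>
          and \<open>U - v * x\<close> of the product formulas \<open>p\<close>; the parameter of
          \<open>c\<close> is the sign of the former.\<close>
        define c where "c = (\<lambda>s (i::nat). if i = 0 then 1 else if i = 1 then s / 2 else 1/2 :: real)"
        define a where "a = (\<lambda>i::nat. if i = 0 then 0 else 1 :: real)"
        define w where "w = (\<lambda>i::nat. if i = 2 then - v else v)"
        show ?thesis
        proof (cases "G = cos")
          case Gc: True
          show ?thesis
          proof (cases "K = cos")
            case True
            show ?thesis
              by (rule exI[of _ "c 1"], rule exI[of _ a], rule exI[of _ w], rule exI[of _ "\<lambda>_. cos"])
                (auto simp: Gc True distrib_right p c_def a_def w_def numeral_3_eq_3 add_divide_distrib diff_divide_distrib)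
          next
            case False
            then have "K = sin" using K by simp
            then show ?thesis
              by (intro exI[of _ "\<lambda>i. if i = 2 then -1/2 else c 1 i"] exI[of _ a] exI[of _ w] exI[of _ "\<lambda>_. sin"])
                (auto simp: Gc distrib_right p c_def a_def w_def numeral_3_eq_3 add_divide_distrib diff_divide_distrib)
          qed
        next
          case False
          then have Gs: "G = sin" using G by simp
          show ?thesis
          proof (cases "K = cos")
            case True
            show ?thesis
              by (rule exI[of _ "c 1"], rule exI[of _ a], rule exI[of _ w], rule exI[of _ "\<lambda>i. if i = 0 then cos else sin"])
                (auto simp: Gs True distrib_right p c_def a_def w_def numeral_3_eq_3 add_divide_distrib diff_divide_distrib)
          next
            case False
            then have "K = sin" using K by simp
            then show ?thesis
              by (intro exI[of _ "c (-1)"] exI[of _ a] exI[of _ w] exI[of _ "\<lambda>i. if i = 0 then sin else cos"])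
                (auto simp: Gs distrib_right p c_def a_def w_def numeral_3_eq_3 add_divide_distrib diff_divide_distrib)
          qed
        qed
      qed
      have "(\<integral>\<omega>. iX \<omega> * (1 + G (UX \<omega>)) * K (v * X k \<omega>) \<partial>M) = (\<integral>\<omega>. iY \<omega> * (1 + G (UY \<omega>)) * K (v * Y k \<omega>) \<partial>N)"
        if K: "K = cos \<or> K = sin" for K :: "real \<Rightarrow> real"
      proof -
        obtain c a w F where F: "\<And>i. F i = cos \<or> F i = sin" and
          id: "\<And>U x. (1 + G U) * K (v * x) = (\<Sum>i<3::nat. c i * F i (a i * U + w i * x :: real))"
          using e[OF K] by blast
        show ?thesis unfolding mult.assoc id by (rule lin[OF F])
      qed
      then show "(\<integral>\<omega>. iX \<omega> * (1 + G (UX \<omega>)) * cos (v * X k \<omega>) \<partial>M) = (\<integral>\<omega>. iY \<omega> * (1 + G (UY \<omega>)) * cos (v * Y k \<omega>) \<partial>N)"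
        "(\<integral>\<omega>. iX \<omega> * (1 + G (UX \<omega>)) * sin (v * X k \<omega>) \<partial>M) = (\<integral>\<omega>. iY \<omega> * (1 + G (UY \<omega>)) * sin (v * Y k \<omega>) \<partial>N)"
        by blast+
    qed auto
    have fin: "(\<integral>\<omega>. iX \<omega> * (indicator (B k) (X k \<omega>) * G (UX \<omega>)) \<partial>M)
       = (\<integral>\<omega>. iY \<omega> * (indicator (B k) (Y k \<omega>) * G (UY \<omega>)) \<partial>N)"
      if G: "G = cos \<or> G = sin" for G :: "real \<Rightarrow> real"
    proof -
      have G1: "\<bar>G x\<bar> \<le> 1" "G \<in> borel_measurable borel" for x using G by auto
      note [measurable] = G1(2)
      have ind: "\<bar>indicat_real S x * y\<bar> \<le> 1" if "\<bar>y\<bar> \<le> 1" for S :: "real set" and x y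
        using that by (auto simp: indicator_def)
      have "(\<integral>\<omega>. iX \<omega> * (1 + G (UX \<omega>)) * indicator (B k) (X k \<omega>) \<partial>M)
        = (\<integral>\<omega>. iX \<omega> * indicator (B k) (X k \<omega>) + iX \<omega> * (indicator (B k) (X k \<omega>) * G (UX \<omega>)) \<partial>M)"
        by (simp add: algebra_simps)
      also have "\<dots> = (\<integral>\<omega>. iX \<omega> * indicator (B k) (X k \<omega>) \<partial>M) + (\<integral>\<omega>. iX \<omega> * (indicator (B k) (X k \<omega>) * G (UX \<omega>)) \<partial>M)"
        by (intro Bochner_Integration.integral_add intM[of _ 1]) (auto simp: ind G1)
      finally have 1: "(\<integral>\<omega>. iX \<omega> * (1 + G (UX \<omega>)) * indicator (B k) (X k \<omega>) \<partial>M) = \<dots>" .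
      have "(\<integral>\<omega>. iY \<omega> * (1 + G (UY \<omega>)) * indicator (B k) (Y k \<omega>) \<partial>N)
        = (\<integral>\<omega>. iY \<omega> * indicator (B k) (Y k \<omega>) + iY \<omega> * (indicator (B k) (Y k \<omega>) * G (UY \<omega>)) \<partial>N)"
        by (simp add: algebra_simps)
      also have "\<dots> = (\<integral>\<omega>. iY \<omega> * indicator (B k) (Y k \<omega>) \<partial>N) + (\<integral>\<omega>. iY \<omega> * (indicator (B k) (Y k \<omega>) * G (UY \<omega>)) \<partial>N)"
        by (intro Bochner_Integration.integral_add intN[of _ 1]) (auto simp: ind G1)
      finally show ?thesis using 1 step[OF G] base by simp
    qed
    show ?case using fin[of cos] fin[of sin] k
      by (simp add: iX_def iY_def UX_def UY_def mult_ac)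
  qed
qed

text \<open>The case \<open>P = J\<close>, \<open>u = 0\<close>, in which every Fourier mode has
  become an indicator and the cosine is 1. Boxes are the only joint events compared below, so
  equality of joint laws is never stated.\<close>

lemma joint_char_eq_imp_box_prob_eq:
  fixes X :: "'i \<Rightarrow> 'a \<Rightarrow> real" and Y :: "'i \<Rightarrow> 'b \<Rightarrow> real"
  assumes "prob_space M" "prob_space N" and J: "finite J"
    and X: "\<And>j. j \<in> J \<Longrightarrow> X j \<in> borel_measurable M"
    and Y: "\<And>j. j \<in> J \<Longrightarrow> Y j \<in> borel_measurable N"
    and B: "\<And>j. j \<in> J \<Longrightarrow> B j \<in> sets borel"
    and char: "\<And>u. char (distr M borel (\<lambda>\<omega>. \<Sum>j\<in>J. u j * X j \<omega>)) 1
                 = char (distr N borel (\<lambda>\<omega>. \<Sum>j\<in>J. u j * Y j \<omega>)) 1"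
  shows "measure M {\<omega>\<in>space M. \<forall>j\<in>J. X j \<omega> \<in> B j} = measure N {\<omega>\<in>space N. \<forall>j\<in>J. Y j \<omega> \<in> B j}"
proof -
  have e: "(\<Prod>j\<in>J. indicat_real (B j) (Z j)) = indicator {z. \<forall>j\<in>J. z j \<in> B j} Z" for Z :: "'i \<Rightarrow> real"
    using J by (induction J) (auto simp: indicator_def)
  have "(\<integral>\<omega>. (\<Prod>j\<in>J. indicat_real (B j) (X j \<omega>)) \<partial>M) = (\<integral>\<omega>. (\<Prod>j\<in>J. indicat_real (B j) (Y j \<omega>)) \<partial>N)"
    using joint_char_eq_imp_box_weights[OF assms subset_refl, where u = "\<lambda>_. 0"] by simp
  moreover have "(\<integral>\<omega>. (\<Prod>j\<in>J. indicat_real (B j) (X j \<omega>)) \<partial>M) = (\<integral>\<omega>. indicator {\<omega>\<in>space M. \<forall>j\<in>J. X j \<omega> \<in> B j} \<omega> \<partial>M)"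
    by (intro Bochner_Integration.integral_cong) (auto simp only: e, auto simp: indicator_def)
  moreover have "(\<integral>\<omega>. (\<Prod>j\<in>J. indicat_real (B j) (Y j \<omega>)) \<partial>N) = (\<integral>\<omega>. indicator {\<omega>\<in>space N. \<forall>j\<in>J. Y j \<omega> \<in> B j} \<omega> \<partial>N)"
    by (intro Bochner_Integration.integral_cong) (auto simp only: e, auto simp: indicator_def)
  moreover have "{\<omega>\<in>space M. \<forall>j\<in>J. X j \<omega> \<in> B j} \<subseteq> space M" "{\<omega>\<in>space N. \<forall>j\<in>J. Y j \<omega> \<in> B j} \<subseteq> space N" by auto
  ultimately show ?thesis by (simp add: Int_absorb1 Int_absorb2)
qed

subsection \<open>Shifts of Gaussian vectors\<close>

lemma char_distr_eq_of_real_iff: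
  fixes X :: "'a \<Rightarrow> real"
  assumes "prob_space M" "X \<in> borel_measurable M"
  shows "char (distr M borel X) 1 = of_real r \<longleftrightarrow> (\<integral>\<omega>. cos (X \<omega>) \<partial>M) = r \<and> (\<integral>\<omega>. sin (X \<omega>) \<partial>M) = 0"
  using char_distr_eq_Complex[OF assms, of 1] by (auto simp: complex_eq_iff)

lemma char_distr_scale:
  assumes [measurable]: "X \<in> borel_measurable M"
  shows "char (distr M borel X) v = char (distr M borel (\<lambda>\<omega>. v * X \<omega> :: real)) 1"
  by (simp add: char_def integral_distr)

lemma std_normal_density_tilt:
  "std_normal_density z * exp (\<sigma> * z) = exp (\<sigma>\<^sup>2 / 2) * std_normal_density (z - \<sigma>)"
proof -
  have "- z\<^sup>2 / 2 + \<sigma> * z = \<sigma>\<^sup>2 / 2 + - (z - \<sigma>)\<^sup>2 / 2"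
    by (simp add: power2_eq_square field_simps)
  then have "exp (- z\<^sup>2 / 2) * exp (\<sigma> * z) = exp (\<sigma>\<^sup>2 / 2) * exp (- (z - \<sigma>)\<^sup>2 / 2)"
    by (simp only: exp_add[symmetric])
  then show ?thesis by (simp add: std_normal_density_def)
qed

lemma integrable_exp_std_normal:
  "integrable lborel (\<lambda>z. std_normal_density z * exp (\<sigma> * z))"
proof -
  have "integrable lborel (\<lambda>z. exp (\<sigma>\<^sup>2 / 2) * normal_density \<sigma> 1 z)" by simp
  also have "(\<lambda>z. exp (\<sigma>\<^sup>2 / 2) * normal_density \<sigma> 1 z) = (\<lambda>z. std_normal_density z * exp (\<sigma> * z))"
    unfolding std_normal_density_tilt by (simp add: normal_density_def)
  finally show ?thesis .
qed

text \<open>By \<open>std_normal_density_tilt\<close> the factor \<open>exp (\<sigma> * z)\<close>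
  only translates the density by \<open>\<sigma>\<close>. Once the translation is undone, addition
  formulas reduce everything to the characteristic function of the standard normal law at
  \<open>b\<close>.\<close>

lemma std_normal_tilted_trig:
  "(\<integral>z. std_normal_density z * (exp (\<sigma> * z) * cos (b * z)) \<partial>lborel) = exp (\<sigma>\<^sup>2 / 2 - b\<^sup>2 / 2) * cos (b * \<sigma>)"
  "(\<integral>z. std_normal_density z * (exp (\<sigma> * z) * sin (b * z)) \<partial>lborel) = exp (\<sigma>\<^sup>2 / 2 - b\<^sup>2 / 2) * sin (b * \<sigma>)"
proof -
  interpret N: real_distribution std_normal_distribution by (rule real_dist_normal_dist)
  have "char (distr std_normal_distribution borel (\<lambda>z. z)) b = exp (- b\<^sup>2 / 2)"
    using char_std_normal_distribution by (simp add: distr_id2)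
  then have c0: "(\<integral>z. cos (b * z) \<partial>std_normal_distribution) = exp (- b\<^sup>2 / 2)"
    and s0: "(\<integral>z. sin (b * z) \<partial>std_normal_distribution) = 0"
    by (auto simp: char_distr_eq_Complex N.prob_space_axioms complex_eq_iff)
  have cos: "(\<integral>z. std_normal_density z * cos (b * z) \<partial>lborel) = exp (- b\<^sup>2 / 2)"
    and sin: "(\<integral>z. std_normal_density z * sin (b * z) \<partial>lborel) = 0"
    using c0 s0 by (simp_all add: integral_density)
  have int: "integrable lborel (\<lambda>z. std_normal_density z * K (b * z))"
    if "K \<in> borel_measurable borel" "\<And>x. \<bar>K x\<bar> \<le> 1" for K :: "real \<Rightarrow> real"
  proof (rule Bochner_Integration.integrable_bound[of lborel std_normal_density])
    note [measurable] = that(1)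
    show "(\<lambda>z. std_normal_density z * K (b * z)) \<in> borel_measurable lborel" by measurable
    show "AE z in lborel. norm (std_normal_density z * K (b * z)) \<le> norm (std_normal_density z)"
      using that(2) by (auto simp: abs_mult intro!: mult_left_le)
  qed simp
  note int = int[of cos, simplified] int[of sin, simplified]
  have shift: "(\<integral>z. std_normal_density z * (exp (\<sigma> * z) * f z) \<partial>lborel)
       = exp (\<sigma>\<^sup>2 / 2) * (\<integral>z. std_normal_density z * f (\<sigma> + z) \<partial>lborel)"
       for f :: "real \<Rightarrow> real"
  proof -
    have "(\<integral>z. std_normal_density z * (exp (\<sigma> * z) * f z) \<partial>lborel)
       = (\<integral>z. exp (\<sigma>\<^sup>2 / 2) * (std_normal_density (z - \<sigma>) * f z) \<partial>lborel)"
      by (simp only: mult.assoc[symmetric] std_normal_density_tilt)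
    also have "\<dots> = exp (\<sigma>\<^sup>2 / 2) * (\<integral>z. std_normal_density (z - \<sigma>) * f z \<partial>lborel)" by simp
    also have "(\<integral>z. std_normal_density (z - \<sigma>) * f z \<partial>lborel) = (\<integral>z. std_normal_density z * f (\<sigma> + z) \<partial>lborel)"
      by (subst lborel_integral_real_affine[where c=1 and t=\<sigma>]) auto
    finally show ?thesis .
  qed
  have ex: "exp (\<sigma>\<^sup>2 / 2) * exp (- b\<^sup>2 / 2) = exp (\<sigma>\<^sup>2 / 2 - b\<^sup>2 / 2)"
    by (simp add: exp_add[symmetric])
  have "(\<integral>z. std_normal_density z * cos (b * (\<sigma> + z)) \<partial>lborel)
      = (\<integral>z. cos (b * \<sigma>) * (std_normal_density z * cos (b * z)) - sin (b * \<sigma>) * (std_normal_density z * sin (b * z)) \<partial>lborel)"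
    by (intro Bochner_Integration.integral_cong refl) (simp add: cos_add algebra_simps)
  also have "\<dots> = cos (b * \<sigma>) * exp (- b\<^sup>2 / 2)"
    using int by (subst Bochner_Integration.integral_diff) (auto simp: cos sin)
  finally show "(\<integral>z. std_normal_density z * (exp (\<sigma> * z) * cos (b * z)) \<partial>lborel) = exp (\<sigma>\<^sup>2 / 2 - b\<^sup>2 / 2) * cos (b * \<sigma>)"
    unfolding shift ex[symmetric] by simp
  have "(\<integral>z. std_normal_density z * sin (b * (\<sigma> + z)) \<partial>lborel)
      = (\<integral>z. sin (b * \<sigma>) * (std_normal_density z * cos (b * z)) + cos (b * \<sigma>) * (std_normal_density z * sin (b * z)) \<partial>lborel)"
    by (intro Bochner_Integration.integral_cong refl) (simp add: sin_add algebra_simps)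
  also have "\<dots> = sin (b * \<sigma>) * exp (- b\<^sup>2 / 2)"
    using int by (subst Bochner_Integration.integral_add) (auto simp: cos sin)
  finally show "(\<integral>z. std_normal_density z * (exp (\<sigma> * z) * sin (b * z)) \<partial>lborel) = exp (\<sigma>\<^sup>2 / 2 - b\<^sup>2 / 2) * sin (b * \<sigma>)"
    unfolding shift ex[symmetric] by simp
qed

text \<open>Here \<open>p\<close>, \<open>q\<close>, \<open>r\<close> play the roles of Var
  \<open>U\<close>, Cov \<open>(U, \<xi>)\<close> and Var \<open>\<xi>\<close>, encoded only in the
  characteristic function of the pair. Write \<open>U = V + b * Z\<close> with
  \<open>Z = \<xi> / \<sigma>\<close> standard normal and \<open>V\<close> uncorrelated with
  \<open>Z\<close>: the tilt acts on \<open>Z\<close> alone and moves the mean of \<open>U\<close>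
  by \<open>q\<close>. Independence of \<open>V\<close> and \<open>Z\<close> is used in the form
  that expectations of products factor.\<close>

lemma gaussian_pair_tilt:
  fixes U \<xi> :: "'a \<Rightarrow> real"
  assumes M: "prob_space M" and [measurable]: "U \<in> borel_measurable M" "\<xi> \<in> borel_measurable M"
    and "0 < r"
    and char: "\<And>s t. char (distr M borel (\<lambda>\<omega>. s * U \<omega> + t * \<xi> \<omega>)) 1
                 = of_real (exp (- (s\<^sup>2 * p + 2 * s * t * q + t\<^sup>2 * r) / 2))"
  shows "integrable M (\<lambda>\<omega>. exp (\<xi> \<omega>))"
    and "(\<integral>\<omega>. exp (\<xi> \<omega>) * cos (U \<omega>) \<partial>M) = exp ((r - p) / 2) * cos q"
    and "(\<integral>\<omega>. exp (\<xi> \<omega>) * sin (U \<omega>) \<partial>M) = exp ((r - p) / 2) * sin q"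
proof -
  interpret prob_space M by fact
  define \<sigma> where "\<sigma> = sqrt r"
  have \<sigma>: "\<sigma> > 0" "\<sigma>\<^sup>2 = r" "\<sigma> * \<sigma> = r" using \<open>0 < r\<close> by (auto simp: \<sigma>_def)
  \<comment> \<open>The regression coefficient Cov \<open>(U, Z)\<close>, which removes the mixed
    term of the quadratic form.\<close>
  define b where "b = q / \<sigma>"
  define Z where "Z \<omega> = \<xi> \<omega> / \<sigma>" for \<omega>
  define V where "V \<omega> = U \<omega> - b * Z \<omega>" for \<omega>
  have [measurable]: "Z \<in> borel_measurable M" unfolding Z_def by measurable
  have [measurable]: "V \<in> borel_measurable M" unfolding V_def by measurable
  have charVZ: "char (distr M borel (\<lambda>\<omega>. s * V \<omega> + t * Z \<omega>)) 1
                 = of_real (exp (- (s\<^sup>2 * (p - b\<^sup>2) + t\<^sup>2) / 2))" for s t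
  proof -
    define x where "x = (t - s * b) / \<sigma>"
    have x: "x * \<sigma> = t - s * b" "q = b * \<sigma>" using \<sigma> by (auto simp: x_def b_def)
    have "s * V \<omega> + t * Z \<omega> = s * U \<omega> + x * \<xi> \<omega>" for \<omega>
    proof -
      have "s * V \<omega> + t * Z \<omega> = s * U \<omega> + (t - s * b) * Z \<omega>" by (simp add: V_def algebra_simps)
      also have "(t - s * b) * Z \<omega> = x * \<xi> \<omega>" by (simp add: x_def Z_def)
      finally show ?thesis .
    qed
    moreover have "s\<^sup>2 * p + 2 * s * x * q + x\<^sup>2 * r = s\<^sup>2 * (p - b\<^sup>2) + t\<^sup>2"
    proof -
      have "s\<^sup>2 * p + 2 * s * x * q + x\<^sup>2 * r = s\<^sup>2 * p + 2 * s * b * (x * \<sigma>) + (x * \<sigma>)\<^sup>2"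
        by (simp add: x(2) \<sigma>(2)[symmetric] power_mult_distrib)
      also have "\<dots> = s\<^sup>2 * (p - b\<^sup>2) + t\<^sup>2"
        unfolding x(1) by (simp add: power2_eq_square algebra_simps)
      finally show ?thesis .
    qed
    ultimately show ?thesis using char[of s x] by simp
  qed
  have VZ: "expectation (\<lambda>\<omega>. cos (s * V \<omega> + t * Z \<omega>)) = exp (- (s\<^sup>2 * (p - b\<^sup>2) + t\<^sup>2) / 2)"
           "expectation (\<lambda>\<omega>. sin (s * V \<omega> + t * Z \<omega>)) = 0" for s t
    using charVZ[of s t] by (subst (asm) char_distr_eq_of_real_iff[OF M]; simp)+
  have "char (distr M borel Z) = char std_normal_distribution"
  proof
    fix v show "char (distr M borel Z) v = char std_normal_distribution v"
      using charVZ[of 0 v] by (simp add: char_std_normal_distribution char_distr_scale[of Z])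
  qed
  then have lawZ: "distr M borel Z = std_normal_distribution"
    by (intro Levy_uniqueness real_distribution_distr real_dist_normal_dist) auto
  have EZ: "expectation (\<lambda>\<omega>. f (Z \<omega>)) = (\<integral>z. std_normal_density z * f z \<partial>lborel)"
    and IZ: "integrable M (\<lambda>\<omega>. f (Z \<omega>)) \<longleftrightarrow> integrable lborel (\<lambda>z. std_normal_density z * f z)"
    if [measurable]: "f \<in> borel_measurable borel" for f :: "real \<Rightarrow> real"
  proof -
    have "expectation (\<lambda>\<omega>. f (Z \<omega>)) = (\<integral>z. f z \<partial>distr M borel Z)" by (simp add: integral_distr)
    also have "\<dots> = (\<integral>z. std_normal_density z * f z \<partial>lborel)" unfolding lawZ by (simp add: integral_density)
    finally show "expectation (\<lambda>\<omega>. f (Z \<omega>)) = (\<integral>z. std_normal_density z * f z \<partial>lborel)" .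
    have "integrable M (\<lambda>\<omega>. f (Z \<omega>)) \<longleftrightarrow> integrable (distr M borel Z) f" by (simp add: integrable_distr_eq)
    also have "\<dots> \<longleftrightarrow> integrable lborel (\<lambda>z. std_normal_density z * f z)" unfolding lawZ by (simp add: integrable_density)
    finally show "integrable M (\<lambda>\<omega>. f (Z \<omega>)) \<longleftrightarrow> integrable lborel (\<lambda>z. std_normal_density z * f z)" .
  qed
  have \<xi>: "\<xi> \<omega> = \<sigma> * Z \<omega>" for \<omega> using \<sigma> by (simp add: Z_def)
  show int: "integrable M (\<lambda>\<omega>. exp (\<xi> \<omega>))"
    unfolding \<xi> by (subst IZ) (auto simp: integrable_exp_std_normal)
  have bI: "integrable M (\<lambda>\<omega>. f \<omega>)" if "f \<in> borel_measurable M" "\<And>\<omega>. \<bar>f \<omega>\<bar> \<le> 2" for f :: "'a \<Rightarrow> real"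
    by (rule integrable_const_bound[of _ 2]) (use that in auto)
  have eI: "integrable M (\<lambda>\<omega>. G \<omega> * (exp (\<sigma> * Z \<omega>) * K (b * Z \<omega>)))"
    if "G \<in> borel_measurable M" "\<And>\<omega>. \<bar>G \<omega>\<bar> \<le> 1" "K \<in> borel_measurable borel" "\<And>x. \<bar>K x\<bar> \<le> 1" for G :: "'a \<Rightarrow> real" and K :: "real \<Rightarrow> real"
  proof (rule Bochner_Integration.integrable_bound[OF int])
    note [measurable] = that(1,3)
    show "(\<lambda>\<omega>. G \<omega> * (exp (\<sigma> * Z \<omega>) * K (b * Z \<omega>))) \<in> borel_measurable M" by measurable
    show "AE \<omega> in M. norm (G \<omega> * (exp (\<sigma> * Z \<omega>) * K (b * Z \<omega>))) \<le> norm (exp (\<xi> \<omega>))"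
    proof (rule AE_I2)
      fix \<omega>
      have "\<bar>G \<omega>\<bar> * \<bar>K (b * Z \<omega>)\<bar> \<le> 1 * 1" by (intro mult_mono that) auto
      then show "norm (G \<omega> * (exp (\<sigma> * Z \<omega>) * K (b * Z \<omega>))) \<le> norm (exp (\<xi> \<omega>))"
        unfolding \<xi> using mult_left_mono[of "\<bar>G \<omega>\<bar> * \<bar>K (b * Z \<omega>)\<bar>" 1 "exp (\<sigma> * Z \<omega>)"]
        by (simp add: abs_mult mult_ac)
    qed
  qed
  have one: "\<bar>1 + cos x\<bar> \<le> 2" "\<bar>1 + sin x\<bar> \<le> 2" "0 \<le> 1 + cos x" "0 \<le> 1 + sin x" for x :: real
    using abs_cos_le_one[of x] abs_sin_le_one[of x] by linarith+
  \<comment> \<open>Under the weight \<open>1 + G (V)\<close> and under a constant weight of the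
    same mass, \<open>Z\<close> has the same trigonometric moments, hence the same law up to that
    mass. This carries the factorisation from bounded trigonometric functions of \<open>Z\<close>
    over to the unbounded \<open>exp\<close>.\<close>
  have fact: "expectation (\<lambda>\<omega>. (1 + G (V \<omega>)) * (exp (\<sigma> * Z \<omega>) * K (b * Z \<omega>)))
     = (1 + expectation (\<lambda>\<omega>. G (V \<omega>))) * expectation (\<lambda>\<omega>. exp (\<sigma> * Z \<omega>) * K (b * Z \<omega>))"
    if G: "G = cos \<or> G = sin" and K[measurable]: "K \<in> borel_measurable borel" for G K :: "real \<Rightarrow> real"
  proof -
    have [measurable]: "G \<in> borel_measurable borel" using G by auto
    have G1: "\<bar>G x\<bar> \<le> 1" for x using G by auto
    have [simp]: "expectation (\<lambda>\<omega>. cos (t * Z \<omega>)) = exp (- t\<^sup>2 / 2)" "expectation (\<lambda>\<omega>. sin (t * Z \<omega>)) = 0" for t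
      using VZ[of 0 t] by simp_all
    have cV: "expectation (\<lambda>\<omega>. cos (V \<omega>)) = exp (- (p - b\<^sup>2) / 2)" and sV: "expectation (\<lambda>\<omega>. sin (V \<omega>)) = 0"
      using VZ[of 1 0] by simp_all
    have prod: "expectation (\<lambda>\<omega>. G (V \<omega>) * L (t * Z \<omega>)) = expectation (\<lambda>\<omega>. G (V \<omega>)) * expectation (\<lambda>\<omega>. L (t * Z \<omega>))"
      if L: "L = cos \<or> L = sin" for L t
    proof -
      have p: "cos U * cos x = cos (U + x)/2 + cos (U - x) / 2"
             "sin U * cos x = sin (U + x)/2 + sin (U - x) / 2"
             "cos U * sin x = sin (U + x)/2 - sin (U - x) / 2"
             "sin U * sin x = cos (U - x)/2 - cos (U + x) / 2" for U x :: real
        by (simp_all add: sin_add cos_add sin_diff cos_diff field_simps)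
      have E: "expectation (\<lambda>\<omega>. cos (V \<omega> + t * Z \<omega>)) = exp (- (p - b\<^sup>2) / 2) * exp (- t\<^sup>2 / 2)"
        "expectation (\<lambda>\<omega>. cos (V \<omega> - t * Z \<omega>)) = exp (- (p - b\<^sup>2) / 2) * exp (- t\<^sup>2 / 2)"
        "expectation (\<lambda>\<omega>. sin (V \<omega> + t * Z \<omega>)) = 0"
        "expectation (\<lambda>\<omega>. sin (V \<omega> - t * Z \<omega>)) = 0"
        using VZ[of 1 t] VZ[of 1 "-t"] by (simp_all add: exp_add[symmetric] field_simps)
      have bnd: "\<bar>cos x / 2\<bar> \<le> 2" "\<bar>sin x / 2\<bar> \<le> 2" for x :: real
        by (rule order_trans[of _ "1 / 2"]; simp)+
      have I: "integrable M (\<lambda>\<omega>. cos (V \<omega> + t * Z \<omega>) / 2)" "integrable M (\<lambda>\<omega>. cos (V \<omega> - t * Z \<omega>) / 2)"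
        "integrable M (\<lambda>\<omega>. sin (V \<omega> + t * Z \<omega>) / 2)" "integrable M (\<lambda>\<omega>. sin (V \<omega> - t * Z \<omega>) / 2)"
        by (rule bI; simp add: bnd del: abs_divide)+
      have "expectation (\<lambda>\<omega>. cos (V \<omega>) * cos (t * Z \<omega>)) = exp (- (p - b\<^sup>2) / 2) * exp (- t\<^sup>2 / 2)"
        unfolding p(1) by (subst Bochner_Integration.integral_add[OF I(1,2)]) (simp add: E)
      moreover have "expectation (\<lambda>\<omega>. sin (V \<omega>) * cos (t * Z \<omega>)) = 0"
        unfolding p(2) by (subst Bochner_Integration.integral_add[OF I(3,4)]) (simp add: E)
      moreover have "expectation (\<lambda>\<omega>. cos (V \<omega>) * sin (t * Z \<omega>)) = 0"
        unfolding p(3) by (subst Bochner_Integration.integral_diff[OF I(3,4)]) (simp add: E)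
      moreover have "expectation (\<lambda>\<omega>. sin (V \<omega>) * sin (t * Z \<omega>)) = 0"
        unfolding p(4) by (subst Bochner_Integration.integral_diff[OF I(2,1)]) (simp add: E)
      ultimately have "L = cos \<Longrightarrow> G = cos \<Longrightarrow> ?thesis" "L = sin \<Longrightarrow> G = cos \<Longrightarrow> ?thesis"
        "L = cos \<Longrightarrow> G = sin \<Longrightarrow> ?thesis" "L = sin \<Longrightarrow> G = sin \<Longrightarrow> ?thesis"
        by (simp_all add: cV sV)
      then show ?thesis using L G by blast
    qed
    have pp: "expectation (\<lambda>\<omega>. (1 + G (V \<omega>)) * L (t * Z \<omega>)) = expectation (\<lambda>\<omega>. (1 + expectation (\<lambda>\<omega>. G (V \<omega>))) * L (t * Z \<omega>))"
      if L: "L = cos \<or> L = sin" for L t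
    proof -
      have [measurable]: "L \<in> borel_measurable borel" using L by auto
      have L1: "\<bar>L x\<bar> \<le> 1" for x using L by auto
      have "\<bar>G (V \<omega>) * L (t * Z \<omega>)\<bar> \<le> 2" for \<omega>
      proof -
        have "\<bar>G (V \<omega>)\<bar> * \<bar>L (t * Z \<omega>)\<bar> \<le> 1 * 1" by (intro mult_mono L1 G1) auto
        then show ?thesis by (simp add: abs_mult)
      qed
      then have 1: "integrable M (\<lambda>\<omega>. G (V \<omega>) * L (t * Z \<omega>))" by (intro bI) auto
      have 2: "integrable M (\<lambda>\<omega>. L (t * Z \<omega>))" by (intro bI order_trans[OF L1]) auto
      show ?thesis unfolding distrib_right using 1 2 prod[OF L] by simp
    qed
    have E1: "\<bar>expectation (\<lambda>\<omega>. G (V \<omega>))\<bar> \<le> 1"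
    proof -
      have "\<bar>expectation (\<lambda>\<omega>. G (V \<omega>))\<bar> \<le> expectation (\<lambda>\<omega>. \<bar>G (V \<omega>)\<bar>)" by (rule integral_abs_bound)
      also have "\<dots> \<le> expectation (\<lambda>\<omega>. 1)" by (intro integral_mono bI) (auto simp: G1 intro!: order_trans[OF G1])
      finally show ?thesis by (simp add: prob_space)
    qed
    then have nn: "0 \<le> 1 + expectation (\<lambda>\<omega>. G (V \<omega>))" "expectation (\<lambda>\<omega>. G (V \<omega>)) \<le> 1" by linarith+
    have "expectation (\<lambda>\<omega>. (1 + G (V \<omega>)) * (exp (\<sigma> * Z \<omega>) * K (b * Z \<omega>)))
      = expectation (\<lambda>\<omega>. (1 + expectation (\<lambda>\<omega>. G (V \<omega>))) * (exp (\<sigma> * Z \<omega>) * K (b * Z \<omega>)))"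
      using G one nn pp[of cos] pp[of sin]
      by (intro weighted_law_eqI[where X = Z and Y = Z and h = "\<lambda>z. exp (\<sigma> * z) * K (b * z)"] bI) auto
    then show ?thesis by simp
  qed
  have cV: "expectation (\<lambda>\<omega>. cos (V \<omega>)) = exp (- (p - b\<^sup>2) / 2)" and sV: "expectation (\<lambda>\<omega>. sin (V \<omega>)) = 0"
    using VZ[of 1 0] by simp_all
  have mult: "expectation (\<lambda>\<omega>. G (V \<omega>) * (exp (\<sigma> * Z \<omega>) * K (b * Z \<omega>)))
     = expectation (\<lambda>\<omega>. G (V \<omega>)) * expectation (\<lambda>\<omega>. exp (\<sigma> * Z \<omega>) * K (b * Z \<omega>))"
    if G: "G = cos \<or> G = sin" and K: "K = cos \<or> K = sin" for G K :: "real \<Rightarrow> real"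
  proof -
    have [measurable]: "G \<in> borel_measurable borel" "K \<in> borel_measurable borel" using G K by auto
    have 1: "\<bar>G x\<bar> \<le> 1" "\<bar>K x\<bar> \<le> 1" for x using G K by auto
    have i: "integrable M (\<lambda>\<omega>. exp (\<sigma> * Z \<omega>) * K (b * Z \<omega>))" using eI[of "\<lambda>_. 1" K] 1 by simp
    have j: "integrable M (\<lambda>\<omega>. G (V \<omega>) * (exp (\<sigma> * Z \<omega>) * K (b * Z \<omega>)))" using 1 by (intro eI) auto
    show ?thesis using fact[OF G, of K] i j by (simp add: distrib_right)
  qed
  have Kc: "expectation (\<lambda>\<omega>. exp (\<sigma> * Z \<omega>) * cos (b * Z \<omega>)) = exp (\<sigma>\<^sup>2 / 2 - b\<^sup>2 / 2) * cos (b * \<sigma>)"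
    by (subst EZ) (auto simp: std_normal_tilted_trig)
  have Ks: "expectation (\<lambda>\<omega>. exp (\<sigma> * Z \<omega>) * sin (b * Z \<omega>)) = exp (\<sigma>\<^sup>2 / 2 - b\<^sup>2 / 2) * sin (b * \<sigma>)"
    by (subst EZ) (auto simp: std_normal_tilted_trig)
  have b\<sigma>: "b * \<sigma> = q" using \<sigma> by (simp add: b_def)
  have ex: "exp (- (p - b\<^sup>2) / 2) * exp (\<sigma>\<^sup>2 / 2 - b\<^sup>2 / 2) = exp ((r - p) / 2)"
    by (simp add: exp_add[symmetric] \<sigma> field_simps)
  have U: "U \<omega> = V \<omega> + b * Z \<omega>" for \<omega> by (simp add: V_def)
  have "(\<integral>\<omega>. exp (\<xi> \<omega>) * cos (U \<omega>) \<partial>M)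
    = (\<integral>\<omega>. cos (V \<omega>) * (exp (\<sigma> * Z \<omega>) * cos (b * Z \<omega>)) - sin (V \<omega>) * (exp (\<sigma> * Z \<omega>) * sin (b * Z \<omega>)) \<partial>M)"
    unfolding \<xi> U cos_add by (intro Bochner_Integration.integral_cong refl) (simp add: algebra_simps)
  also have "\<dots> = exp (- (p - b\<^sup>2) / 2) * (exp (\<sigma>\<^sup>2 / 2 - b\<^sup>2 / 2) * cos (b * \<sigma>))"
    by (subst Bochner_Integration.integral_diff) (auto intro!: eI simp: mult cV sV Kc Ks)
  also have "\<dots> = exp ((r - p) / 2) * cos q"
    using ex by (metis mult.assoc b\<sigma>)
  finally show "(\<integral>\<omega>. exp (\<xi> \<omega>) * cos (U \<omega>) \<partial>M) = exp ((r - p) / 2) * cos q" .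
  have "(\<integral>\<omega>. exp (\<xi> \<omega>) * sin (U \<omega>) \<partial>M)
    = (\<integral>\<omega>. sin (V \<omega>) * (exp (\<sigma> * Z \<omega>) * cos (b * Z \<omega>)) + cos (V \<omega>) * (exp (\<sigma> * Z \<omega>) * sin (b * Z \<omega>)) \<partial>M)"
    unfolding \<xi> U sin_add by (intro Bochner_Integration.integral_cong refl) (simp add: algebra_simps)
  also have "\<dots> = exp (- (p - b\<^sup>2) / 2) * (exp (\<sigma>\<^sup>2 / 2 - b\<^sup>2 / 2) * sin (b * \<sigma>))"
    by (subst Bochner_Integration.integral_add) (auto intro!: eI simp: mult cV sV Kc Ks)
  also have "\<dots> = exp ((r - p) / 2) * sin q"
    using ex by (metis mult.assoc b\<sigma>)
  finally show "(\<integral>\<omega>. exp (\<xi> \<omega>) * sin (U \<omega>) \<partial>M) = exp ((r - p) / 2) * sin q" .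
qed

text \<open>The finite-dimensional Cameron--Martin formula: \<open>g j\<close> is the covariance of
  \<open>X j\<close> and \<open>\<xi>\<close>, so under the density
  \<open>exp (\<xi> - r / 2)\<close>, with \<open>r\<close> the variance of \<open>\<xi>\<close>,
  the characteristic function of \<open>X\<close> becomes that of \<open>X + g\<close>. The last
  claim is the symmetry of a centred Gaussian vector: \<open>g - X\<close> and \<open>X + g\<close>
  have the same characteristic function.\<close>

lemma gaussian_box_tilt:
  fixes X :: "'i \<Rightarrow> 'a \<Rightarrow> real" and b :: "'i \<Rightarrow> real"
  defines "Q \<equiv> \<lambda>J R c d. \<Sum>i\<in>J. \<Sum>j\<in>J. c i * d j * R i j"
  assumes M: "prob_space M" and J: "finite J" and X: "\<And>j. j \<in> J \<Longrightarrow> X j \<in> borel_measurable M"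
    and char: "\<And>c. char (distr M borel (\<lambda>\<omega>. \<Sum>j\<in>J. c j * X j \<omega>)) 1 = of_real (exp (- Q J R c c / 2))"
    and sym: "\<And>i j. R i j = R j i"
    and g: "\<And>j. j \<in> J \<Longrightarrow> g j = (\<Sum>i\<in>J. a i * R i j)"
    and r: "0 < Q J R a a"
  defines "A \<equiv> {\<omega>\<in>space M. \<forall>j\<in>J. \<bar>X j \<omega>\<bar> \<le> b j}"
    and "\<xi> \<equiv> \<lambda>\<omega>. \<Sum>j\<in>J. a j * X j \<omega>"
  shows "integrable M (\<lambda>\<omega>. indicator A \<omega> * exp (\<xi> \<omega>))" (is ?int)
    and "measure M {\<omega>\<in>space M. \<forall>j\<in>J. \<bar>X j \<omega> + g j\<bar> \<le> b j}
      = exp (- Q J R a a / 2) * (\<integral>\<omega>. indicator A \<omega> * exp (\<xi> \<omega>) \<partial>M)" (is "?l = ?r")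
    and "measure M {\<omega>\<in>space M. \<forall>j\<in>J. \<bar>X j \<omega> - g j\<bar> \<le> b j}
      = measure M {\<omega>\<in>space M. \<forall>j\<in>J. \<bar>X j \<omega> + g j\<bar> \<le> b j}" (is "?m = _")
proof -
  interpret prob_space M by fact
  have [measurable]: "(\<lambda>\<omega>. \<Sum>j\<in>J. c j * X j \<omega>) \<in> borel_measurable M" for c using X by measurable
  have [measurable]: "\<xi> \<in> borel_measurable M" unfolding \<xi>_def by measurable
  have A[measurable]: "A \<in> sets M"
    unfolding A_def using J X by (intro sets.sets_Collect_finite_All) auto
  define r where "r = Q J R a a"
  have bil: "Q J R (\<lambda>j. s * c j + t * a j) (\<lambda>j. s * c j + t * a j)
      = s\<^sup>2 * Q J R c c + 2 * s * t * (\<Sum>j\<in>J. c j * g j) + t\<^sup>2 * r" for s t c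
  proof -
    have 1: "(\<Sum>i\<in>J. \<Sum>j\<in>J. a i * c j * R i j) = (\<Sum>j\<in>J. c j * g j)"
      by (subst sum.swap) (simp add: g sum_distrib_left mult_ac)
    have 2: "(\<Sum>i\<in>J. \<Sum>j\<in>J. c i * a j * R i j) = (\<Sum>j\<in>J. c j * g j)"
      by (simp add: g sum_distrib_left mult_ac sym)
    have "Q J R (\<lambda>j. s * c j + t * a j) (\<lambda>j. s * c j + t * a j)
      = s\<^sup>2 * Q J R c c + s * t * (\<Sum>i\<in>J. \<Sum>j\<in>J. a i * c j * R i j)
       + s * t * (\<Sum>i\<in>J. \<Sum>j\<in>J. c i * a j * R i j) + t\<^sup>2 * r"
      unfolding Q_def r_def sum_distrib_left sum.distrib[symmetric]
      by (intro sum.cong refl) (simp add: power2_eq_square algebra_simps)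
    then show ?thesis unfolding 1 2 by simp
  qed
  have charM: "char (distr M borel (\<lambda>\<omega>. s * (\<Sum>j\<in>J. c j * X j \<omega>) + t * \<xi> \<omega>)) 1
      = of_real (exp (- (s\<^sup>2 * Q J R c c + 2 * s * t * (\<Sum>j\<in>J. c j * g j) + t\<^sup>2 * r) / 2))" for s t c
  proof -
    have "(\<lambda>\<omega>. s * (\<Sum>j\<in>J. c j * X j \<omega>) + t * \<xi> \<omega>) = (\<lambda>\<omega>. \<Sum>j\<in>J. (s * c j + t * a j) * X j \<omega>)"
      by (simp add: \<xi>_def sum_distrib_left distrib_right sum.distrib mult.assoc)
    then show ?thesis using char[of "\<lambda>j. s * c j + t * a j"] unfolding bil by simp
  qed
  note tilt = gaussian_pair_tilt[OF M _ _ r[folded r_def] charM]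
  have iexp: "integrable M (\<lambda>\<omega>. exp (\<xi> \<omega>))" by (rule tilt(1)[of "\<lambda>_. 0"]) auto
  have tc: "(\<integral>\<omega>. exp (\<xi> \<omega>) * cos (\<Sum>j\<in>J. c j * X j \<omega>) \<partial>M) = exp ((r - Q J R c c) / 2) * cos (\<Sum>j\<in>J. c j * g j)" for c
    by (rule tilt(2)) auto
  have ts: "(\<integral>\<omega>. exp (\<xi> \<omega>) * sin (\<Sum>j\<in>J. c j * X j \<omega>) \<partial>M) = exp ((r - Q J R c c) / 2) * sin (\<Sum>j\<in>J. c j * g j)" for c
    by (rule tilt(3)) auto
  have c0: "expectation (\<lambda>\<omega>. cos (\<Sum>j\<in>J. c j * X j \<omega>)) = exp (- Q J R c c / 2)"
    and s0: "expectation (\<lambda>\<omega>. sin (\<Sum>j\<in>J. c j * X j \<omega>)) = 0" for c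
    using char[of c] by (subst (asm) char_distr_eq_of_real_iff[OF M]; simp)+
  show ?int using iexp by (rule integrable_real_mult_indicator[OF A, simplified mult.commute[of _ "indicator _ _"]])
  have bI: "integrable M (\<lambda>\<omega>. cos (\<Sum>j\<in>J. c j * X j \<omega>))" "integrable M (\<lambda>\<omega>. sin (\<Sum>j\<in>J. c j * X j \<omega>))" for c
    by (rule integrable_const_bound[of _ 1]; simp)+
  define N where "N = density M (\<lambda>\<omega>. ennreal (exp (\<xi> \<omega> - r / 2)))"
  have ie: "(\<integral>\<omega>. exp (\<xi> \<omega> - r / 2) \<partial>M) = 1" "integrable M (\<lambda>\<omega>. exp (\<xi> \<omega> - r / 2))"
    using tc[of "\<lambda>_. 0"] iexp by (auto simp: Q_def exp_diff)
  have N: "prob_space N"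
  proof
    have "emeasure N (space N) = (\<integral>\<^sup>+\<omega>. ennreal (exp (\<xi> \<omega> - r / 2)) \<partial>M)"
      unfolding N_def by (subst emeasure_density) (auto intro!: nn_integral_cong)
    also have "\<dots> = ennreal (\<integral>\<omega>. exp (\<xi> \<omega> - r / 2) \<partial>M)" by (intro nn_integral_eq_integral ie) auto
    finally show "emeasure N (space N) = 1" using ie by simp
  qed
  have XN: "\<And>j. j \<in> J \<Longrightarrow> X j \<in> borel_measurable N" using X by (simp add: N_def)
  have iN: "(\<integral>\<omega>. f \<omega> \<partial>N) = exp (- r / 2) * (\<integral>\<omega>. exp (\<xi> \<omega>) * f \<omega> \<partial>M)"
    if [measurable]: "f \<in> borel_measurable M" for f :: "'a \<Rightarrow> real"
  proof -
    have e: "exp (\<xi> \<omega> - r / 2) * f \<omega> = exp (- r / 2) * (exp (\<xi> \<omega>) * f \<omega>)" for \<omega>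
      using exp_add[of "- r / 2" "\<xi> \<omega>"] by simp
    have "(\<integral>\<omega>. f \<omega> \<partial>N) = (\<integral>\<omega>. exp (\<xi> \<omega> - r / 2) * f \<omega> \<partial>M)"
      unfolding N_def by (subst integral_density) auto
    then show ?thesis unfolding e by simp
  qed
  have sumg: "(\<Sum>j\<in>J. u j * (X j \<omega> + g j)) = (\<Sum>j\<in>J. u j * X j \<omega>) + (\<Sum>j\<in>J. u j * g j)" for u \<omega>
    by (simp add: distrib_left sum.distrib)
  have charXg: "char (distr M borel (\<lambda>\<omega>. \<Sum>j\<in>J. u j * (X j \<omega> + g j))) 1
     = Complex (exp (- Q J R u u / 2) * cos (\<Sum>j\<in>J. u j * g j)) (exp (- Q J R u u / 2) * sin (\<Sum>j\<in>J. u j * g j))" for u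
    unfolding sumg using bI[of u]
    by (subst char_distr_eq_Complex[OF M]) (auto simp: cos_add sin_add c0 s0)
  have sumg': "(\<Sum>j\<in>J. u j * (g j - X j \<omega>)) = (\<Sum>j\<in>J. u j * g j) - (\<Sum>j\<in>J. u j * X j \<omega>)" for u \<omega>
    by (simp add: right_diff_distrib sum_subtractf)
  have charXg': "char (distr M borel (\<lambda>\<omega>. \<Sum>j\<in>J. u j * (g j - X j \<omega>))) 1
     = Complex (exp (- Q J R u u / 2) * cos (\<Sum>j\<in>J. u j * g j)) (exp (- Q J R u u / 2) * sin (\<Sum>j\<in>J. u j * g j))" for u
    unfolding sumg' using bI[of u]
    by (subst char_distr_eq_Complex[OF M]) (auto simp: cos_diff sin_diff c0 s0)
  have exr: "exp (- (r / 2)) * exp ((r - q) / 2) = exp (- (q / 2))" for q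
    by (simp add: exp_add[symmetric] field_simps)
  have charN: "char (distr N borel (\<lambda>\<omega>. \<Sum>j\<in>J. u j * X j \<omega>)) 1
     = Complex (exp (- Q J R u u / 2) * cos (\<Sum>j\<in>J. u j * g j)) (exp (- Q J R u u / 2) * sin (\<Sum>j\<in>J. u j * g j))" for u
  proof -
    have "(\<lambda>\<omega>. \<Sum>j\<in>J. u j * X j \<omega>) \<in> borel_measurable N" using XN by measurable
    then show ?thesis
      by (simp add: char_distr_eq_Complex[OF N] iN tc ts mult.assoc[symmetric] exr)
  qed
  have iv: "\<bar>x\<bar> \<le> b j \<longleftrightarrow> x \<in> {- b j .. b j}" for x j by auto
  have "?l = measure N {\<omega>\<in>space N. \<forall>j\<in>J. \<bar>X j \<omega>\<bar> \<le> b j}"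
    unfolding iv by (rule joint_char_eq_imp_box_prob_eq[OF M N J _ XN]) (use X in \<open>auto simp: charN charXg\<close>)
  also have "\<dots> = (\<integral>\<omega>. indicator A \<omega> \<partial>N)"
    by (auto simp: A_def N_def intro!: arg_cong2[where f=measure])
  also have "\<dots> = ?r"
    by (subst iN) (auto simp: r_def mult.commute)
  finally show "?l = ?r" .
  have "?m = measure M {\<omega>\<in>space M. \<forall>j\<in>J. \<bar>g j - X j \<omega>\<bar> \<le> b j}"
    by (simp add: abs_minus_commute)
  also have "\<dots> = ?l"
    unfolding iv by (rule joint_char_eq_imp_box_prob_eq[OF M M J]) (use X in \<open>auto simp: charXg' charXg\<close>)
  finally show "?m = ?l" .
qed

text \<open>The tilts by \<open>a\<close> and \<open>- a\<close> describe the boxes for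
  \<open>X + g\<close> and \<open>X - g\<close>, which have equal probability, so the two formulas
  can be averaged. The hypothesis \<open>null\<close> covers a degenerate \<open>\<xi>\<close>, to
  which \<open>gaussian_box_tilt\<close> does not apply and for which the shift has to
  vanish.\<close>

lemma gaussian_box_shift:
  fixes X :: "'i \<Rightarrow> 'a \<Rightarrow> real"
  assumes M: "prob_space M" and J: "finite J" and X: "\<And>j. j \<in> J \<Longrightarrow> X j \<in> borel_measurable M"
    and char: "\<And>c. char (distr M borel (\<lambda>\<omega>. \<Sum>j\<in>J. c j * X j \<omega>)) 1
      = of_real (exp (- (\<Sum>i\<in>J. \<Sum>j\<in>J. c i * c j * R i j) / 2))"
    and sym: "\<And>i j. R i j = R j i"
    and g: "\<And>j. j \<in> J \<Longrightarrow> g j = (\<Sum>i\<in>J. a i * R i j)"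
    and C: "(\<Sum>j\<in>J. a j * g j) \<le> C"
    and null: "(\<Sum>j\<in>J. a j * g j) = 0 \<Longrightarrow> \<forall>j\<in>J. g j = 0"
  shows "exp (- C / 2) * measure M {\<omega>\<in>space M. \<forall>j\<in>J. \<bar>X j \<omega>\<bar> \<le> b j}
      \<le> measure M {\<omega>\<in>space M. \<forall>j\<in>J. \<bar>X j \<omega> + g j\<bar> \<le> b j}"
proof -
  interpret prob_space M by fact
  define Q where "Q c = (\<Sum>i\<in>J. \<Sum>j\<in>J. c i * c j * R i j)" for c
  define A where "A = {\<omega>\<in>space M. \<forall>j\<in>J. \<bar>X j \<omega>\<bar> \<le> b j}"
  define \<xi> where "\<xi> \<omega> = (\<Sum>j\<in>J. a j * X j \<omega>)" for \<omega>
  have A: "A \<in> sets M"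
    unfolding A_def using J X by (intro sets.sets_Collect_finite_All) auto
  have Qa: "Q a = (\<Sum>j\<in>J. a j * g j)"
    unfolding Q_def by (subst sum.swap) (simp add: g sum_distrib_left mult_ac)
  \<comment> \<open>A characteristic function has modulus at most 1, and this one is
    \<open>exp (- Q a / 2)\<close>.\<close>
  have "Q a \<ge> 0"
  proof -
    have m: "(\<lambda>\<omega>. \<Sum>j\<in>J. a j * X j \<omega>) \<in> borel_measurable M" using X by measurable
    then interpret D: real_distribution "distr M borel (\<lambda>\<omega>. \<Sum>j\<in>J. a j * X j \<omega>)" by simp
    have "exp (- Q a / 2) \<le> 1" using D.cmod_char_le_1[of 1] unfolding char Q_def[symmetric] by simp
    then show ?thesis by simp
  qed
  then consider "Q a = 0" | "0 < Q a" by linarith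
  then show ?thesis
  proof cases
    case 1
    then have "\<forall>j\<in>J. g j = 0" using null Qa by simp
    then have e: "{\<omega>\<in>space M. \<forall>j\<in>J. \<bar>X j \<omega> + g j\<bar> \<le> b j} = A" by (auto simp: A_def)
    have "exp (- C / 2) \<le> 1" using 1 C Qa by simp
    then show ?thesis unfolding e A_def[symmetric] by (intro mult_left_le_one_le) auto
  next
    case 2
    note pos = 2[unfolded Q_def]
    have neg: "0 < (\<Sum>i\<in>J. \<Sum>j\<in>J. (- a i) * (- a j) * R i j)" using pos by simp
    have gn: "- g j = (\<Sum>i\<in>J. - a i * R i j)" if "j \<in> J" for j using g[OF that] by (simp add: sum_negf)
    let ?P = "measure M {\<omega>\<in>space M. \<forall>j\<in>J. \<bar>X j \<omega> + g j\<bar> \<le> b j}"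
    note p = gaussian_box_tilt[OF M J X char sym g pos, where b=b, folded A_def \<xi>_def, folded Q_def]
    note n = gaussian_box_tilt[OF M J X char sym gn neg, where b=b, folded A_def]
    have \<xi>n: "(\<Sum>j\<in>J. - a j * X j \<omega>) = - \<xi> \<omega>" for \<omega> by (simp add: \<xi>_def sum_negf)
    have Qn: "(\<Sum>i\<in>J. \<Sum>j\<in>J. (- a i) * (- a j) * R i j) = Q a" by (simp add: Q_def)
    have n2: "?P = exp (- Q a / 2) * (\<integral>\<omega>. indicator A \<omega> * exp (- \<xi> \<omega>) \<partial>M)"
      using n(2)[unfolded \<xi>n Qn] p(3) by simp
    have "(\<integral>\<omega>. indicator A \<omega> * 2 \<partial>M)
       \<le> (\<integral>\<omega>. indicator A \<omega> * exp (\<xi> \<omega>) + indicator A \<omega> * exp (- \<xi> \<omega>) \<partial>M)"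
    proof (rule integral_mono)
      show "integrable M (\<lambda>\<omega>. indicat_real A \<omega> * 2)" using A by (simp add: emeasure_eq_measure)
      show "integrable M (\<lambda>\<omega>. indicator A \<omega> * exp (\<xi> \<omega>) + indicator A \<omega> * exp (- \<xi> \<omega>))"
        using p(1) n(1)[unfolded \<xi>n] by simp
      show "indicat_real A \<omega> * 2 \<le> indicator A \<omega> * exp (\<xi> \<omega>) + indicator A \<omega> * exp (- \<xi> \<omega>)" for \<omega>
        using cosh_real_ge_1[of "\<xi> \<omega>"] by (auto simp: cosh_def indicator_def)
    qed
    also have "\<dots> = (\<integral>\<omega>. indicator A \<omega> * exp (\<xi> \<omega>) \<partial>M) + (\<integral>\<omega>. indicator A \<omega> * exp (- \<xi> \<omega>) \<partial>M)"
      using p(1) n(1)[unfolded \<xi>n] by simp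
    finally have "2 * measure M A \<le> \<dots>" using A sets.sets_into_space[OF A] by (simp add: Int_absorb2)
    then have "exp (- Q a / 2) * (2 * measure M A) \<le> exp (- Q a / 2) * \<dots>" by (intro mult_left_mono) auto
    then have 3: "exp (- Q a / 2) * measure M A \<le> ?P" using p(2) n2 by (simp add: distrib_left)
    have "exp (- C / 2) * measure M A \<le> exp (- Q a / 2) * measure M A"
      using C Qa by (intro mult_right_mono) auto
    then show ?thesis using 3 by (simp add: A_def)
  qed
qed

text \<open>In the inductive step the new unit vector is replaced by its component orthogonal to the
  old ones; when that component has length \<open>\<delta> = 0\<close>, the bound forces the numerator of
  \<open>\<gamma> / \<delta>\<close> to vanish, and division by zero gives the right coefficient \<open>0\<close>.\<close>

lemma bounded_functional_represented:
  fixes R :: "'i \<Rightarrow> 'i \<Rightarrow> real"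
  assumes "finite J" and sym: "\<And>i j. R i j = R j i"
    and pos: "\<And>c. 0 \<le> (\<Sum>i\<in>J. \<Sum>j\<in>J. c i * c j * R i j)"
    and bound: "\<And>c. (\<Sum>j\<in>J. c j * g j)\<^sup>2 \<le> C * (\<Sum>i\<in>J. \<Sum>j\<in>J. c i * c j * R i j)"
  shows "\<exists>a. \<forall>j\<in>J. g j = (\<Sum>i\<in>J. a i * R i j)"
  using assms(1) pos bound
proof (induction J arbitrary: g C)
  case empty
  then show ?case by simp
next
  case (insert k J)
  define Q where "Q c = (\<Sum>i\<in>J. \<Sum>j\<in>J. c i * c j * R i j)" for c
  have symk: "R i k = R k i" if "i \<in> J" for i by (rule sym)
  have ext: "(\<Sum>i\<in>insert k J. \<Sum>j\<in>insert k J. d i * d j * R i j)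
      = (d k)\<^sup>2 * R k k + 2 * d k * (\<Sum>j\<in>J. d j * R k j) + Q d" for d
  proof -
    have "(\<Sum>i\<in>J. d i * d k * R i k) = d k * (\<Sum>j\<in>J. d j * R k j)"
      "(\<Sum>j\<in>J. d k * d j * R k j) = d k * (\<Sum>j\<in>J. d j * R k j)"
      by (simp_all add: sum_distrib_left mult_ac symk)
    then show ?thesis
      using insert.hyps by (simp add: sum.distrib Q_def power2_eq_square)
  qed
  have Q_cong: "Q d = Q c" if "\<And>j. j \<in> J \<Longrightarrow> d j = c j" for c d using that by (simp add: Q_def)
  have posJ: "0 \<le> Q c" and boundJ: "(\<Sum>j\<in>J. c j * g j)\<^sup>2 \<le> C * Q c" for c
  proof -
    define d where "d = c(k := 0)"
    have d: "d k = 0" "\<And>j. j \<in> J \<Longrightarrow> d j = c j" using insert.hyps by (auto simp: d_def)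
    have "(\<Sum>j\<in>J. d j * g j) = (\<Sum>j\<in>J. c j * g j)" "Q d = Q c"
      using d by (auto intro!: sum.cong Q_cong)
    then show "0 \<le> Q c" "(\<Sum>j\<in>J. c j * g j)\<^sup>2 \<le> C * Q c"
      using insert.prems(1)[of d] insert.prems(2)[of d] insert.hyps d unfolding ext by simp_all
  qed
  obtain a where a: "\<And>j. j \<in> J \<Longrightarrow> g j = (\<Sum>i\<in>J. a i * R i j)"
    using insert.IH[of g C] posJ boundJ unfolding Q_def by blast
  \<comment> \<open>Cauchy--Schwarz for the semidefinite form. It makes row \<open>k\<close> of
    \<open>R\<close> a bounded functional on \<open>J\<close>, so the induction hypothesis
    represents this row too; the coefficients \<open>p\<close> are those of the projection of the
    new unit vector.\<close>
  have "(\<Sum>j\<in>J. c j * R k j)\<^sup>2 \<le> R k k * Q c" for c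
  proof -
    define S where "S = (\<Sum>j\<in>J. c j * R k j)"
    have quad: "0 \<le> R k k + 2 * t * S + t\<^sup>2 * Q c" for t
    proof -
      define d where "d = (\<lambda>j. t * c j)(k := 1)"
      have d: "d k = 1" "\<And>j. j \<in> J \<Longrightarrow> d j = t * c j" using insert.hyps by (auto simp: d_def)
      have "(\<Sum>j\<in>J. d j * R k j) = t * S"
        using d by (simp add: S_def sum_distrib_left mult.assoc)
      moreover have "Q d = t\<^sup>2 * Q c"
        using d by (simp add: Q_def sum_distrib_left power2_eq_square mult_ac)
      ultimately show ?thesis using insert.prems(1)[of d] d unfolding ext by simp
    qed
    show ?thesis
    proof (cases "Q c = 0")
      case True
      \<comment> \<open>With \<open>Q c = 0\<close> the quadratic is affine in \<open>t\<close>; at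
        this point it would take the value -1 if \<open>S\<close> were nonzero.\<close>
      then have "S = 0" using quad[of "- (R k k + 1) / (2 * S)"] by (cases "S = 0") (auto simp: field_simps)
      then show ?thesis using True by (simp add: S_def)
    next
      case False
      then have Qp: "Q c > 0" using posJ[of c] by simp
      have "0 \<le> R k k - S\<^sup>2 / Q c"
        using quad[of "- S / Q c"] Qp by (simp add: power2_eq_square)
      then show ?thesis using Qp by (simp add: S_def field_simps)
    qed
  qed
  then obtain p where p: "\<And>j. j \<in> J \<Longrightarrow> R k j = (\<Sum>i\<in>J. p i * R i j)"
    using insert.IH[of "\<lambda>j. R k j" "R k k"] posJ unfolding Q_def by blast
  define \<delta> where "\<delta> = R k k - (\<Sum>i\<in>J. p i * R i k)"
  define \<gamma> where "\<gamma> = g k - (\<Sum>i\<in>J. p i * g i)"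
  have Qp: "Q p = (\<Sum>i\<in>J. p i * R i k)"
    unfolding Q_def by (subst sum.swap) (simp add: p symk sum_distrib_left mult_ac)
  have bd: "\<gamma>\<^sup>2 \<le> C * \<delta>"
  proof -
    define d where "d = (\<lambda>j. - p j)(k := 1)"
    have "(\<Sum>j\<in>J. d j * g j) = - (\<Sum>i\<in>J. p i * g i)"
      using insert.hyps by (auto simp: d_def sum_negf[symmetric] intro!: sum.cong)
    moreover have "(\<Sum>j\<in>J. d j * R k j) = - (\<Sum>i\<in>J. p i * R i k)"
      using insert.hyps by (auto simp: d_def sum_negf[symmetric] symk intro!: sum.cong)
    moreover have "Q d = Q p" using insert.hyps by (auto simp: d_def Q_def intro!: sum.cong)
    moreover have "d k = 1" by (simp add: d_def)
    ultimately show ?thesis using insert.prems(2)[of d] insert.hyps unfolding ext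
      by (simp add: \<gamma>_def \<delta>_def Qp)
  qed
  define a' where "a' = (\<lambda>j. a j - \<gamma> / \<delta> * p j)(k := \<gamma> / \<delta>)"
  have sum': "(\<Sum>i\<in>insert k J. a' i * R i j) = (\<Sum>i\<in>J. a i * R i j) + \<gamma> / \<delta> * (R k j - (\<Sum>i\<in>J. p i * R i j))" for j
  proof -
    define e where "e = \<gamma> / \<delta>"
    have "(\<Sum>i\<in>J. a' i * R i j) = (\<Sum>i\<in>J. a i * R i j - e * (p i * R i j))"
      using insert.hyps unfolding a'_def e_def[symmetric] by (auto simp: left_diff_distrib intro!: sum.cong)
    then show ?thesis using insert.hyps unfolding e_def[symmetric]
      by (simp add: a'_def e_def[symmetric] sum_subtractf sum_distrib_left[symmetric] right_diff_distrib)
  qed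
  have "g j = (\<Sum>i\<in>insert k J. a' i * R i j)" if "j \<in> insert k J" for j
  proof (cases "j = k")
    case False
    then show ?thesis using that unfolding sum' by (simp add: a p)
  next
    case True
    have "(\<Sum>i\<in>J. a i * R i k) = (\<Sum>i\<in>J. \<Sum>j\<in>J. a i * p j * R i j)"
      by (simp add: symk p sum_distrib_left mult_ac) (simp add: sym)
    also have "\<dots> = (\<Sum>j\<in>J. p j * g j)"
      by (subst sum.swap) (simp add: a sum_distrib_left mult_ac)
    finally have 1: "(\<Sum>i\<in>J. a i * R i k) = (\<Sum>j\<in>J. p j * g j)" .
    have "\<gamma> / \<delta> * \<delta> = \<gamma>" using bd by (cases "\<delta> = 0") auto
    then show ?thesis unfolding True sum' 1 \<delta>_def[symmetric] by (simp add: \<gamma>_def)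
  qed
  then show ?case by blast
qed

subsection \<open>Finite-dimensional laws of the mixed process\<close>

lemma (in prob_space) char_centered_normal:
  assumes "distributed M lborel X (normal_density 0 \<sigma>)" "0 < \<sigma>"
  shows "char (distr M borel X) v = of_real (exp (- (\<sigma>\<^sup>2 * v\<^sup>2) / 2))"
proof -
  have X[measurable]: "X \<in> borel_measurable M" using assms(1) by (simp add: distributed_def)
  have std: "distributed M lborel (\<lambda>x. X x / \<sigma>) std_normal_density"
    using assms normal_standard_normal_convert[of \<sigma> X 0] by simp
  then have "distr M borel (\<lambda>x. X x / \<sigma>) = std_normal_distribution"
    using distributed_distr_eq_density[OF std] by (simp cong: distr_cong)
  then have "char (distr M borel (\<lambda>x. X x / \<sigma>)) (\<sigma> * v) = of_real (exp (- (\<sigma> * v)\<^sup>2 / 2))"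
    by (simp add: char_std_normal_distribution)
  moreover have "char (distr M borel (\<lambda>x. X x / \<sigma>)) (\<sigma> * v) = char (distr M borel X) v"
    using assms by (simp add: char_def integral_distr)
  ultimately show ?thesis by (simp add: power_mult_distrib)
qed

text \<open>Abel summation. The weight of an increment is the tail sum of the coefficients at later
  times; this turns a combination of Wiener values into one of independent increments.\<close>

lemma sum_by_parts_increments:
  fixes c w :: "nat \<Rightarrow> real"
  shows "(\<Sum>i<n. c i * w (Suc i)) = (\<Sum>k<n. (\<Sum>i\<in>{k..<n}. c i) * (w (Suc k) - w k)) + (\<Sum>i<n. c i) * w 0"
proof (induction n)
  case (Suc n)
  have "(\<Sum>k<Suc n. (\<Sum>i\<in>{k..<Suc n}. c i) * (w (Suc k) - w k))
      = (\<Sum>k<Suc n. (\<Sum>i\<in>{k..<n}. c i) * (w (Suc k) - w k) + c n * (w (Suc k) - w k))"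
    by (intro sum.cong refl) (auto simp: sum.atLeastLessThan_Suc algebra_simps)
  also have "\<dots> = (\<Sum>k<n. (\<Sum>i\<in>{k..<n}. c i) * (w (Suc k) - w k)) + c n * (w (Suc n) - w 0)"
    by (simp add: sum.distrib sum_distrib_left[symmetric] sum_lessThan_telescope del: sum.lessThan_Suc) simp
  finally show ?case using Suc by (simp add: algebra_simps)
qed simp

text \<open>Both sides are the variance of \<open>\<Sum>i<n. c i * W (\<tau> (Suc i))\<close> for a
  Wiener process, once from the covariance \<open>min\<close> and once from independent
  increments.\<close>

lemma sum_min_eq_sum_increments:
  fixes c \<tau> :: "nat \<Rightarrow> real"
  assumes "\<tau> 0 = 0" and "\<And>i j. i \<le> j \<Longrightarrow> j \<le> n \<Longrightarrow> \<tau> i \<le> \<tau> j"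
  shows "(\<Sum>i<n. \<Sum>j<n. c i * c j * min (\<tau> (Suc i)) (\<tau> (Suc j)))
     = (\<Sum>k<n. (\<Sum>i\<in>{k..<n}. c i)\<^sup>2 * (\<tau> (Suc k) - \<tau> k))"
  using assms(2)
proof (induction n)
  case (Suc n)
  define D where "D k = (\<Sum>i\<in>{k..<n}. c i)" for k
  have m: "min (\<tau> (Suc i)) (\<tau> (Suc n)) = \<tau> (Suc i)" "min (\<tau> (Suc n)) (\<tau> (Suc i)) = \<tau> (Suc i)" if "i < n" for i
    using Suc.prems[of "Suc i" "Suc n"] that by auto
  have "(\<Sum>i<Suc n. \<Sum>j<Suc n. c i * c j * min (\<tau> (Suc i)) (\<tau> (Suc j)))
     = (\<Sum>i<n. \<Sum>j<n. c i * c j * min (\<tau> (Suc i)) (\<tau> (Suc j)))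
       + 2 * c n * (\<Sum>i<n. c i * \<tau> (Suc i)) + (c n)\<^sup>2 * \<tau> (Suc n)"
    by (simp add: sum.distrib m sum_distrib_left power2_eq_square mult_ac)
  also have "(\<Sum>i<n. \<Sum>j<n. c i * c j * min (\<tau> (Suc i)) (\<tau> (Suc j))) = (\<Sum>k<n. (D k)\<^sup>2 * (\<tau> (Suc k) - \<tau> k))"
    using Suc by (simp add: D_def)
  also have "(\<Sum>i<n. c i * \<tau> (Suc i)) = (\<Sum>k<n. D k * (\<tau> (Suc k) - \<tau> k))"
    using sum_by_parts_increments[of c \<tau> n] assms(1) by (simp add: D_def)
  also have "\<tau> (Suc n) = (\<Sum>k<Suc n. \<tau> (Suc k) - \<tau> k)"
    using assms(1) by (simp add: sum_lessThan_telescope del: sum.lessThan_Suc)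
  also have "(\<Sum>k<n. (D k)\<^sup>2 * (\<tau> (Suc k) - \<tau> k)) + 2 * c n * (\<Sum>k<n. D k * (\<tau> (Suc k) - \<tau> k)) + (c n)\<^sup>2 * \<dots>
     = (\<Sum>k<Suc n. (D k + c n)\<^sup>2 * (\<tau> (Suc k) - \<tau> k))"
  proof -
    have "(D k + c n)\<^sup>2 * x = (D k)\<^sup>2 * x + 2 * c n * (D k * x) + (c n)\<^sup>2 * x" for k x
      by (simp add: power2_eq_square algebra_simps)
    moreover have "D n = 0" by (simp add: D_def)
    ultimately show ?thesis
      by (simp add: sum.distrib sum_distrib_left[symmetric] distrib_left)
  qed
  also have "\<dots> = (\<Sum>k<Suc n. (\<Sum>i\<in>{k..<Suc n}. c i)\<^sup>2 * (\<tau> (Suc k) - \<tau> k))"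
    by (intro sum.cong refl) (auto simp: D_def sum.atLeastLessThan_Suc)
  finally show ?case .
qed simp

lemma wiener_process_char:
  assumes "prob_space M" and W: "wiener_process M W" and J: "finite J" "J \<subseteq> {0..}"
  shows "char (distr M borel (\<lambda>\<omega>. \<Sum>t\<in>J. c t * W t \<omega>)) 1
      = of_real (exp (- (\<Sum>s\<in>J. \<Sum>t\<in>J. c s * c t * min s t) / 2))"
proof -
  interpret prob_space M by fact
  define l where "l = sorted_list_of_set J"
  define n where "n = card J"
  have l: "set l = J" "sorted l" "distinct l" "length l = n" using J by (auto simp: l_def n_def)
  \<comment> \<open>The sorted times of \<open>J\<close> with 0 prepended, so that the first
    increment starts at \<open>W 0\<close>.\<close>
  define \<tau> where "\<tau> i = (if i = 0 then 0 else l ! (i - 1))" for i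
  define d where "d i = c (l ! i)" for i
  have [simp]: "\<tau> (Suc i) = l ! i" "\<tau> 0 = 0" for i by (simp_all add: \<tau>_def)
  have lnn: "0 \<le> l ! i" if "i < n" for i using that l J nth_mem[of i l] by auto
  have \<tau>: "\<tau> i \<le> \<tau> j" if "i \<le> j" "j \<le> n" for i j
    using that lnn[of "j - 1"] l sorted_nth_mono[of l "i - 1" "j - 1"]
    by (cases i; cases j) auto
  have bij: "bij_betw (\<lambda>i. l ! i) {..<n} J" using bij_betw_nth[OF l(3), of "{..<n}" J] l by auto
  have Wm[measurable]: "W t \<in> borel_measurable M" if "0 \<le> t" for t using W that by (auto simp: wiener_process_def)
  define D where "D k = (\<Sum>i\<in>{k..<n}. d i)" for k
  define \<Delta> where "\<Delta> k \<omega> = W (\<tau> (Suc k)) \<omega> - W (\<tau> k) \<omega>" for k \<omega>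
  have \<Delta>m: "\<Delta> k \<in> borel_measurable M" if "k < n" for k
    unfolding \<Delta>_def using \<tau>[of 0 k] \<tau>[of 0 "Suc k"] that by (intro borel_measurable_diff Wm) auto
  have e1: "(\<Sum>t\<in>J. c t * W t \<omega>) = (\<Sum>k<n. D k * \<Delta> k \<omega>) + (\<Sum>i<n. d i) * W 0 \<omega>" for \<omega>
  proof -
    have "(\<Sum>t\<in>J. c t * W t \<omega>) = (\<Sum>i<n. d i * W (\<tau> (Suc i)) \<omega>)"
      using sum.reindex_bij_betw[OF bij, of "\<lambda>t. c t * W t \<omega>"] by (simp add: d_def)
    then show ?thesis using sum_by_parts_increments[of d "\<lambda>i. W (\<tau> i) \<omega>" n]
      by (simp add: D_def \<Delta>_def)
  qed
  have e2: "(\<Sum>s\<in>J. \<Sum>t\<in>J. c s * c t * min s t) = (\<Sum>k<n. (D k)\<^sup>2 * (\<tau> (Suc k) - \<tau> k))"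
  proof -
    have "(\<Sum>s\<in>J. \<Sum>t\<in>J. c s * c t * min s t) = (\<Sum>i<n. \<Sum>j<n. d i * d j * min (\<tau> (Suc i)) (\<tau> (Suc j)))"
      by (simp add: sum.reindex_bij_betw[OF bij, symmetric] d_def)
    then show ?thesis using sum_min_eq_sum_increments[of \<tau> n d] \<tau> by (simp add: D_def)
  qed
  have "AE \<omega> in M. W 0 \<omega> = 0" using W by (simp add: wiener_process_def)
  then have "distr M borel (\<lambda>\<omega>. \<Sum>t\<in>J. c t * W t \<omega>) = distr M borel (\<lambda>\<omega>. \<Sum>k<n. D k * \<Delta> k \<omega>)"
    unfolding e1 using \<Delta>m by (intro distr_cong_AE refl) auto
  moreover have "char (distr M borel (\<lambda>\<omega>. \<Sum>k<n. D k * \<Delta> k \<omega>)) 1 = (\<Prod>k<n. char (distr M borel (\<lambda>\<omega>. D k * \<Delta> k \<omega>)) 1)"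
  proof (rule char_distr_sum)
    have "indep_vars (\<lambda>_. borel) \<Delta> {..<n}"
    proof -
      have "0 \<le> \<tau> 0 \<and> (\<forall>i<n. \<tau> i \<le> \<tau> (Suc i))"
        by (intro conjI allI impI \<tau>) auto
      then show ?thesis using W unfolding wiener_process_def \<Delta>_def[abs_def] by blast
    qed
    then show "indep_vars (\<lambda>_. borel) (\<lambda>k \<omega>. D k * \<Delta> k \<omega>) {..<n}"
      by (rule indep_vars_compose2[where Y = "\<lambda>k x. D k * x"]) auto
  qed
  moreover have "char (distr M borel (\<lambda>\<omega>. D k * \<Delta> k \<omega>)) 1 = of_real (exp (- ((D k)\<^sup>2 * (\<tau> (Suc k) - \<tau> k)) / 2))"
    if k: "k < n" for k
  proof (cases "\<tau> k = \<tau> (Suc k)")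
    \<comment> \<open>Occurs only for \<open>k = 0\<close> with \<open>0 \<in> J\<close>, where the
      prepended 0 is repeated.\<close>
    case True
    then have "\<Delta> k = (\<lambda>_. 0)" by (auto simp: \<Delta>_def)
    then show ?thesis using True by (simp add: char_def integral_distr prob_space del: distr_const)
  next
    case False
    then have lt: "\<tau> k < \<tau> (Suc k)" using \<tau>[of k "Suc k"] k by linarith
    have "distributed M lborel (\<Delta> k) (normal_density 0 (sqrt (\<tau> (Suc k) - \<tau> k)))"
      using W lt \<tau>[of 0 k] k unfolding wiener_process_def \<Delta>_def by auto
    from char_centered_normal[OF this, of "D k"] lt show ?thesis
      using char_distr_scale[OF \<Delta>m[OF k], of "D k"] by (simp add: mult.commute)
  qed
  ultimately show ?thesis
    unfolding e2 by (simp add: exp_sum sum_negf[symmetric] sum_divide_distrib)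
qed

lemma gaussian_rv_char:
  assumes "prob_space M" and S: "gaussian_rv M S" and E0: "prob_space.expectation M S = 0"
  shows "integrable M (\<lambda>\<omega>. (S \<omega>)\<^sup>2)"
    and "char (distr M borel S) 1 = of_real (exp (- (\<integral>\<omega>. (S \<omega>)\<^sup>2 \<partial>M) / 2))"
proof -
  interpret prob_space M by fact
  have [measurable]: "S \<in> borel_measurable M" using S by (simp add: gaussian_rv_def)
  consider (n) \<mu> \<sigma> where "0 < \<sigma>" "distributed M lborel S (\<lambda>x. ennreal (normal_density \<mu> \<sigma> x))"
    | (c) \<mu> where "AE \<omega> in M. S \<omega> = \<mu>"
    using S by (auto simp: gaussian_rv_def)
  then have "integrable M (\<lambda>\<omega>. (S \<omega>)\<^sup>2) \<and> char (distr M borel S) 1 = of_real (exp (- (\<integral>\<omega>. (S \<omega>)\<^sup>2 \<partial>M) / 2))"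
  proof cases
    case n
    have "\<mu> = 0" using normal_distributed_expectation[OF n(1) n(2)] E0 by simp
    with n have d: "distributed M lborel S (normal_density 0 \<sigma>)" by simp
    have "(\<integral>\<omega>. (S \<omega>)\<^sup>2 \<partial>M) = \<sigma>\<^sup>2" using normal_distributed_variance[OF n(1) d] E0 by simp
    moreover have "integrable M (\<lambda>\<omega>. (S \<omega>)\<^sup>2)"
      using distributed_integrable[OF d, of "\<lambda>x. x\<^sup>2"] integrable_normal_moment[OF n(1), of 0 2] n(1) by simp
    ultimately show ?thesis using char_centered_normal[OF d n(1), of 1] by simp
  next
    case c
    have "expectation S = expectation (\<lambda>_. \<mu>)" using c by (intro integral_cong_AE) auto
    then have "\<mu> = 0" using E0 by (simp add: prob_space)
    with c have z: "AE \<omega> in M. S \<omega> = 0" by simp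
    have "distr M borel S = distr M borel (\<lambda>_. 0)" using z by (intro distr_cong_AE) auto
    moreover have "(\<integral>\<omega>. (S \<omega>)\<^sup>2 \<partial>M) = (\<integral>\<omega>. 0 \<partial>M)" using z by (intro integral_cong_AE) auto
    moreover have "integrable M (\<lambda>\<omega>. (S \<omega>)\<^sup>2) \<longleftrightarrow> integrable M (\<lambda>\<omega>. 0::real)" using z by (intro integrable_cong_AE) auto
    ultimately show ?thesis by (simp add: char_def integral_distr prob_space del: distr_const)
  qed
  then show "integrable M (\<lambda>\<omega>. (S \<omega>)\<^sup>2)"
    and "char (distr M borel S) 1 = of_real (exp (- (\<integral>\<omega>. (S \<omega>)\<^sup>2 \<partial>M) / 2))" by auto
qed

definition fbm_cov :: "real \<Rightarrow> real \<Rightarrow> real \<Rightarrow> real" where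
  "fbm_cov H s t = (s powr (2 * H) + t powr (2 * H) - \<bar>s - t\<bar> powr (2 * H)) / 2"

text \<open>Gaussianity of every finite linear combination leaves only its variance to be found.
  Single times, seen as combinations over one-point sets, supply the square integrability behind the
  bilinear expansion.\<close>

lemma fbm_char:
  assumes "prob_space M" and B: "fractional_brownian_motion M H B" and J: "finite J" "J \<subseteq> {0..}"
  shows "char (distr M borel (\<lambda>\<omega>. \<Sum>t\<in>J. c t * B t \<omega>)) 1
      = of_real (exp (- (\<Sum>s\<in>J. \<Sum>t\<in>J. c s * c t * fbm_cov H s t) / 2))"
proof -
  interpret prob_space M by fact
  have gau: "gaussian_rv M (\<lambda>\<omega>. \<Sum>t\<in>J. c t * B t \<omega>)" if "finite J" "J \<subseteq> {0..}" for J c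
    using B that by (simp add: fractional_brownian_motion_def gaussian_process_def)
  have gB: "gaussian_rv M (B t)" if "0 \<le> t" for t using gau[of "{t}" "\<lambda>_. 1"] that by simp
  then have Bm[measurable]: "B t \<in> borel_measurable M" if "0 \<le> t" for t using that by (simp add: gaussian_rv_def)
  have EB: "expectation (B t) = 0" if "0 \<le> t" for t using B that by (simp add: fractional_brownian_motion_def)
  have sq: "integrable M (\<lambda>\<omega>. (B t \<omega>)\<^sup>2)" if "0 \<le> t" for t
    using gaussian_rv_char(1)[OF assms(1) gB[OF that] EB[OF that]] .
  have iB: "integrable M (B t)" if "0 \<le> t" for t
    using Bm[OF that] sq[OF that] by (rule square_integrable_imp_integrable)
  have prod: "integrable M (\<lambda>\<omega>. B s \<omega> * B t \<omega>)" if "0 \<le> s" "0 \<le> t" for s t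
  proof (rule Bochner_Integration.integrable_bound[OF Bochner_Integration.integrable_add[OF sq[OF that(1)] sq[OF that(2)]]])
    show "(\<lambda>\<omega>. B s \<omega> * B t \<omega>) \<in> borel_measurable M" using that by (intro borel_measurable_times Bm)
    have "\<bar>x * y\<bar> \<le> \<bar>x\<^sup>2 + y\<^sup>2\<bar>" for x y :: real
    proof -
      have "2 * \<bar>x * y\<bar> \<le> x\<^sup>2 + y\<^sup>2" using sum_squares_bound[of "\<bar>x\<bar>" "\<bar>y\<bar>"] by (simp add: abs_mult)
      then show ?thesis by linarith
    qed
    then show "AE \<omega> in M. norm (B s \<omega> * B t \<omega>) \<le> norm ((B s \<omega>)\<^sup>2 + (B t \<omega>)\<^sup>2)" by simp
  qed
  have cov: "expectation (\<lambda>\<omega>. B s \<omega> * B t \<omega>) = fbm_cov H s t" if "0 \<le> s" "0 \<le> t" for s t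
    using B that by (simp add: fractional_brownian_motion_def fbm_cov_def)
  have nn: "0 \<le> t" if "t \<in> J" for t using that J by auto
  have E0: "expectation (\<lambda>\<omega>. \<Sum>t\<in>J. c t * B t \<omega>) = 0"
  proof -
    have "expectation (\<lambda>\<omega>. \<Sum>t\<in>J. c t * B t \<omega>) = (\<Sum>t\<in>J. expectation (\<lambda>\<omega>. c t * B t \<omega>))"
      using nn by (intro Bochner_Integration.integral_sum integrable_mult_right iB) auto
    then show ?thesis using nn by (simp add: EB)
  qed
  have "(\<integral>\<omega>. (\<Sum>t\<in>J. c t * B t \<omega>)\<^sup>2 \<partial>M) = (\<integral>\<omega>. (\<Sum>s\<in>J. \<Sum>t\<in>J. c s * c t * (B s \<omega> * B t \<omega>)) \<partial>M)"
    unfolding power2_eq_square sum_product by (intro Bochner_Integration.integral_cong sum.cong refl) (simp add: mult_ac)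
  also have "\<dots> = (\<Sum>s\<in>J. \<integral>\<omega>. (\<Sum>t\<in>J. c s * c t * (B s \<omega> * B t \<omega>)) \<partial>M)"
    using nn by (intro Bochner_Integration.integral_sum Bochner_Integration.integrable_sum integrable_mult_right prod) auto
  also have "\<dots> = (\<Sum>s\<in>J. \<Sum>t\<in>J. \<integral>\<omega>. c s * c t * (B s \<omega> * B t \<omega>) \<partial>M)"
    using nn by (intro sum.cong refl Bochner_Integration.integral_sum integrable_mult_right prod) auto
  also have "\<dots> = (\<Sum>s\<in>J. \<Sum>t\<in>J. c s * c t * fbm_cov H s t)"
    using nn by (simp add: cov)
  finally show ?thesis using gaussian_rv_char(2)[OF assms(1) gau[OF J] E0] by simp
qed

lemma mixed_process_char:
  assumes M: "prob_space M" and B: "fractional_brownian_motion M H B" and W: "wiener_process M W"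
    and ind: "independent_processes M B W" and J: "finite J" "J \<subseteq> {0..}"
  shows "char (distr M borel (\<lambda>\<omega>. \<Sum>t\<in>J. c t * (B t \<omega> + W t \<omega>))) 1
      = of_real (exp (- (\<Sum>s\<in>J. \<Sum>t\<in>J. c s * c t * (fbm_cov H s t + min s t)) / 2))"
proof -
  interpret prob_space M by fact
  \<comment> \<open>Independence is given for whole paths on \<open>{0..}\<close>; composing both
    path maps with this measurable functional of finitely many coordinates passes it on to linear
    combinations.\<close>
  define \<Phi> where "\<Phi> = (\<lambda>x :: real \<Rightarrow> real. \<Sum>t\<in>J. c t * x t)"
  have \<Phi>: "\<Phi> \<in> borel_measurable (PiM {0..} (\<lambda>_. borel))"
    unfolding \<Phi>_def using J(2) by (intro borel_measurable_sum borel_measurable_times measurable_const measurable_component_singleton) auto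
  have "indep_var borel (\<Phi> \<circ> (\<lambda>\<omega>. \<lambda>t\<in>{0..}. B t \<omega>)) borel (\<Phi> \<circ> (\<lambda>\<omega>. \<lambda>t\<in>{0..}. W t \<omega>))"
    using ind \<Phi> unfolding independent_processes_def by (intro indep_var_compose) auto
  moreover have "\<Phi> \<circ> (\<lambda>\<omega>. \<lambda>t\<in>{0..}. X t \<omega>) = (\<lambda>\<omega>. \<Sum>t\<in>J. c t * X t \<omega>)" for X :: "real \<Rightarrow> 'a \<Rightarrow> real"
    using J(2) by (auto simp: \<Phi>_def fun_eq_iff intro!: sum.cong)
  ultimately have i: "indep_var borel (\<lambda>\<omega>. \<Sum>t\<in>J. c t * B t \<omega>) borel (\<lambda>\<omega>. \<Sum>t\<in>J. c t * W t \<omega>)" by simp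
  have "(\<lambda>\<omega>. \<Sum>t\<in>J. c t * (B t \<omega> + W t \<omega>)) = (\<lambda>\<omega>. (\<Sum>t\<in>J. c t * B t \<omega>) + (\<Sum>t\<in>J. c t * W t \<omega>))"
    by (simp add: distrib_left sum.distrib)
  then have "char (distr M borel (\<lambda>\<omega>. \<Sum>t\<in>J. c t * (B t \<omega> + W t \<omega>))) 1
     = of_real (exp (- (\<Sum>s\<in>J. \<Sum>t\<in>J. c s * c t * fbm_cov H s t) / 2) * exp (- (\<Sum>s\<in>J. \<Sum>t\<in>J. c s * c t * min s t) / 2))"
    by (simp add: char_distr_add[OF i] fbm_char[OF M B J] wiener_process_char[OF M W J])
  moreover have "exp (- a / 2) * exp (- b / 2) = exp (- (a + b) / 2)" for a b :: real
    unfolding exp_add[symmetric] by (simp add: add_divide_distrib)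
  moreover have "(\<Sum>s\<in>J. \<Sum>t\<in>J. c s * c t * (fbm_cov H s t + min s t))
     = (\<Sum>s\<in>J. \<Sum>t\<in>J. c s * c t * fbm_cov H s t) + (\<Sum>s\<in>J. \<Sum>t\<in>J. c s * c t * min s t)"
    by (simp only: distrib_left sum.distrib)
  ultimately show ?thesis by (simp only:)
qed

subsection \<open>Square integrable functions and Schur kernels\<close>

definition sq_integrable :: "'a measure \<Rightarrow> ('a \<Rightarrow> real) \<Rightarrow> bool" where
  "sq_integrable M f \<longleftrightarrow> f \<in> borel_measurable M \<and> integrable M (\<lambda>x. (f x)\<^sup>2)"

abbreviation sqn :: "'a measure \<Rightarrow> ('a \<Rightarrow> real) \<Rightarrow> real" where
  "sqn M f \<equiv> \<integral>x. (f x)\<^sup>2 \<partial>M"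

lemma sq_integrable_mult:
  assumes "sq_integrable M f" "sq_integrable M g"
  shows "integrable M (\<lambda>x. f x * g x)"
proof (rule Bochner_Integration.integrable_bound)
  show "integrable M (\<lambda>x. (f x)\<^sup>2 + (g x)\<^sup>2)" using assms by (simp add: sq_integrable_def)
  show "(\<lambda>x. f x * g x) \<in> borel_measurable M" using assms by (auto simp: sq_integrable_def)
  have "\<bar>x * y\<bar> \<le> x\<^sup>2 + y\<^sup>2" for x y :: real
  proof -
    have "2 * \<bar>x * y\<bar> \<le> x\<^sup>2 + y\<^sup>2" using sum_squares_bound[of "\<bar>x\<bar>" "\<bar>y\<bar>"] by (simp add: abs_mult)
    then show ?thesis by linarith
  qed
  then show "AE x in M. norm (f x * g x) \<le> norm ((f x)\<^sup>2 + (g x)\<^sup>2)" by simp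
qed

lemma sq_integrable_cmult:
  assumes "sq_integrable M f" shows "sq_integrable M (\<lambda>x. c * f x)"
  using assms by (auto simp: sq_integrable_def power_mult_distrib)

lemma sq_integrable_add:
  assumes "sq_integrable M f" "sq_integrable M g" shows "sq_integrable M (\<lambda>x. f x + g x)"
proof -
  have "integrable M (\<lambda>x. (f x)\<^sup>2 + (g x)\<^sup>2 + 2 * (f x * g x))"
    using assms sq_integrable_mult[OF assms] by (simp add: sq_integrable_def)
  then show ?thesis using assms by (auto simp: sq_integrable_def power2_sum mult.assoc)
qed

lemma sq_integrable_diff:
  assumes "sq_integrable M f" "sq_integrable M g" shows "sq_integrable M (\<lambda>x. f x - g x)"
  using sq_integrable_add[OF assms(1) sq_integrable_cmult[OF assms(2), of "-1"]] by simp

lemma sq_integrable_zero: "sq_integrable M (\<lambda>_. 0)" by (simp add: sq_integrable_def)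

lemma sq_integrable_sum:
  assumes "\<And>i. i \<in> I \<Longrightarrow> sq_integrable M (f i)" shows "sq_integrable M (\<lambda>x. \<Sum>i\<in>I. f i x)"
  using assms
  by (induction I rule: infinite_finite_induct) (simp_all add: sq_integrable_zero sq_integrable_add)

lemma sqn_add:
  assumes "sq_integrable M f" "sq_integrable M g"
  shows "sqn M (\<lambda>x. f x + g x) = sqn M f + 2 * (\<integral>x. f x * g x \<partial>M) + sqn M g"
proof -
  have "sqn M (\<lambda>x. f x + g x) = (\<integral>x. (f x)\<^sup>2 + 2 * (f x * g x) + (g x)\<^sup>2 \<partial>M)"
    by (intro Bochner_Integration.integral_cong refl) (simp add: power2_sum)
  then show ?thesis using assms sq_integrable_mult[OF assms] by (simp add: sq_integrable_def)
qed

lemma sqn_diff: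
  assumes "sq_integrable M f" "sq_integrable M g"
  shows "sqn M (\<lambda>x. f x - g x) = sqn M f - 2 * (\<integral>x. f x * g x \<partial>M) + sqn M g"
  using sqn_add[OF assms(1) sq_integrable_cmult[OF assms(2), of "-1"]] by simp

lemma sqn_add_le:
  assumes "sq_integrable M f" "sq_integrable M g"
  shows "sqn M (\<lambda>x. f x + g x) \<le> 2 * sqn M f + 2 * sqn M g"
proof -
  have "0 \<le> sqn M (\<lambda>x. f x - g x)" by simp
  then show ?thesis using sqn_add[OF assms] sqn_diff[OF assms] by linarith
qed

lemma sqn_cong_AE:
  assumes "f \<in> borel_measurable M" "g \<in> borel_measurable M" "AE x in M. f x = g x"
  shows "sqn M f = sqn M g"
  using assms by (intro integral_cong_AE) auto

lemma Cauchy_Schwarz_sq_integrable: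
  assumes "sq_integrable M f" "sq_integrable M g"
  shows "(\<integral>x. f x * g x \<partial>M)\<^sup>2 \<le> sqn M f * sqn M g"
proof -
  define p where "p = (\<integral>x. f x * g x \<partial>M)"
  have quad: "0 \<le> sqn M f - 2 * t * p + t\<^sup>2 * sqn M g" for t
  proof -
    have "0 \<le> sqn M (\<lambda>x. f x - t * g x)" by simp
    also have "\<dots> = sqn M f - 2 * (t * p) + t\<^sup>2 * sqn M g"
      using sqn_diff[OF assms(1) sq_integrable_cmult[OF assms(2), of t]]
      by (simp add: p_def power_mult_distrib mult.left_commute)
    finally show ?thesis by (simp add: mult.assoc)
  qed
  show ?thesis
  proof (cases "sqn M g = 0")
    case True
    then have "p = 0" using quad[of "(sqn M f + 1) / (2 * p)"] by (cases "p = 0") (auto simp: field_simps)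
    then show ?thesis using True by (simp add: p_def)
  next
    case False
    moreover have "0 \<le> sqn M g" by simp
    ultimately have G: "0 < sqn M g" by linarith
    have "0 \<le> sqn M f - p\<^sup>2 / sqn M g"
      using quad[of "p / sqn M g"] G by (simp add: power2_eq_square)
    then show ?thesis using G by (simp add: p_def field_simps)
  qed
qed

lemma sqn_eq_0_iff:
  assumes "sq_integrable M f" shows "sqn M f = 0 \<longleftrightarrow> (AE x in M. f x = 0)"
  using assms integral_nonneg_eq_0_iff_AE[of M "\<lambda>x. (f x)\<^sup>2"] by (simp add: sq_integrable_def)

section \<open>Completeness along geometric series\<close>

text \<open>The form of completeness that the iteration in \<open>S_surjective\<close> calls for.
  With \<open>r = sqrt q\<close> the weighted squares \<open>(d k x)\<^sup>2 / r ^ k\<close> still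
  have summable integrals, hence an integrable sum \<open>g\<close>. Cauchy--Schwarz with weights
  \<open>r ^ k\<close> bounds every squared tail pointwise by \<open>r ^ n / (1 - r) * g x\<close>,
  which yields both square integrability of the limit and convergence in norm.\<close>

lemma L2_complete_geometric:
  assumes d: "\<And>n. sq_integrable M (d n)" and q: "0 < q" "q < 1"
    and bnd: "\<And>n. sqn M (d n) \<le> C * q ^ n"
  shows "\<exists>X. sq_integrable M X \<and> (\<lambda>n. sqn M (\<lambda>x. X x - (\<Sum>k<n. d k x))) \<longlonglongrightarrow> 0"
proof -
  define r where "r = sqrt q"
  have r: "0 < r" "r < 1" "r * r = q" using q by (auto simp: r_def)
  have [measurable]: "d n \<in> borel_measurable M" for n using d by (simp add: sq_integrable_def)
  have C: "0 \<le> C"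
  proof -
    have "0 \<le> sqn M (d 0)" by simp
    also have "\<dots> \<le> C" using bnd[of 0] by simp
    finally show ?thesis .
  qed
  define e where "e k x = (d k x)\<^sup>2 / r ^ k" for k x
  have [measurable]: "e k \<in> borel_measurable M" for k unfolding e_def by measurable
  have e0: "0 \<le> e k x" for k x using r by (simp add: e_def)
  have ei: "(\<integral>\<^sup>+x. ennreal (e k x) \<partial>M) \<le> ennreal (C * r ^ k)" for k
  proof -
    have "(\<integral>\<^sup>+x. ennreal (e k x) \<partial>M) = ennreal (\<integral>x. e k x \<partial>M)"
      using d[of k] e0 by (intro nn_integral_eq_integral) (auto simp: e_def sq_integrable_def)
    also have "(\<integral>x. e k x \<partial>M) = sqn M (d k) / r ^ k" by (simp add: e_def)
    also have "\<dots> \<le> C * q ^ k / r ^ k" using bnd r by (intro divide_right_mono) auto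
    also have "\<dots> = C * r ^ k" using r by (simp add: r(3)[symmetric] power_mult_distrib)
    finally show ?thesis by (simp add: ennreal_leI)
  qed
  define G where "G x = (\<Sum>k. ennreal (e k x))" for x
  have [measurable]: "G \<in> borel_measurable M" unfolding G_def by measurable
  have sr: "summable (\<lambda>k. C * r ^ k)" using r by (intro summable_mult summable_geometric) auto
  have "(\<integral>\<^sup>+x. G x \<partial>M) = (\<Sum>k. \<integral>\<^sup>+x. ennreal (e k x) \<partial>M)"
    unfolding G_def by (intro nn_integral_suminf) auto
  also have "\<dots> \<le> (\<Sum>k. ennreal (C * r ^ k))" by (intro suminf_le ei) auto
  also have "\<dots> = ennreal (\<Sum>k. C * r ^ k)" using C r sr by (intro suminf_ennreal2) auto
  finally have Gi: "(\<integral>\<^sup>+x. G x \<partial>M) < \<infinity>" by (simp add: le_less_trans)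
  then have Gfin: "AE x in M. G x \<noteq> \<infinity>" by (intro nn_integral_noteq_infinite) auto
  define g where "g x = enn2real (G x)" for x
  have [measurable]: "g \<in> borel_measurable M" unfolding g_def by measurable
  have gG: "AE x in M. ennreal (g x) = G x" using Gfin by eventually_elim (auto simp: g_def top.not_eq_extremum)
  have g0: "0 \<le> g x" for x by (simp add: g_def)
  have gint: "integrable M g"
  proof (rule integrableI_nonneg)
    have "(\<integral>\<^sup>+x. ennreal (g x) \<partial>M) = (\<integral>\<^sup>+x. G x \<partial>M)" using gG by (rule nn_integral_cong_AE)
    then show "(\<integral>\<^sup>+x. ennreal (g x) \<partial>M) < \<infinity>" using Gi by simp
  qed (auto simp: g0)
  define X where "X x = (\<Sum>k. d k x)" for x
  have [measurable]: "X \<in> borel_measurable M" unfolding X_def by measurable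
  have tail: "AE x in M. \<forall>n. (X x - (\<Sum>k<n. d k x))\<^sup>2 \<le> r ^ n / (1 - r) * g x"
    using gG
  proof eventually_elim
    fix x assume gx: "ennreal (g x) = G x"
    have se: "summable (\<lambda>k. e k x)"
      using gx e0 by (intro summable_suminf_not_top) (auto simp: G_def[symmetric])
    have part: "(\<Sum>k\<in>A. e k x) \<le> g x" if "finite A" for A
    proof -
      have "ennreal (\<Sum>k\<in>A. e k x) = (\<Sum>k\<in>A. ennreal (e k x))" using e0 by (simp add: sum_ennreal)
      also have "\<dots> \<le> G x" unfolding G_def using that by (intro sum_le_suminf) auto
      finally show ?thesis using g0 gx[symmetric] by simp
    qed
    \<comment> \<open>Absolute convergence wherever \<open>g\<close> represents a finite sum, from
      \<open>2 * \<bar>d k x\<bar> * r ^ k \<le> (d k x)\<^sup>2 + r ^ k * r ^ k\<close>.\<close>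
    have "norm (d k x) \<le> r ^ k + e k x" for k
    proof -
      have rk: "0 < r ^ k" using r by simp
      have "2 * \<bar>d k x\<bar> * r ^ k \<le> (d k x)\<^sup>2 + r ^ k * r ^ k"
        using sum_squares_bound[of "\<bar>d k x\<bar>" "r ^ k"] by (simp add: power2_eq_square[of "r ^ k"])
      then have "2 * \<bar>d k x\<bar> \<le> ((d k x)\<^sup>2 + r ^ k * r ^ k) / r ^ k"
        using rk by (simp add: pos_le_divide_eq)
      also have "\<dots> = e k x + r ^ k" using rk by (simp add: e_def add_divide_distrib)
      finally show ?thesis by simp
    qed
    then have sd: "summable (\<lambda>k. d k x)"
      using r se by (intro summable_comparison_test'[OF summable_add[OF summable_geometric se]]) auto
    show "\<forall>n. (X x - (\<Sum>k<n. d k x))\<^sup>2 \<le> r ^ n / (1 - r) * g x"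
    proof
      fix n
      have "(\<lambda>m. ((\<Sum>k<m. d k x) - (\<Sum>k<n. d k x))\<^sup>2) \<longlonglongrightarrow> (X x - (\<Sum>k<n. d k x))\<^sup>2"
        using summable_LIMSEQ[OF sd] unfolding X_def by (intro tendsto_intros)
      then show "(X x - (\<Sum>k<n. d k x))\<^sup>2 \<le> r ^ n / (1 - r) * g x"
      proof (rule LIMSEQ_le_const2, intro exI[of _ n] allI impI)
        fix m assume nm: "n \<le> m"
        have "(\<Sum>k<m. d k x) - (\<Sum>k<n. d k x) = (\<Sum>k\<in>{n..<m}. d k x)"
          using nm by (simp add: lessThan_atLeast0 sum_diff_nat_ivl)
        also have "\<dots> = (\<Sum>k\<in>{n..<m}. sqrt (r ^ k) * (d k x / sqrt (r ^ k)))" using r by simp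
        also have "\<dots>\<^sup>2 \<le> (\<Sum>k\<in>{n..<m}. (sqrt (r ^ k))\<^sup>2) * (\<Sum>k\<in>{n..<m}. (d k x / sqrt (r ^ k))\<^sup>2)"
          by (rule Cauchy_Schwarz_ineq_sum)
        also have "\<dots> = (\<Sum>k\<in>{n..<m}. r ^ k) * (\<Sum>k\<in>{n..<m}. e k x)"
          using r by (simp add: power_divide e_def)
        also have "\<dots> \<le> r ^ n / (1 - r) * g x"
        proof (rule mult_mono)
          have "(\<Sum>k\<in>{n..<m}. r ^ k) = (r ^ n - r ^ m) / (1 - r)"
            using sum_gp[of r n "m - 1"] nm r by (cases "n = m") (auto simp: atLeastLessThanSuc_atLeastAtMost[symmetric])
          then show "(\<Sum>k\<in>{n..<m}. r ^ k) \<le> r ^ n / (1 - r)" using r by (simp add: divide_right_mono)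
        qed (use part e0 r in \<open>auto intro!: sum_nonneg divide_nonneg_nonneg\<close>)
        finally show "((\<Sum>k<m. d k x) - (\<Sum>k<n. d k x))\<^sup>2 \<le> r ^ n / (1 - r) * g x" .
      qed
    qed
  qed
  have X2: "sq_integrable M X"
    unfolding sq_integrable_def
  proof
    show "integrable M (\<lambda>x. (X x)\<^sup>2)"
    proof (rule Bochner_Integration.integrable_bound)
      show "integrable M (\<lambda>x. 1 / (1 - r) * g x)" by (intro integrable_mult_right gint)
      show "AE x in M. norm ((X x)\<^sup>2) \<le> norm (1 / (1 - r) * g x)"
        using tail
      proof eventually_elim
        fix x assume "\<forall>n. (X x - (\<Sum>k<n. d k x))\<^sup>2 \<le> r ^ n / (1 - r) * g x"
        from this[rule_format, of 0] show "norm ((X x)\<^sup>2) \<le> norm (1 / (1 - r) * g x)"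
          using r g0[of x] by simp
      qed
    qed auto
  qed auto
  have "(\<lambda>n. sqn M (\<lambda>x. X x - (\<Sum>k<n. d k x))) \<longlonglongrightarrow> 0"
  proof (rule tendsto_sandwich[where f = "\<lambda>_. 0" and h = "\<lambda>n. r ^ n / (1 - r) * (\<integral>x. g x \<partial>M)"])
    show "\<forall>\<^sub>F n in sequentially. sqn M (\<lambda>x. X x - (\<Sum>k<n. d k x)) \<le> r ^ n / (1 - r) * (\<integral>x. g x \<partial>M)"
    proof (rule always_eventually, rule allI)
      fix n
      have "sqn M (\<lambda>x. X x - (\<Sum>k<n. d k x)) \<le> (\<integral>x. r ^ n / (1 - r) * g x \<partial>M)"
      proof (rule integral_mono_AE)
        have "sq_integrable M (\<lambda>x. X x - (\<Sum>k<n. d k x))"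
          by (intro sq_integrable_diff sq_integrable_sum X2 d)
        then show "integrable M (\<lambda>x. (X x - (\<Sum>k<n. d k x))\<^sup>2)" by (simp add: sq_integrable_def)
        show "integrable M (\<lambda>x. r ^ n / (1 - r) * g x)" by (intro integrable_mult_right gint)
        show "AE x in M. (X x - (\<Sum>k<n. d k x))\<^sup>2 \<le> r ^ n / (1 - r) * g x" using tail by eventually_elim auto
      qed
      then show "sqn M (\<lambda>x. X x - (\<Sum>k<n. d k x)) \<le> r ^ n / (1 - r) * (\<integral>x. g x \<partial>M)" by simp
    qed
    have "(\<lambda>n. r ^ n / (1 - r) * (\<integral>x. g x \<partial>M)) \<longlonglongrightarrow> 0 / (1 - r) * (\<integral>x. g x \<partial>M)"
      using r by (intro tendsto_intros LIMSEQ_power_zero) auto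
    then show "(\<lambda>n. r ^ n / (1 - r) * (\<integral>x. g x \<partial>M)) \<longlonglongrightarrow> 0" by simp
  qed auto
  with X2 show ?thesis by blast
qed

section \<open>Bounded operators from Schur kernels\<close>

text \<open>The Schur test with weight 1. One bound \<open>A\<close> for rows and columns keeps the
  hypotheses invariant under transposition, on which the interpretation \<open>flip\<close>
  relies.\<close>

locale schur_kernel = sigma_finite_measure M for M :: "'a measure" +
  fixes k :: "'a \<Rightarrow> 'a \<Rightarrow> real" and A :: real
  assumes kernel_measurable: "case_prod k \<in> borel_measurable (M \<Otimes>\<^sub>M M)"
    and kernel_nonneg: "\<And>x y. 0 \<le> k x y"
    and A_nonneg: "0 \<le> A"
    and schur_row: "\<And>x. x \<in> space M \<Longrightarrow> (\<integral>\<^sup>+y. k x y \<partial>M) \<le> A"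
    and schur_col: "\<And>y. y \<in> space M \<Longrightarrow> (\<integral>\<^sup>+x. k x y \<partial>M) \<le> A"
begin

definition op :: "('a \<Rightarrow> real) \<Rightarrow> 'a \<Rightarrow> real" where
  "op \<phi> x = (\<integral>y. k x y * \<phi> y \<partial>M)"

definition adj :: "('a \<Rightarrow> real) \<Rightarrow> 'a \<Rightarrow> real" where
  "adj \<psi> y = (\<integral>x. k x y * \<psi> x \<partial>M)"

sublocale P: pair_sigma_finite M M ..

lemma kernel_measurable'[measurable (raw)]:
  assumes "f \<in> measurable N M" "g \<in> measurable N M"
  shows "(\<lambda>x. k (f x) (g x)) \<in> borel_measurable N"
  using measurable_compose[OF measurable_Pair[OF assms] kernel_measurable] by simp

lemma op_measurable:
  assumes [measurable]: "\<phi> \<in> borel_measurable M"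
  shows "op \<phi> \<in> borel_measurable M" "adj \<phi> \<in> borel_measurable M"
  unfolding op_def[abs_def] adj_def[abs_def]
  by (rule borel_measurable_lebesgue_integral; measurable)+

text \<open>Split \<open>k\<close> as \<open>sqrt k * sqrt k\<close> and apply Cauchy--Schwarz in
  \<open>y\<close>: the row bound takes care of one factor and, after Tonelli, the column bound of
  the other. In terms of nonnegative integrals this presupposes no integrability and yields it for
  almost every \<open>x\<close>.\<close>

lemma nn_schur:
  assumes [measurable]: "\<phi> \<in> borel_measurable M"
  shows "(\<integral>\<^sup>+x. (\<integral>\<^sup>+y. k x y * \<bar>\<phi> y\<bar> \<partial>M)\<^sup>2 \<partial>M) \<le> ennreal (A\<^sup>2) * (\<integral>\<^sup>+y. (\<phi> y)\<^sup>2 \<partial>M)"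
proof -
  have "(\<integral>\<^sup>+x. (\<integral>\<^sup>+y. k x y * \<bar>\<phi> y\<bar> \<partial>M)\<^sup>2 \<partial>M) \<le> (\<integral>\<^sup>+x. ennreal A * (\<integral>\<^sup>+y. ennreal (k x y) * (\<phi> y)\<^sup>2 \<partial>M) \<partial>M)"
  proof (rule nn_integral_mono)
    fix x assume x[measurable]: "x \<in> space M"
    have "(\<integral>\<^sup>+y. k x y * \<bar>\<phi> y\<bar> \<partial>M) = (\<integral>\<^sup>+y. ennreal (sqrt (k x y)) * ennreal (sqrt (k x y) * \<bar>\<phi> y\<bar>) \<partial>M)"
      using kernel_nonneg by (intro nn_integral_cong) (simp add: ennreal_mult[symmetric] mult.assoc[symmetric])
    also have "\<dots>\<^sup>2 \<le> (\<integral>\<^sup>+y. (ennreal (sqrt (k x y)))\<^sup>2 \<partial>M) * (\<integral>\<^sup>+y. (ennreal (sqrt (k x y) * \<bar>\<phi> y\<bar>))\<^sup>2 \<partial>M)"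
      by (intro Cauchy_Schwarz_nn_integral) measurable
    also have "\<dots> = (\<integral>\<^sup>+y. k x y \<partial>M) * (\<integral>\<^sup>+y. ennreal (k x y) * (\<phi> y)\<^sup>2 \<partial>M)"
      using kernel_nonneg
      by (intro arg_cong2[where f="(*)"] nn_integral_cong) (simp_all add: ennreal_power power_mult_distrib ennreal_mult[symmetric])
    also have "\<dots> \<le> ennreal A * (\<integral>\<^sup>+y. ennreal (k x y) * (\<phi> y)\<^sup>2 \<partial>M)"
      by (intro mult_right_mono schur_row x) auto
    finally show "(\<integral>\<^sup>+y. k x y * \<bar>\<phi> y\<bar> \<partial>M)\<^sup>2 \<le> ennreal A * (\<integral>\<^sup>+y. ennreal (k x y) * (\<phi> y)\<^sup>2 \<partial>M)" .
  qed
  also have "\<dots> = ennreal A * (\<integral>\<^sup>+x. \<integral>\<^sup>+y. ennreal (k x y) * (\<phi> y)\<^sup>2 \<partial>M \<partial>M)"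
    by (intro nn_integral_cmult) measurable
  also have "(\<integral>\<^sup>+x. \<integral>\<^sup>+y. ennreal (k x y) * (\<phi> y)\<^sup>2 \<partial>M \<partial>M) = (\<integral>\<^sup>+y. \<integral>\<^sup>+x. ennreal (k x y) * (\<phi> y)\<^sup>2 \<partial>M \<partial>M)"
    by (rule P.Fubini'[symmetric]) measurable
  also have "\<dots> = (\<integral>\<^sup>+y. (\<integral>\<^sup>+x. k x y \<partial>M) * (\<phi> y)\<^sup>2 \<partial>M)"
    by (intro nn_integral_cong nn_integral_multc) measurable
  also have "\<dots> \<le> (\<integral>\<^sup>+y. ennreal A * (\<phi> y)\<^sup>2 \<partial>M)"
    by (intro nn_integral_mono mult_right_mono schur_col) auto
  also have "\<dots> = ennreal A * (\<integral>\<^sup>+y. (\<phi> y)\<^sup>2 \<partial>M)"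
    by (intro nn_integral_cmult) measurable
  finally show ?thesis
    using A_nonneg by (simp add: mult_left_mono mult.assoc[symmetric] power2_eq_square ennreal_mult)
qed

lemma nn_sq_finite:
  assumes "sq_integrable M \<phi>"
  shows "(\<integral>\<^sup>+y. (\<phi> y)\<^sup>2 \<partial>M) = ennreal (sqn M \<phi>)"
  using assms by (intro nn_integral_eq_integral) (auto simp: sq_integrable_def)

lemma op_sq_integrable:
  assumes \<phi>: "sq_integrable M \<phi>"
  shows "AE x in M. integrable M (\<lambda>y. k x y * \<phi> y)"
    and "sq_integrable M (op \<phi>)"
    and "sqn M (op \<phi>) \<le> A\<^sup>2 * sqn M \<phi>"
    and "sq_integrable M (op (\<lambda>y. \<bar>\<phi> y\<bar>))"
proof -
  have [measurable]: "\<phi> \<in> borel_measurable M" using \<phi> by (simp add: sq_integrable_def)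
  define F where "F x = (\<integral>\<^sup>+y. k x y * \<bar>\<phi> y\<bar> \<partial>M)" for x
  have [measurable]: "F \<in> borel_measurable M" unfolding F_def by measurable
  have F2: "(\<integral>\<^sup>+x. (F x)\<^sup>2 \<partial>M) \<le> ennreal (A\<^sup>2 * sqn M \<phi>)"
    using nn_schur[of \<phi>] unfolding F_def nn_sq_finite[OF \<phi>] by (simp add: ennreal_mult)
  then have "AE x in M. (F x)\<^sup>2 \<noteq> \<infinity>"
    by (intro nn_integral_noteq_infinite) (auto simp: top_unique)
  then have "AE x in M. F x < \<infinity>"
  proof eventually_elim
    fix x assume "(F x)\<^sup>2 \<noteq> \<infinity>"
    then have "F x \<noteq> \<infinity>" by (auto simp: power2_eq_square)
    then show "F x < \<infinity>" by (simp add: less_top)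
  qed
  with AE_space show 1: "AE x in M. integrable M (\<lambda>y. k x y * \<phi> y)"
  proof eventually_elim
    fix x assume [measurable]: "x \<in> space M" and "F x < \<infinity>"
    then show "integrable M (\<lambda>y. k x y * \<phi> y)"
      unfolding F_def integrable_iff_bounded using kernel_nonneg by (simp add: abs_mult)
  qed
  \<comment> \<open>\<open>\<phi>\<close> and \<open>\<bar>\<phi>\<bar>\<close> share the majorant
    \<open>F\<close>. The result for \<open>\<bar>\<phi>\<bar>\<close> provides the integrable
    majorants for later applications of Fubini's theorem.\<close>
  have gen: "sq_integrable M (op \<eta>) \<and> sqn M (op \<eta>) \<le> A\<^sup>2 * sqn M \<phi>"
    if \<eta>: "\<eta> \<in> borel_measurable M" "\<And>y. \<bar>\<eta> y\<bar> = \<bar>\<phi> y\<bar>" for \<eta>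
  proof -
    note [measurable] = \<eta>(1) op_measurable(1)[OF \<eta>(1)]
    have le: "ennreal ((op \<eta> x)\<^sup>2) \<le> (F x)\<^sup>2" if [measurable]: "x \<in> space M" for x
    proof (cases "F x < \<infinity>")
      case True
      then have "integrable M (\<lambda>y. k x y * \<eta> y)"
        unfolding F_def integrable_iff_bounded using kernel_nonneg by (simp add: abs_mult \<eta>)
      from integral_norm_bound_ennreal[OF this]
      have "ennreal \<bar>op \<eta> x\<bar> \<le> F x" using kernel_nonneg by (simp add: op_def F_def abs_mult \<eta>)
      then have "(ennreal \<bar>op \<eta> x\<bar>)\<^sup>2 \<le> (F x)\<^sup>2" by (intro power_mono) auto
      then show ?thesis by (simp add: ennreal_power)
    next
      case False
      then have "F x = \<infinity>" by (metis infinity_ennreal_def top.not_eq_extremum)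
      then show ?thesis by (simp add: power2_eq_square)
    qed
    have nn: "(\<integral>\<^sup>+x. (op \<eta> x)\<^sup>2 \<partial>M) \<le> ennreal (A\<^sup>2 * sqn M \<phi>)"
      by (rule order_trans[OF nn_integral_mono F2]) (rule le)
    then have i: "integrable M (\<lambda>x. (op \<eta> x)\<^sup>2)"
      by (intro integrableI_bounded) (auto simp: le_less_trans)
    have "ennreal (sqn M (op \<eta>)) \<le> ennreal (A\<^sup>2 * sqn M \<phi>)"
      using nn nn_integral_eq_integral[OF i] by simp
    then have "sqn M (op \<eta>) \<le> A\<^sup>2 * sqn M \<phi>" by (subst (asm) ennreal_le_iff) auto
    then show ?thesis using i by (simp add: sq_integrable_def)
  qed
  show "sq_integrable M (op \<phi>)" "sqn M (op \<phi>) \<le> A\<^sup>2 * sqn M \<phi>" "sq_integrable M (op (\<lambda>y. \<bar>\<phi> y\<bar>))"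
    using gen[of \<phi>] gen[of "\<lambda>y. \<bar>\<phi> y\<bar>"] by auto
qed

lemma integrable_kernel_product:
  assumes "sq_integrable M \<phi>" "sq_integrable M \<psi>"
  shows "integrable (M \<Otimes>\<^sub>M M) (\<lambda>(x, y). k x y * \<phi> y * \<psi> x)"
proof (rule P.Fubini_integrable)
  have [measurable]: "\<phi> \<in> borel_measurable M" "\<psi> \<in> borel_measurable M"
    using assms by (auto simp: sq_integrable_def)
  show "(\<lambda>(x, y). k x y * \<phi> y * \<psi> x) \<in> borel_measurable (M \<Otimes>\<^sub>M M)" by measurable
  have "integrable M (\<lambda>x. op (\<lambda>y. \<bar>\<phi> y\<bar>) x * \<bar>\<psi> x\<bar>)"
    using op_sq_integrable(4)[OF assms(1)] assms(2) by (intro sq_integrable_mult) (auto simp: sq_integrable_def)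
  then show "integrable M (\<lambda>x. \<integral>y. norm (case (x, y) of (x, y) \<Rightarrow> k x y * \<phi> y * \<psi> x) \<partial>M)"
    using kernel_nonneg by (simp add: op_def abs_mult)
  show "AE x in M. integrable M (\<lambda>y. case (x, y) of (x, y) \<Rightarrow> k x y * \<phi> y * \<psi> x)"
    using op_sq_integrable(1)[OF assms(1)] by eventually_elim (auto intro: integrable_mult_left)
qed

lemma adj_eq:
  assumes "sq_integrable M \<phi>" "sq_integrable M \<psi>"
  shows "(\<integral>x. op \<phi> x * \<psi> x \<partial>M) = (\<integral>y. \<phi> y * adj \<psi> y \<partial>M)"
proof -
  have "(\<integral>x. op \<phi> x * \<psi> x \<partial>M) = (\<integral>x. (\<integral>y. k x y * \<phi> y * \<psi> x \<partial>M) \<partial>M)"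
    by (simp add: op_def)
  also have "\<dots> = (\<integral>y. (\<integral>x. k x y * \<phi> y * \<psi> x \<partial>M) \<partial>M)"
    using P.Fubini_integral[OF integrable_kernel_product[OF assms]] by simp
  also have "\<dots> = (\<integral>y. \<phi> y * adj \<psi> y \<partial>M)"
    unfolding adj_def by (intro Bochner_Integration.integral_cong refl) (simp add: mult.commute mult.left_commute)
  finally show ?thesis .
qed

lemma op_add:
  assumes "sq_integrable M \<phi>" "sq_integrable M \<psi>"
  shows "AE x in M. op (\<lambda>y. \<phi> y + c * \<psi> y) x = op \<phi> x + c * op \<psi> x"
  using op_sq_integrable(1)[OF assms(1)] op_sq_integrable(1)[OF assms(2)]
proof eventually_elim
  fix x assume i: "integrable M (\<lambda>y. k x y * \<phi> y)" "integrable M (\<lambda>y. k x y * \<psi> y)"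
  have "(\<integral>y. k x y * (\<phi> y + c * \<psi> y) \<partial>M) = (\<integral>y. k x y * \<phi> y + c * (k x y * \<psi> y) \<partial>M)"
    by (intro Bochner_Integration.integral_cong refl) (simp add: algebra_simps)
  then show "op (\<lambda>y. \<phi> y + c * \<psi> y) x = op \<phi> x + c * op \<psi> x" using i by (simp add: op_def)
qed

lemma op_cong_AE:
  assumes "AE y in M. \<phi> y = \<psi> y" and [measurable]: "\<phi> \<in> borel_measurable M" "\<psi> \<in> borel_measurable M"
    and "x \<in> space M"
  shows "op \<phi> x = op \<psi> x"
proof -
  note [measurable] = assms(4)
  show ?thesis unfolding op_def using assms(1) by (intro integral_cong_AE) auto
qed

end

text \<open>Transposing the kernel exchanges \<open>op\<close> and \<open>adj\<close>, so every fact
  about one becomes available for the other; the rewrites keep the two names.\<close>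

sublocale schur_kernel \<subseteq> flip: schur_kernel M "\<lambda>x y. k y x" A
  rewrites flip_op: "schur_kernel.op M (\<lambda>x y. k y x) = adj"
    and flip_adj: "schur_kernel.adj M (\<lambda>x y. k y x) = op"
proof -
  show *: "schur_kernel M (\<lambda>x y. k y x) A"
    by unfold_locales (use kernel_nonneg A_nonneg schur_row schur_col in \<open>auto\<close>)
  show "schur_kernel.op M (\<lambda>x y. k y x) = adj"
    by (intro ext) (simp add: schur_kernel.op_def[OF *] adj_def)
  show "schur_kernel.adj M (\<lambda>x y. k y x) = op"
    by (intro ext) (simp add: schur_kernel.adj_def[OF *] op_def)
qed

section \<open>The equation \<open>S x = g\<close> and its quadratic functional\<close>

context schur_kernel
begin

definition S :: "('a \<Rightarrow> real) \<Rightarrow> 'a \<Rightarrow> real" where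
  "S \<phi> x = \<phi> x + adj (op \<phi>) x"

text \<open>The constant comes from \<open>sqn_add_le\<close> and two uses of the Schur bound. The
  last identity is the coercivity of \<open>S\<close>, from which both existence and uniqueness of
  solutions follow.\<close>

lemma S_sq_integrable:
  assumes "sq_integrable M \<phi>"
  shows "sq_integrable M (S \<phi>)"
    and "sqn M (S \<phi>) \<le> (2 + 2 * A ^ 4) * sqn M \<phi>"
    and "(\<integral>x. \<phi> x * S \<phi> x \<partial>M) = sqn M \<phi> + sqn M (op \<phi>)"
proof -
  note o = op_sq_integrable[OF assms]
  note a = flip.op_sq_integrable[unfolded flip_op, OF o(2)]
  show "sq_integrable M (S \<phi>)" unfolding S_def[abs_def] by (intro sq_integrable_add assms a)
  have "sqn M (S \<phi>) \<le> 2 * sqn M \<phi> + 2 * sqn M (adj (op \<phi>))"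
    unfolding S_def[abs_def] by (intro sqn_add_le assms a)
  also have "sqn M (adj (op \<phi>)) \<le> A\<^sup>2 * (A\<^sup>2 * sqn M \<phi>)"
    using a(3) mult_left_mono[OF o(3), of "A\<^sup>2"] by simp
  finally show "sqn M (S \<phi>) \<le> (2 + 2 * A ^ 4) * sqn M \<phi>"
    by (simp add: algebra_simps power4_eq_xxxx power2_eq_square)
  have "(\<integral>x. \<phi> x * S \<phi> x \<partial>M) = (\<integral>x. (\<phi> x)\<^sup>2 + \<phi> x * adj (op \<phi>) x \<partial>M)"
    by (simp add: S_def distrib_left power2_eq_square)
  also have "\<dots> = sqn M \<phi> + (\<integral>x. \<phi> x * adj (op \<phi>) x \<partial>M)"
    using assms sq_integrable_mult[OF assms a(2)] by (simp add: sq_integrable_def)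
  also have "(\<integral>x. \<phi> x * adj (op \<phi>) x \<partial>M) = sqn M (op \<phi>)"
    using adj_eq[OF assms o(2)] by (simp add: power2_eq_square)
  finally show "(\<integral>x. \<phi> x * S \<phi> x \<partial>M) = sqn M \<phi> + sqn M (op \<phi>)" .
qed

lemma S_add:
  assumes \<phi>: "sq_integrable M \<phi>" and \<psi>: "sq_integrable M \<psi>"
  shows "AE x in M. S (\<lambda>y. \<phi> y + c * \<psi> y) x = S \<phi> x + c * S \<psi> x"
proof -
  note o = op_sq_integrable(2)
  have s: "sq_integrable M (\<lambda>y. \<phi> y + c * \<psi> y)" by (intro sq_integrable_add sq_integrable_cmult assms)
  have m: "op (\<lambda>y. \<phi> y + c * \<psi> y) \<in> borel_measurable M" "(\<lambda>y. op \<phi> y + c * op \<psi> y) \<in> borel_measurable M"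
    using o[OF s] sq_integrable_add[OF o[OF \<phi>] sq_integrable_cmult[OF o[OF \<psi>], of c]]
    by (simp_all add: sq_integrable_def)
  from flip.op_add[unfolded flip_op, OF o[OF \<phi>] o[OF \<psi>], of c] AE_space
  show ?thesis
  proof eventually_elim
    fix x assume 1: "adj (\<lambda>y. op \<phi> y + c * op \<psi> y) x = adj (op \<phi>) x + c * adj (op \<psi>) x" and x: "x \<in> space M"
    have "adj (op (\<lambda>y. \<phi> y + c * \<psi> y)) x = adj (\<lambda>y. op \<phi> y + c * op \<psi> y) x"
      by (rule flip.op_cong_AE[unfolded flip_op, OF op_add[OF \<phi> \<psi>] m x])
    then show "S (\<lambda>y. \<phi> y + c * \<psi> y) x = S \<phi> x + c * S \<psi> x"
      using 1 by (simp add: S_def algebra_simps)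
  qed
qed

text \<open>Richardson iteration: since \<open>S = 1 + adj op\<close> is self-adjoint with \<open>\<langle>x, S x\<rangle> \<ge> \<parallel>x\<parallel>\<^sup>2\<close> and
  \<open>\<parallel>S x\<parallel>\<^sup>2 \<le> L \<parallel>x\<parallel>\<^sup>2\<close>, the map \<open>x - S x / L\<close> shrinks squared norms by the factor \<open>1 - 1 / L\<close>.\<close>

lemma S_surjective:
  assumes g: "sq_integrable M g"
  shows "\<exists>x. sq_integrable M x \<and> (AE t in M. S x t = g t)"
proof -
  define L where "L = 2 + 2 * A ^ 4"
  have L: "2 \<le> L" using A_nonneg by (simp add: L_def)
  \<comment> \<open>\<open>d n\<close> is the n-th correction of the iteration started at 0. The
    partial sums \<open>Y n\<close> are the iterates, with residual
    \<open>g - S (Y n) = L * d n\<close>; this is the fact \<open>SY\<close>.\<close>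
  define d where "d = rec_nat (\<lambda>t. g t / L) (\<lambda>n u t. u t - S u t / L)"
  have d0: "d 0 = (\<lambda>t. g t / L)" and dS: "d (Suc n) = (\<lambda>t. d n t - S (d n) t / L)" for n
    by (simp_all add: d_def)
  have d: "sq_integrable M (d n)" for n
  proof (induction n)
    case 0
    show ?case using sq_integrable_cmult[OF g, of "1 / L"] by (simp add: d0)
  next
    case (Suc n)
    show ?case using sq_integrable_diff[OF Suc sq_integrable_cmult[OF S_sq_integrable(1)[OF Suc], of "1 / L"]]
      by (simp add: dS)
  qed
  have dec: "sqn M (d (Suc n)) \<le> (1 - 1 / L) * sqn M (d n)" for n
  proof -
    note Sd = S_sq_integrable[OF d[of n]]
    have "sqn M (d (Suc n)) = sqn M (d n) - 2 * ((\<integral>x. d n x * S (d n) x \<partial>M) / L) + sqn M (S (d n)) / L\<^sup>2"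
      using sqn_diff[OF d[of n] sq_integrable_cmult[OF Sd(1), of "1 / L"]]
      by (simp add: dS power_divide)
    \<comment> \<open>Coercivity gains \<open>2 / L\<close> and the norm bound of \<open>S\<close>
      costs \<open>L / L\<^sup>2\<close>, which leaves the factor \<open>1 - 1 / L\<close>.\<close>
    also have "\<dots> \<le> sqn M (d n) - 2 * (sqn M (d n) / L) + L * sqn M (d n) / L\<^sup>2"
    proof -
      have 1: "sqn M (d n) / L \<le> (\<integral>x. d n x * S (d n) x \<partial>M) / L" using Sd(3) L by (intro divide_right_mono) auto
      have "sqn M (S (d n)) / L\<^sup>2 \<le> L * sqn M (d n) / L\<^sup>2" using Sd(2) by (intro divide_right_mono) (auto simp: L_def)
      with 1 show ?thesis by linarith
    qed
    also have "\<dots> = (1 - 1 / L) * sqn M (d n)" using L by (simp add: power2_eq_square field_simps)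
    finally show ?thesis .
  qed
  have q: "0 < 1 - 1 / L" "1 - 1 / L < 1" using L by (auto simp: field_simps)
  have bnd: "sqn M (d n) \<le> sqn M (d 0) * (1 - 1 / L) ^ n" for n
  proof (induction n)
    case (Suc n)
    have "sqn M (d (Suc n)) \<le> (1 - 1 / L) * (sqn M (d 0) * (1 - 1 / L) ^ n)"
      using dec[of n] mult_left_mono[OF Suc, of "1 - 1 / L"] q by linarith
    then show ?case by (simp add: mult_ac)
  qed simp
  obtain X where X: "sq_integrable M X" and lim: "(\<lambda>n. sqn M (\<lambda>x. X x - (\<Sum>k<n. d k x))) \<longlonglongrightarrow> 0"
    using L2_complete_geometric[OF d q bnd] by blast
  define Y where "Y n x = (\<Sum>k<n. d k x)" for n x
  have Y: "sq_integrable M (Y n)" for n unfolding Y_def by (intro sq_integrable_sum d)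
  have SY: "AE t in M. S (Y n) t = g t - L * d n t" for n
  proof (induction n)
    case 0
    have [simp]: "Y 0 = (\<lambda>_. 0)" by (auto simp: Y_def)
    show ?case using L by (simp add: S_def op_def adj_def d0)
  next
    case (Suc n)
    have Ye: "Y (Suc n) = (\<lambda>t. Y n t + 1 * d n t)" by (auto simp: Y_def)
    from Suc S_add[OF Y[of n] d[of n], of 1] show ?case unfolding Ye
    proof eventually_elim
      fix t assume "S (Y n) t = g t - L * d n t" "S (\<lambda>y. Y n y + 1 * d n y) t = S (Y n) t + 1 * S (d n) t"
      moreover have "L * d (Suc n) t = L * d n t - S (d n) t" using L by (simp add: dS right_diff_distrib)
      ultimately show "S (\<lambda>t. Y n t + 1 * d n t) t = g t - L * d (Suc n) t" by simp
    qed
  qed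
  have "sqn M (\<lambda>t. S X t - g t) \<le> 2 * L * sqn M (\<lambda>t. X t - Y n t) + 2 * L\<^sup>2 * (sqn M (d 0) * (1 - 1 / L) ^ n)" for n
  proof -
    define Z where "Z t = X t - Y n t" for t
    have Z: "sq_integrable M Z" unfolding Z_def by (intro sq_integrable_diff X Y)
    have "AE t in M. S X t - g t = S Z t + - L * d n t"
      using SY[of n] S_add[OF X Y[of n], of "-1"]
      by eventually_elim (simp add: Z_def[abs_def])
    then have "sqn M (\<lambda>t. S X t - g t) = sqn M (\<lambda>t. S Z t + - L * d n t)"
      using S_sq_integrable(1)[OF X] S_sq_integrable(1)[OF Z] d[of n] g
      by (intro sqn_cong_AE) (auto simp: sq_integrable_def)
    also have "\<dots> \<le> 2 * sqn M (S Z) + 2 * sqn M (\<lambda>t. - L * d n t)"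
      by (intro sqn_add_le S_sq_integrable Z sq_integrable_cmult d)
    also have "sqn M (\<lambda>t. - L * d n t) = L\<^sup>2 * sqn M (d n)" by (simp add: power_mult_distrib)
    also have "2 * sqn M (S Z) + 2 * (L\<^sup>2 * sqn M (d n)) \<le> 2 * (L * sqn M Z) + 2 * (L\<^sup>2 * (sqn M (d 0) * (1 - 1 / L) ^ n))"
      using S_sq_integrable(2)[OF Z] bnd[of n]
      by (intro add_mono mult_left_mono) (auto simp: L_def)
    finally show ?thesis by (simp add: Z_def mult.assoc)
  qed
  moreover have "(\<lambda>n. 2 * L * sqn M (\<lambda>t. X t - Y n t) + 2 * L\<^sup>2 * (sqn M (d 0) * (1 - 1 / L) ^ n))
      \<longlonglongrightarrow> 2 * L * 0 + 2 * L\<^sup>2 * (sqn M (d 0) * 0)"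
    using lim q unfolding Y_def by (intro tendsto_intros LIMSEQ_power_zero) auto
  ultimately have "sqn M (\<lambda>t. S X t - g t) \<le> 2 * L * 0 + 2 * L\<^sup>2 * (sqn M (d 0) * 0)"
    by (intro LIMSEQ_le_const) auto
  moreover have "0 \<le> sqn M (\<lambda>t. S X t - g t)" by simp
  ultimately have "sqn M (\<lambda>t. S X t - g t) = 0" by linarith
  then have "AE t in M. S X t - g t = 0"
    using sqn_eq_0_iff[OF sq_integrable_diff[OF S_sq_integrable(1)[OF X] g]] by simp
  then show ?thesis using X by auto
qed

lemma S_injective:
  assumes x: "sq_integrable M x" and y: "sq_integrable M y" and eq: "AE t in M. S x t = S y t"
  shows "AE t in M. x t = y t"
proof -
  define z where "z t = x t - y t" for t
  have z: "sq_integrable M z" unfolding z_def by (intro sq_integrable_diff x y)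
  have "AE t in M. S z t = 0"
    using S_add[OF x y, of "-1"] eq by eventually_elim (simp add: z_def[abs_def])
  then have "(\<integral>t. z t * S z t \<partial>M) = (\<integral>t. 0 \<partial>M)"
    using z S_sq_integrable(1)[OF z] by (intro integral_cong_AE) (auto simp: sq_integrable_def)
  then have "sqn M z + sqn M (op z) = 0" using S_sq_integrable(3)[OF z] by simp
  moreover have "0 \<le> sqn M z" "0 \<le> sqn M (op z)" by simp_all
  ultimately have "sqn M z = 0" by linarith
  then have "AE t in M. z t = 0" using sqn_eq_0_iff[OF z] by simp
  then show ?thesis by (simp add: z_def)
qed

text \<open>With \<open>b = x + z\<close> the terms linear in \<open>z\<close> are
  \<open>- 2 * \<langle>g - x, z\<rangle>\<close> and
  \<open>2 * \<langle>op x, op z\<rangle>\<close>. They cancel by the equation for \<open>x\<close>,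
  since \<open>\<langle>op x, op z\<rangle> = \<langle>adj (op x), z\<rangle>\<close>; the remainder
  is \<open>\<parallel>z\<parallel>\<^sup>2 + \<parallel>op z\<parallel>\<^sup>2\<close>.\<close>

lemma S_solution_minimizes:
  assumes g: "sq_integrable M g" and x: "sq_integrable M x" and b: "sq_integrable M b"
    and eq: "AE t in M. S x t = g t"
  shows "sqn M (\<lambda>t. g t - x t) + sqn M (op x) \<le> sqn M (\<lambda>t. g t - b t) + sqn M (op b)"
proof -
  define z where "z t = b t - x t" for t
  have z: "sq_integrable M z" unfolding z_def by (intro sq_integrable_diff x b)
  note gx = sq_integrable_diff[OF g x]
  note o = op_sq_integrable(2)
  have "sqn M (\<lambda>t. g t - b t) = sqn M (\<lambda>t. (g t - x t) - z t)" by (simp add: z_def)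
  then have 1: "sqn M (\<lambda>t. g t - b t) = sqn M (\<lambda>t. g t - x t) - 2 * (\<integral>t. (g t - x t) * z t \<partial>M) + sqn M z"
    using sqn_diff[OF gx z] by simp
  have "AE t in M. op b t = op x t + op z t"
    using op_add[OF x z, of 1] by (simp add: z_def)
  then have "sqn M (op b) = sqn M (\<lambda>t. op x t + op z t)"
    using o[OF b] o[OF x] o[OF z] by (intro sqn_cong_AE) (auto simp: sq_integrable_def)
  then have 2: "sqn M (op b) = sqn M (op x) + 2 * (\<integral>t. op x t * op z t \<partial>M) + sqn M (op z)"
    using sqn_add[OF o[OF x] o[OF z]] by simp
  have "(\<integral>t. op x t * op z t \<partial>M) = (\<integral>t. z t * adj (op x) t \<partial>M)"
    using adj_eq[OF z o[OF x]] by (simp add: mult.commute)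
  also have "\<dots> = (\<integral>t. (g t - x t) * z t \<partial>M)"
    using eq z flip.op_sq_integrable(2)[unfolded flip_op, OF o[OF x]] gx
    by (intro integral_cong_AE) (auto simp: sq_integrable_def S_def)
  finally have 3: "(\<integral>t. op x t * op z t \<partial>M) = (\<integral>t. (g t - x t) * z t \<partial>M)" .
  have "0 \<le> sqn M z" "0 \<le> sqn M (op z)" by simp_all
  then show ?thesis using 1 2 3 by linarith
qed

text \<open>Exhibits \<open>adj op\<close> as an integral operator with the iterated kernel, the
  shape it has in the Fredholm equation. Fubini's theorem applies at those \<open>t\<close> where
  the kernel pairs integrably with \<open>op\<close> of \<open>\<bar>\<phi>\<bar>\<close>, that is,
  almost everywhere.\<close>

lemma adj_op_kernel:
  assumes \<phi>: "sq_integrable M \<phi>"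
  shows "AE t in M. (\<integral>z. (\<integral>u. k u t * k u z \<partial>M) * \<phi> z \<partial>M) = adj (op \<phi>) t"
proof -
  have [measurable]: "\<phi> \<in> borel_measurable M" using \<phi> by (simp add: sq_integrable_def)
  from flip.op_sq_integrable(1)[OF op_sq_integrable(4)[OF \<phi>]] AE_space show ?thesis
  proof eventually_elim
    fix t assume i: "integrable M (\<lambda>u. k u t * op (\<lambda>y. \<bar>\<phi> y\<bar>) u)" and t[measurable]: "t \<in> space M"
    have I: "integrable (M \<Otimes>\<^sub>M M) (\<lambda>(u, z). k u t * (k u z * \<phi> z))"
    proof (rule P.Fubini_integrable)
      show "(\<lambda>(u, z). k u t * (k u z * \<phi> z)) \<in> borel_measurable (M \<Otimes>\<^sub>M M)" by measurable
      show "integrable M (\<lambda>u. \<integral>z. norm (case (u, z) of (u, z) \<Rightarrow> k u t * (k u z * \<phi> z)) \<partial>M)"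
        using i kernel_nonneg by (simp add: op_def abs_mult)
      show "AE u in M. integrable M (\<lambda>z. case (u, z) of (u, z) \<Rightarrow> k u t * (k u z * \<phi> z))"
        using op_sq_integrable(1)[OF \<phi>] by eventually_elim (auto intro: integrable_mult_right)
    qed
    have "(\<integral>z. (\<integral>u. k u t * k u z \<partial>M) * \<phi> z \<partial>M) = (\<integral>z. (\<integral>u. k u t * (k u z * \<phi> z) \<partial>M) \<partial>M)"
      by (simp add: mult.assoc[symmetric])
    also have "\<dots> = (\<integral>u. (\<integral>z. k u t * (k u z * \<phi> z) \<partial>M) \<partial>M)"
      by (rule P.Fubini_integral[OF I])
    also have "\<dots> = adj (op \<phi>) t" by (simp add: adj_def op_def)
    finally show "(\<integral>z. (\<integral>u. k u t * k u z \<partial>M) * \<phi> z \<partial>M) = adj (op \<phi>) t" .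
  qed
qed

end

subsection \<open>Beta integrals\<close>

lemma Beta_real_nonneg:
  assumes "0 < p" "0 < (q::real)" shows "0 \<le> Beta p q"
  using has_integral_Beta_real[OF assms] by (rule has_integral_nonneg) auto

lemma nn_integral_beta_interval:
  fixes a b p q :: real
  assumes "a < b" "0 < p" "0 < q"
  shows "(\<integral>\<^sup>+u. ennreal ((u - a) powr (p - 1) * (b - u) powr (q - 1)) * indicator {a<..<b} u \<partial>lborel)
     = ennreal ((b - a) powr (p + q - 1) * Beta p q)"
proof -
  define c where "c = b - a"
  have c: "0 < c" using assms by (simp add: c_def)
  have B: "0 \<le> Beta p q" by (intro Beta_real_nonneg assms)
  have 0: "(\<integral>\<^sup>+x. ennreal (x powr (p - 1) * (1 - x) powr (q - 1)) * indicator {0..1} x \<partial>lborel) = ennreal (Beta p q)"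
    by (intro nn_integral_has_integral_lebesgue' has_integral_Beta_real assms) auto
  have "(\<integral>\<^sup>+u. ennreal ((u - a) powr (p - 1) * (b - u) powr (q - 1)) * indicator {a<..<b} u \<partial>lborel)
    = ennreal \<bar>c\<bar> * (\<integral>\<^sup>+x. ennreal ((a + c * x - a) powr (p - 1) * (b - (a + c * x)) powr (q - 1)) * indicator {a<..<b} (a + c * x) \<partial>lborel)"
    using c by (intro nn_integral_real_affine) auto
  also have "(\<integral>\<^sup>+x. ennreal ((a + c * x - a) powr (p - 1) * (b - (a + c * x)) powr (q - 1)) * indicator {a<..<b} (a + c * x) \<partial>lborel)
    = (\<integral>\<^sup>+x. ennreal (c powr (p + q - 2)) * (ennreal (x powr (p - 1) * (1 - x) powr (q - 1)) * indicator {0..1} x) \<partial>lborel)"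
  proof (intro nn_integral_cong)
    fix x :: real
    have e: "b - (a + c * x) = c * (1 - x)" by (simp add: c_def algebra_simps)
    have ind: "a + c * x \<in> {a<..<b} \<longleftrightarrow> x \<in> {0<..<1}"
    proof -
      have "a + c * x < b \<longleftrightarrow> 0 < c * (1 - x)" using e by linarith
      then show ?thesis using c by (simp add: zero_less_mult_iff)
    qed
    show "ennreal ((a + c * x - a) powr (p - 1) * (b - (a + c * x)) powr (q - 1)) * indicator {a<..<b} (a + c * x)
      = ennreal (c powr (p + q - 2)) * (ennreal (x powr (p - 1) * (1 - x) powr (q - 1)) * indicator {0..1} x)"
    proof (cases "x \<in> {0<..<1}")
      case True
      have "(c * x) powr (p - 1) * (c * (1 - x)) powr (q - 1) = c powr (p + q - 2) * (x powr (p - 1) * (1 - x) powr (q - 1))"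
      proof -
        have "c powr (p + q - 2) = c powr (p - 1) * c powr (q - 1)" by (simp add: powr_add[symmetric])
        then show ?thesis using True c by (simp add: powr_mult mult_ac)
      qed
      then show ?thesis using True ind c unfolding e by (simp add: ennreal_mult[symmetric])
    next
      case False
      \<comment> \<open>At the end points the convention \<open>0 powr a = 0\<close> makes the
        closed and the open interval agree pointwise.\<close>
      then have "x \<in> {0..1} \<Longrightarrow> x = 0 \<or> x = 1" by auto
      then have "ennreal (x powr (p - 1) * (1 - x) powr (q - 1)) * indicator {0..1} x = 0"
        by (cases "x \<in> {0..1}") auto
      moreover have "indicator {a<..<b} (a + c * x) = (0 :: ennreal)"
        using False ind by (intro indicator_simps(2)) blast
      ultimately show ?thesis by (simp only: mult_zero_right)
    qed
  qed
  also have "\<dots> = ennreal (c powr (p + q - 2)) * ennreal (Beta p q)"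
    by (subst nn_integral_cmult) (auto simp: 0)
  also have "ennreal \<bar>c\<bar> * \<dots> = ennreal (c powr (p + q - 1) * Beta p q)"
  proof -
    have "c powr (p + q - 1) = c * c powr (p + q - 2)"
      using c powr_add[of c 1 "p + q - 2"] by (simp add: algebra_simps)
    then show ?thesis using c B by (simp add: ennreal_mult[symmetric] mult.assoc)
  qed
  finally show ?thesis by (simp add: c_def)
qed

lemma nn_integral_powr_tail:
  fixes v \<alpha> :: real
  assumes "0 < v" "0 < \<alpha>"
  shows "(\<integral>\<^sup>+w. ennreal (\<alpha> * w powr (- \<alpha> - 1)) * indicator {v..} w \<partial>lborel) = ennreal (v powr (- \<alpha>))"
proof -
  have "(\<integral>\<^sup>+w. ennreal (\<alpha> * w powr (- \<alpha> - 1)) * indicator {v..} w \<partial>lborel) = ennreal (0 - - (v powr (- \<alpha>)))"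
  proof (rule nn_integral_FTC_atLeast)
    show "DERIV (\<lambda>w. - (w powr (- \<alpha>))) w :> \<alpha> * w powr (- \<alpha> - 1)" if "v \<le> w" for w
      using that assms by (auto intro!: derivative_eq_intros)
    show "0 \<le> \<alpha> * w powr (- \<alpha> - 1)" for w using assms by simp
    have "((\<lambda>w. - (w powr (- \<alpha>))) \<longlongrightarrow> - 0) at_top"
      using assms by (intro tendsto_minus tendsto_neg_powr filterlim_ident) auto
    then show "((\<lambda>w. - (w powr (- \<alpha>))) \<longlongrightarrow> 0) at_top" by simp
  qed auto
  then show ?thesis by simp
qed

text \<open>Up to a constant this is the right-sided Riemann--Liouville derivative of order \<open>\<alpha>\<close> on \<open>[u,s]\<close>
  of \<open>w powr (- \<alpha>)\<close>, whose boundary term at \<open>s\<close> is absorbed by the part \<open>w > s\<close> of the integral.\<close>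

definition trunc_int :: "real \<Rightarrow> real \<Rightarrow> real \<Rightarrow> ennreal" where
  "trunc_int \<alpha> s u = (\<integral>\<^sup>+w. ennreal (\<alpha> * w powr (- \<alpha> - 1) * (min w s - u) powr (- \<alpha>)) * indicator {u..} w \<partial>lborel)"

text \<open>With the constraint \<open>u \<le> w\<close> as an indicator of the pair, the integrand
  is jointly measurable at sight, as measurability in \<open>u\<close> and Tonelli's theorem
  require.\<close>

lemma trunc_int_alt: "trunc_int \<alpha> s u = (\<integral>\<^sup>+w. ennreal (\<alpha> * w powr (- \<alpha> - 1) * (min w s - u) powr (- \<alpha>)) * indicator {(u, w). u \<le> w} (u, w) \<partial>lborel)"
  unfolding trunc_int_def by (intro nn_integral_cong) (simp add: indicator_def)

lemma trunc_int_measurable[measurable]: "trunc_int \<alpha> s \<in> borel_measurable borel"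
proof -
  show ?thesis unfolding trunc_int_alt[abs_def] by measurable
qed

text \<open>Abel's inversion. After the exchange of integrals the inner one runs over
  \<open>(v, min w s)\<close> and is a beta integral with parameters \<open>\<alpha>\<close> and
  \<open>1 - \<alpha>\<close>; as these add up to 1, the length of the interval drops out. The outer
  integral is then a pure power tail from \<open>v\<close>, whichever side of \<open>s\<close> the
  point \<open>w\<close> lies on.\<close>

lemma nn_integral_trunc_int:
  assumes \<alpha>: "0 < \<alpha>" "\<alpha> < 1" and v: "0 < v" "v < s"
  shows "(\<integral>\<^sup>+u. ennreal ((u - v) powr (\<alpha> - 1)) * indicator {v<..<s} u * trunc_int \<alpha> s u \<partial>lborel)
      = ennreal (Beta \<alpha> (1 - \<alpha>) * v powr (- \<alpha>))"
proof -
  have B: "0 \<le> Beta \<alpha> (1 - \<alpha>)" using \<alpha> by (intro Beta_real_nonneg) auto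
  define F where "F u w = ennreal ((u - v) powr (\<alpha> - 1)) * indicator {v<..<s} u *
     (ennreal (\<alpha> * w powr (- \<alpha> - 1) * (min w s - u) powr (- \<alpha>)) * indicator {(u, w). u \<le> w} (u, w))" for u w
  have [measurable]: "case_prod F \<in> borel_measurable (lborel \<Otimes>\<^sub>M lborel)" unfolding F_def by measurable
  have "(\<integral>\<^sup>+u. ennreal ((u - v) powr (\<alpha> - 1)) * indicator {v<..<s} u * trunc_int \<alpha> s u \<partial>lborel) = (\<integral>\<^sup>+u. \<integral>\<^sup>+w. F u w \<partial>lborel \<partial>lborel)"
    unfolding F_def trunc_int_alt by (subst nn_integral_cmult) auto
  also have "\<dots> = (\<integral>\<^sup>+w. \<integral>\<^sup>+u. F u w \<partial>lborel \<partial>lborel)"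
    by (rule lborel_pair.Fubini') measurable
  also have "\<dots> = (\<integral>\<^sup>+w. ennreal (Beta \<alpha> (1 - \<alpha>)) * (ennreal (\<alpha> * w powr (- \<alpha> - 1)) * indicator {v..} w) \<partial>lborel)"
  proof (rule nn_integral_cong_AE, rule AE_mp[OF AE_lborel_singleton[of v]], rule AE_I2, rule impI)
    fix w assume "w \<noteq> v"
    show "(\<integral>\<^sup>+u. F u w \<partial>lborel) = ennreal (Beta \<alpha> (1 - \<alpha>)) * (ennreal (\<alpha> * w powr (- \<alpha> - 1)) * indicator {v..} w)"
    proof (cases "v < w")
      case False
      then have "F u w = 0" for u by (auto simp: F_def indicator_def)
      then show ?thesis using False \<open>w \<noteq> v\<close> by simp
    next
      case True
      define m where "m = min w s"
      have m: "v < m" using True v by (simp add: m_def)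
      have "F u w = ennreal (\<alpha> * w powr (- \<alpha> - 1)) * (ennreal ((u - v) powr (\<alpha> - 1) * (m - u) powr ((1 - \<alpha>) - 1)) * indicator {v<..<m} u)" for u
      proof (cases "v < u \<and> u < m")
        case T: True
        then have i: "u < s" "u \<le> w" by (auto simp: m_def)
        have "F u w = ennreal ((u - v) powr (\<alpha> - 1)) * ennreal (\<alpha> * w powr (- \<alpha> - 1) * (m - u) powr (- \<alpha>))"
          using T i by (simp add: F_def m_def)
        then show ?thesis using T \<alpha> by (simp add: ennreal_mult[symmetric] mult_ac)
      next
        case f: False
        then have "F u w = 0" by (auto simp: F_def m_def indicator_def min_def split: if_splits)
        then show ?thesis using f by auto
      qed
      then have "(\<integral>\<^sup>+u. F u w \<partial>lborel) = ennreal (\<alpha> * w powr (- \<alpha> - 1)) *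
          (\<integral>\<^sup>+u. ennreal ((u - v) powr (\<alpha> - 1) * (m - u) powr ((1 - \<alpha>) - 1)) * indicator {v<..<m} u \<partial>lborel)"
        by (simp add: nn_integral_cmult)
      also have "\<dots> = ennreal (\<alpha> * w powr (- \<alpha> - 1)) * ennreal (Beta \<alpha> (1 - \<alpha>))"
        using m \<alpha> by (subst nn_integral_beta_interval) auto
      finally show ?thesis using True by (simp add: mult.commute)
    qed
  qed
  also have "\<dots> = ennreal (Beta \<alpha> (1 - \<alpha>)) * ennreal (v powr (- \<alpha>))"
    using v \<alpha> by (simp add: nn_integral_cmult nn_integral_powr_tail)
  finally show ?thesis using B by (simp add: ennreal_mult)
qed

section \<open>Incomplete beta integrals\<close>

text \<open>The incomplete beta function with parameters \<open>2 * \<alpha>\<close> and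
  \<open>- \<alpha>\<close>. For positive \<open>\<alpha>\<close> the negative second parameter
  makes it infinite from \<open>x = 1\<close> on, hence values in \<open>ennreal\<close>.\<close>

definition inc_beta :: "real \<Rightarrow> real \<Rightarrow> ennreal" where
  "inc_beta \<alpha> x = (\<integral>\<^sup>+y. ennreal (y powr (2 * \<alpha> - 1) * (1 - y) powr (- \<alpha> - 1)) * indicator {0..x} y \<partial>lborel)"

text \<open>Integrates the derivative of
  \<open>y powr (2 * \<alpha>) * (1 - y) powr (- \<alpha>)\<close>, regrouped through
  \<open>2 * (1 - y) + y = 1 + (1 - y)\<close>. It relates the second parameter
  \<open>- \<alpha>\<close> to \<open>1 - \<alpha>\<close>, and also shows that
  \<open>inc_beta\<close> is finite below 1.\<close>

lemma powr_mult_eq_inc_beta: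
  assumes \<alpha>: "0 < \<alpha>" "\<alpha> < 1" and x: "0 < x" "x < 1"
  shows "ennreal (x powr (2 * \<alpha>) * (1 - x) powr (- \<alpha>))
     = ennreal \<alpha> * inc_beta \<alpha> x
       + ennreal \<alpha> * (\<integral>\<^sup>+y. ennreal (y powr (2 * \<alpha> - 1) * (1 - y) powr (- \<alpha>)) * indicator {0..x} y \<partial>lborel)"
proof -
  define f where "f y = \<alpha> * (y powr (2 * \<alpha> - 1) * (1 - y) powr (- \<alpha> - 1)) + \<alpha> * (y powr (2 * \<alpha> - 1) * (1 - y) powr (- \<alpha>))" for y
  have "(f has_integral (x powr (2 * \<alpha>) * (1 - x) powr (- \<alpha>) - 0 powr (2 * \<alpha>) * (1 - 0) powr (- \<alpha>))) {0..x}"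
  proof (rule fundamental_theorem_of_calculus_interior)
    show "continuous_on {0..x} (\<lambda>y. y powr (2 * \<alpha>) * (1 - y) powr (- \<alpha>))"
      using x \<alpha> by (intro continuous_intros continuous_on_powr') auto
    fix y assume y: "y \<in> {0<..<x}"
    have e1: "y powr (2 * \<alpha>) = y powr (2 * \<alpha> - 1) * y" using y powr_add[of y "2 * \<alpha> - 1" 1] by simp
    have e2: "(1 - y) powr (- \<alpha>) = (1 - y) powr (- \<alpha> - 1) * (1 - y)" using y x powr_add[of "1 - y" "- \<alpha> - 1" 1] by simp
    have "((\<lambda>y. y powr (2 * \<alpha>) * (1 - y) powr (- \<alpha>)) has_real_derivative
        2 * \<alpha> * y powr (2 * \<alpha> - 1) * (1 - y) powr (- \<alpha>) + \<alpha> * (1 - y) powr (- \<alpha> - 1) * y powr (2 * \<alpha>)) (at y)"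
      using y x by (auto intro!: derivative_eq_intros)
    also have "2 * \<alpha> * y powr (2 * \<alpha> - 1) * (1 - y) powr (- \<alpha>) + \<alpha> * (1 - y) powr (- \<alpha> - 1) * y powr (2 * \<alpha>) = f y"
      unfolding f_def e1 e2 by (simp add: algebra_simps)
    finally show "((\<lambda>y. y powr (2 * \<alpha>) * (1 - y) powr (- \<alpha>)) has_vector_derivative f y) (at y)"
      by (simp add: has_real_derivative_iff_has_vector_derivative)
  qed (use x in auto)
  moreover have "0 \<le> f y" for y using \<alpha> by (simp add: f_def)
  ultimately have "(\<integral>\<^sup>+y. ennreal (f y) * indicator {0..x} y \<partial>lborel) = ennreal (x powr (2 * \<alpha>) * (1 - x) powr (- \<alpha>))"
    by (subst nn_integral_has_integral_lebesgue') auto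
  moreover have "(\<integral>\<^sup>+y. ennreal (f y) * indicator {0..x} y \<partial>lborel)
     = (\<integral>\<^sup>+y. ennreal \<alpha> * (ennreal (y powr (2 * \<alpha> - 1) * (1 - y) powr (- \<alpha> - 1)) * indicator {0..x} y)
      + ennreal \<alpha> * (ennreal (y powr (2 * \<alpha> - 1) * (1 - y) powr (- \<alpha>)) * indicator {0..x} y) \<partial>lborel)"
    unfolding f_def using \<alpha> by (intro nn_integral_cong) (auto simp: indicator_def ennreal_plus ennreal_mult)
  ultimately show ?thesis by (simp add: nn_integral_add nn_integral_cmult inc_beta_def)
qed

text \<open>The substitution \<open>y = u / w\<close>. It is carried out through the increasing map
  \<open>w \<mapsto> - u / w\<close>, and a reflection restores the sign.\<close>

lemma nn_integral_inversion:
  assumes \<alpha>: "0 < \<alpha>" "\<alpha> < 1" and u: "0 < u" "u < s"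
  shows "(\<integral>\<^sup>+w. ennreal (\<alpha> * w powr (- \<alpha> - 1) * (w - u) powr (- \<alpha>)) * indicator {u..s} w \<partial>lborel)
     = ennreal (\<alpha> * u powr (- 2 * \<alpha>)) *
       (\<integral>\<^sup>+y. ennreal (y powr (2 * \<alpha> - 1) * (1 - y) powr (- \<alpha>)) * indicator {u / s..1} y \<partial>lborel)"
proof -
  define f where "f \<eta> = (- \<eta>) powr (2 * \<alpha> - 1) * (1 + \<eta>) powr (- \<alpha>)" for \<eta> :: real
  have g: "- u / u = -1" using u by simp
  have "(\<integral>\<^sup>+\<eta>. ennreal (f \<eta>) * indicator {- u / u..- u / s} \<eta> \<partial>lborel)
     = (\<integral>\<^sup>+w. ennreal (f (- u / w) * (u / w\<^sup>2)) * indicator {u..s} w \<partial>lborel)"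
  proof -
    have "(\<integral>\<^sup>+\<eta>. ennreal (f \<eta> * indicator {- u / u..- u / s} \<eta>) \<partial>lborel)
     = (\<integral>\<^sup>+w. ennreal (f (- u / w) * (u / w\<^sup>2) * indicator {u..s} w) \<partial>lborel)"
    proof (rule nn_integral_substitution)
      show "set_borel_measurable borel {- u / u..- u / s} f" unfolding f_def set_borel_measurable_def by measurable
      show "continuous_on {u..s} (\<lambda>w. u / w\<^sup>2)" using u by (intro continuous_intros) auto
      show "((\<lambda>w. - u / w) has_real_derivative u / w\<^sup>2) (at w)" if "w \<in> {u..s}" for w
        using that u by (auto intro!: derivative_eq_intros simp: power2_eq_square field_simps)
    qed (use u in auto)
    moreover have "ennreal (f \<eta>) * indicator X \<eta> = ennreal (f \<eta> * indicat_real X \<eta>)"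
      "ennreal (f (- u / w) * (u / w\<^sup>2)) * indicator X w = ennreal (f (- u / w) * (u / w\<^sup>2) * indicat_real X w)" for \<eta> X w
      by (simp_all add: indicator_def)
    ultimately show ?thesis by (simp only:)
  qed
  also have "\<dots> = (\<integral>\<^sup>+w. ennreal (u powr (2 * \<alpha>) / \<alpha>) * (ennreal (\<alpha> * w powr (- \<alpha> - 1) * (w - u) powr (- \<alpha>)) * indicator {u..s} w) \<partial>lborel)"
  proof (intro nn_integral_cong)
    fix w
    have "f (- u / w) * (u / w\<^sup>2) = u powr (2 * \<alpha>) / \<alpha> * (\<alpha> * w powr (- \<alpha> - 1) * (w - u) powr (- \<alpha>))" if w: "u \<le> w"
    proof -
      have wp: "0 < w" using w u by simp
      have "1 + - u / w = (w - u) / w" using wp by (simp add: field_simps)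
      then have "f (- u / w) = (u / w) powr (2 * \<alpha> - 1) * ((w - u) / w) powr (- \<alpha>)" by (simp add: f_def)
      also have "\<dots> = u powr (2 * \<alpha> - 1) * w powr (1 - 2 * \<alpha>) * ((w - u) powr (- \<alpha>) * w powr \<alpha>)"
        using wp u w by (simp add: powr_divide powr_minus_divide[of w] powr_diff powr_minus field_simps)
      finally have "f (- u / w) * (u / w\<^sup>2) = (u powr (2 * \<alpha> - 1) * u) * (w powr (1 - 2 * \<alpha>) * w powr \<alpha> * w powr (-2)) * (w - u) powr (- \<alpha>)"
        using wp by (simp add: powr_minus powr_numeral field_simps)
      also have "u powr (2 * \<alpha> - 1) * u = u powr (2 * \<alpha>)" using u powr_add[of u "2 * \<alpha> - 1" 1] by simp
      also have "w powr (1 - 2 * \<alpha>) * w powr \<alpha> * w powr (-2) = w powr (- \<alpha> - 1)"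
        unfolding powr_add[symmetric] by (intro arg_cong2[where f = "(powr)"]) auto
      finally show ?thesis using \<alpha> by simp
    qed
    then show "ennreal (f (- u / w) * (u / w\<^sup>2)) * indicator {u..s} w
      = ennreal (u powr (2 * \<alpha>) / \<alpha>) * (ennreal (\<alpha> * w powr (- \<alpha> - 1) * (w - u) powr (- \<alpha>)) * indicator {u..s} w)"
      using \<alpha> by (auto simp: indicator_def ennreal_mult[symmetric])
  qed
  also have "\<dots> = ennreal (u powr (2 * \<alpha>) / \<alpha>) * (\<integral>\<^sup>+w. ennreal (\<alpha> * w powr (- \<alpha> - 1) * (w - u) powr (- \<alpha>)) * indicator {u..s} w \<partial>lborel)"
    by (simp add: nn_integral_cmult)
  finally have 1: "(\<integral>\<^sup>+\<eta>. ennreal (f \<eta>) * indicator {- u / u..- u / s} \<eta> \<partial>lborel) = \<dots>" .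
  have "(\<integral>\<^sup>+\<eta>. ennreal (f \<eta>) * indicator {- u / u..- u / s} \<eta> \<partial>lborel)
     = ennreal \<bar>-1\<bar> * (\<integral>\<^sup>+y. ennreal (f (0 + -1 * y)) * indicator {- u / u..- u / s} (0 + -1 * y) \<partial>lborel)"
    unfolding f_def by (intro nn_integral_real_affine) auto
  also have "\<dots> = (\<integral>\<^sup>+y. ennreal (y powr (2 * \<alpha> - 1) * (1 - y) powr (- \<alpha>)) * indicator {u / s..1} y \<partial>lborel)"
    unfolding g by (auto simp: f_def indicator_def intro!: nn_integral_cong)
  finally have 2: "ennreal (u powr (2 * \<alpha>) / \<alpha>) * (\<integral>\<^sup>+w. ennreal (\<alpha> * w powr (- \<alpha> - 1) * (w - u) powr (- \<alpha>)) * indicator {u..s} w \<partial>lborel)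
     = (\<integral>\<^sup>+y. ennreal (y powr (2 * \<alpha> - 1) * (1 - y) powr (- \<alpha>)) * indicator {u / s..1} y \<partial>lborel)"
    using 1 by simp
  have "\<alpha> * u powr (- 2 * \<alpha>) * (u powr (2 * \<alpha>) / \<alpha>) = 1" using \<alpha> u by (simp add: powr_add[symmetric])
  then have "ennreal (\<alpha> * u powr (- 2 * \<alpha>)) * ennreal (u powr (2 * \<alpha>) / \<alpha>) = 1"
    using \<alpha> by (subst ennreal_mult[symmetric]) auto
  then show ?thesis unfolding 2[symmetric] by (simp add: mult.assoc[symmetric])
qed

text \<open>Euler's integral for a hypergeometric function whose first and third parameters are both
  \<open>2 * \<alpha> + 1\<close>, so that it reduces to a power. The Moebius substitution
  \<open>w = z / D z\<close> fixes 0 and 1; the exponents of \<open>D z\<close>, including the 2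
  from the Jacobian, add up to 0 and leave an ordinary beta integral.\<close>

lemma nn_integral_moebius_beta:
  assumes \<alpha>: "0 < \<alpha>" and y: "0 \<le> y" "y < 1"
  shows "(\<integral>\<^sup>+w. ennreal ((1 - w) powr (\<alpha> - 1) * w powr \<alpha> * (1 - y * w) powr (- 2 * \<alpha> - 1)) * indicator {0..1} w \<partial>lborel)
     = ennreal (Beta (\<alpha> + 1) \<alpha> * (1 - y) powr (- \<alpha> - 1))"
proof -
  define f where "f w = (1 - w) powr (\<alpha> - 1) * w powr \<alpha> * (1 - y * w) powr (- 2 * \<alpha> - 1)" for w
  define D where "D z = 1 - y * (1 - z)" for z
  have D: "0 < D z" if "z \<in> {0..1}" for z
  proof -
    have "y * (1 - z) \<le> y * 1" using that y by (intro mult_left_mono) auto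
    then show ?thesis using y by (simp add: D_def)
  qed
  define g where "g z = z / D z" for z
  define g' where "g' z = (1 - y) / (D z)\<^sup>2" for z
  have g01: "g 0 = 0" "g 1 = 1" by (simp_all add: g_def D_def)
  have "(\<integral>\<^sup>+w. ennreal (f w * indicator {g 0..g 1} w) \<partial>lborel) = (\<integral>\<^sup>+z. ennreal (f (g z) * g' z * indicator {0..1} z) \<partial>lborel)"
  proof (rule nn_integral_substitution)
    show "set_borel_measurable borel {g 0..g 1} f" unfolding f_def set_borel_measurable_def by measurable
    show "continuous_on {0..1} g'"
    proof -
      have nz: "\<forall>z\<in>{0..1}. (D z)\<^sup>2 \<noteq> 0" using D by force
      have "continuous_on {0..1} (\<lambda>z. (D z)\<^sup>2)" unfolding D_def by (intro continuous_intros)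
      then show ?thesis unfolding g'_def by (rule continuous_on_divide[OF continuous_on_const _ nz])
    qed
    show "(g has_real_derivative g' z) (at z)" if "z \<in> {0..1}" for z
    proof -
      have dD: "(D has_real_derivative y) (at z)" unfolding D_def by (auto intro!: derivative_eq_intros)
      have "(g has_real_derivative ((1 * D z - z * y) / (D z * D z))) (at z)"
        unfolding g_def using D[OF that] by (intro DERIV_divide dD DERIV_ident) auto
      moreover have "1 * D z - z * y = 1 - y" by (simp add: D_def algebra_simps)
      ultimately show ?thesis by (simp add: g'_def power2_eq_square)
    qed
    show "0 \<le> g' z" for z using y by (simp add: g'_def)
  qed simp
  also have "\<dots> = (\<integral>\<^sup>+z. ennreal ((1 - y) powr (- \<alpha> - 1)) * (ennreal (z powr ((\<alpha> + 1) - 1) * (1 - z) powr (\<alpha> - 1)) * indicator {0<..<1} z) \<partial>lborel)"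
  proof (intro nn_integral_cong)
    fix z
    show "ennreal (f (g z) * g' z * indicator {0..1} z)
      = ennreal ((1 - y) powr (- \<alpha> - 1)) * (ennreal (z powr ((\<alpha> + 1) - 1) * (1 - z) powr (\<alpha> - 1)) * indicator {0<..<1} z)"
    proof (cases "z \<in> {0<..<1}")
      case True
      then have Dz: "0 < D z" using D[of z] by auto
      have y1: "0 < 1 - y" using y by simp
      have e1: "1 - g z = (1 - y) * (1 - z) / D z" using Dz by (simp add: g_def field_simps) (simp add: D_def algebra_simps)
      have e2: "1 - y * g z = (1 - y) / D z" using Dz by (simp add: g_def field_simps) (simp add: D_def algebra_simps)
      define l where "l = ln (D z)"
      define m where "m = ln (1 - y)"
      have Dp: "D z powr a = exp (a * l)" for a using Dz by (simp add: powr_def l_def)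
      have yp: "(1 - y) powr a = exp (a * m)" for a using y1 by (simp add: powr_def m_def)
      have "f (g z) * g' z = ((1 - y) powr (\<alpha> - 1) * (1 - z) powr (\<alpha> - 1) / D z powr (\<alpha> - 1)) * (z powr \<alpha> / D z powr \<alpha>)
          * ((1 - y) powr (- 2 * \<alpha> - 1) / D z powr (- 2 * \<alpha> - 1)) * ((1 - y) powr 1 / D z powr 2)"
        unfolding f_def e1 e2 g'_def using True Dz y1
        by (simp add: g_def powr_divide powr_mult)
      also have "\<dots> = ((1 - y) powr (\<alpha> - 1) * (1 - y) powr (- 2 * \<alpha> - 1) * (1 - y) powr 1)
           * (z powr \<alpha> * (1 - z) powr (\<alpha> - 1)) / (D z powr (\<alpha> - 1) * D z powr \<alpha> * D z powr (- 2 * \<alpha> - 1) * D z powr 2)"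
        by (simp add: divide_simps mult_ac)
      also have "(1 - y) powr (\<alpha> - 1) * (1 - y) powr (- 2 * \<alpha> - 1) * (1 - y) powr 1 = (1 - y) powr (- \<alpha> - 1)"
        unfolding powr_add[symmetric] by (intro arg_cong2[where f = "(powr)"]) auto
      also have "D z powr (\<alpha> - 1) * D z powr \<alpha> * D z powr (- 2 * \<alpha> - 1) * D z powr 2 = D z powr 0"
        unfolding powr_add[symmetric] by (intro arg_cong2[where f = "(powr)"]) auto
      finally show ?thesis using True Dz by (simp add: ennreal_mult[symmetric])
    next
      case False
      then have 0: "f (g z) * g' z * indicator {0..1} z = 0"
        using g01 by (cases "z = 0 \<or> z = 1") (auto simp: f_def indicator_def)
      have "indicator {0<..<1} z = (0 :: ennreal)" using False by (intro indicator_simps(2))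
      then show ?thesis unfolding 0 by simp
    qed
  qed
  also have "\<dots> = ennreal ((1 - y) powr (- \<alpha> - 1)) * ennreal (Beta (\<alpha> + 1) \<alpha>)"
    using nn_integral_beta_interval[of 0 1 "\<alpha> + 1" \<alpha>] \<alpha> by (simp add: nn_integral_cmult)
  also have "\<dots> = ennreal (Beta (\<alpha> + 1) \<alpha> * (1 - y) powr (- \<alpha> - 1))"
    using \<alpha> by (simp add: ennreal_mult[symmetric] Beta_real_nonneg mult.commute)
  finally have "(\<integral>\<^sup>+w. ennreal (f w * indicator {0..1} w) \<partial>lborel) = \<dots>" by (simp only: g01)
  moreover have "ennreal (f w) * indicator {0..1} w = ennreal (f w * indicator {0..1} w)" for w
    by (simp add: indicator_def)
  ultimately show ?thesis unfolding f_def by (simp only:)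
qed

text \<open>The integrand is the \<open>y\<close>-derivative of the right-hand factor, since
  \<open>(1 - y * w) + y * w = 1\<close>. Written as an integral over \<open>y\<close>, this factor
  can be exchanged with the integral over \<open>w\<close> in
  \<open>nn_integral_increment_density\<close>.\<close>

lemma nn_integral_powr_ftc:
  assumes \<alpha>: "0 < \<alpha>" and x: "0 < x" "x < 1" and w: "0 \<le> w" "w \<le> 1"
  shows "(\<integral>\<^sup>+y. ennreal (2 * \<alpha> * (y powr (2 * \<alpha> - 1) * (1 - y * w) powr (- 2 * \<alpha> - 1))) * indicator {0..x} y \<partial>lborel)
     = ennreal (x powr (2 * \<alpha>) * (1 - x * w) powr (- 2 * \<alpha>))"
proof -
  have pos: "0 < 1 - y * w" if "y \<in> {0..x}" for y
  proof -
    have "y * w \<le> y * 1" using that w by (intro mult_left_mono) auto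
    then show ?thesis using that x by auto
  qed
  define f where "f y = 2 * \<alpha> * (y powr (2 * \<alpha> - 1) * (1 - y * w) powr (- 2 * \<alpha> - 1))" for y
  have "(f has_integral (x powr (2 * \<alpha>) * (1 - x * w) powr (- 2 * \<alpha>) - 0 powr (2 * \<alpha>) * (1 - 0 * w) powr (- 2 * \<alpha>))) {0..x}"
  proof (rule fundamental_theorem_of_calculus_interior)
    have "1 - y * w \<noteq> 0" if "y \<in> {0..x}" for y using pos[OF that] by simp
    then show "continuous_on {0..x} (\<lambda>y. y powr (2 * \<alpha>) * (1 - y * w) powr (- 2 * \<alpha>))"
      using \<alpha> by (intro continuous_intros continuous_on_powr') auto
    fix y assume y: "y \<in> {0<..<x}"
    then have p: "0 < 1 - y * w" using pos by auto
    have e1: "y powr (2 * \<alpha>) = y powr (2 * \<alpha> - 1) * y" using y powr_add[of y "2 * \<alpha> - 1" 1] by simp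
    have e2: "(1 - y * w) powr (- 2 * \<alpha>) = (1 - y * w) powr (- 2 * \<alpha> - 1) * (1 - y * w)"
      using p powr_add[of "1 - y * w" "- 2 * \<alpha> - 1" 1] by simp
    have "((\<lambda>y. (1 - y * w) powr (- 2 * \<alpha>)) has_real_derivative - 2 * \<alpha> * (1 - y * w) powr (- 2 * \<alpha> - 1) * (- w)) (at y)"
      using p by (auto intro!: derivative_eq_intros)
    moreover have "((\<lambda>y. y powr (2 * \<alpha>)) has_real_derivative 2 * \<alpha> * y powr (2 * \<alpha> - 1)) (at y)"
      using y by (intro has_real_derivative_powr) auto
    ultimately have "((\<lambda>y. y powr (2 * \<alpha>) * (1 - y * w) powr (- 2 * \<alpha>)) has_real_derivative
        2 * \<alpha> * y powr (2 * \<alpha> - 1) * (1 - y * w) powr (- 2 * \<alpha>)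
        + (- 2 * \<alpha> * (1 - y * w) powr (- 2 * \<alpha> - 1) * (- w)) * y powr (2 * \<alpha>)) (at y)"
      by (intro DERIV_mult)
    also have "2 * \<alpha> * y powr (2 * \<alpha> - 1) * (1 - y * w) powr (- 2 * \<alpha>)
        + (- 2 * \<alpha> * (1 - y * w) powr (- 2 * \<alpha> - 1) * (- w)) * y powr (2 * \<alpha>) = f y"
      unfolding f_def e1 e2 by (simp add: algebra_simps)
    finally show "((\<lambda>y. y powr (2 * \<alpha>) * (1 - y * w) powr (- 2 * \<alpha>)) has_vector_derivative f y) (at y)"
      by (simp add: has_real_derivative_iff_has_vector_derivative)
  qed (use x in auto)
  moreover have "0 \<le> f y" for y using \<alpha> by (simp add: f_def)
  ultimately have "(\<integral>\<^sup>+y. ennreal (f y) * indicator {0..x} y \<partial>lborel) = ennreal (x powr (2 * \<alpha>) * (1 - x * w) powr (- 2 * \<alpha>))"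
    by (subst nn_integral_has_integral_lebesgue') auto
  then show ?thesis by (simp only: f_def)
qed

text \<open>Split at \<open>w = s\<close>. Below \<open>s\<close> the inversion gives a beta
  integral over \<open>[u / s, 1]\<close>. Above \<open>s\<close> the truncated factor is constant
  in \<open>w\<close>, and \<open>powr_mult_eq_inc_beta\<close> turns this part into
  \<open>inc_beta\<close> plus the missing beta integral over \<open>[0, u / s]\<close>. The two
  beta pieces join to a complete one.\<close>

lemma trunc_int_eq_inc_beta:
  assumes \<alpha>: "0 < \<alpha>" "\<alpha> < 1" and u: "0 < u" "u < s"
  shows "trunc_int \<alpha> s u = ennreal (\<alpha> * u powr (- 2 * \<alpha>)) * (inc_beta \<alpha> (u / s) + ennreal (Beta (2 * \<alpha>) (1 - \<alpha>)))"
proof -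
  define x where "x = u / s"
  have x: "0 < x" "x < 1" using u by (auto simp: x_def)
  define b where "b y = ennreal (y powr (2 * \<alpha> - 1) * (1 - y) powr (- \<alpha>))" for y
  have [measurable]: "b \<in> borel_measurable borel" unfolding b_def by measurable
  define c where "c = ennreal (\<alpha> * u powr (- 2 * \<alpha>))"
  define F where "F w = ennreal (\<alpha> * w powr (- \<alpha> - 1) * (min w s - u) powr (- \<alpha>))" for w
  have [measurable]: "F \<in> borel_measurable borel" unfolding F_def by measurable
  have "trunc_int \<alpha> s u = (\<integral>\<^sup>+w. F w * indicator {u..s} w + F w * indicator {s..} w \<partial>lborel)"
    unfolding trunc_int_def F_def[symmetric]
    by (rule nn_integral_cong_AE, rule AE_mp[OF AE_lborel_singleton[of s]], rule AE_I2)
       (use u in \<open>auto simp: indicator_def\<close>)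
  also have "\<dots> = (\<integral>\<^sup>+w. F w * indicator {u..s} w \<partial>lborel) + (\<integral>\<^sup>+w. F w * indicator {s..} w \<partial>lborel)"
    by (intro nn_integral_add) measurable
  also have "(\<integral>\<^sup>+w. F w * indicator {s..} w \<partial>lborel)
      = (\<integral>\<^sup>+w. ennreal ((s - u) powr (- \<alpha>)) * (ennreal (\<alpha> * w powr (- \<alpha> - 1)) * indicator {s..} w) \<partial>lborel)"
    using \<alpha> by (intro nn_integral_cong) (auto simp: F_def indicator_def min_def ennreal_mult[symmetric] mult_ac)
  also have "\<dots> = ennreal ((s - u) powr (- \<alpha>)) * ennreal (s powr (- \<alpha>))"
    using u \<alpha> by (simp add: nn_integral_cmult nn_integral_powr_tail)
  also have "\<dots> = ennreal (u powr (- 2 * \<alpha>)) * ennreal (x powr (2 * \<alpha>) * (1 - x) powr (- \<alpha>))"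
  proof -
    have "1 - x = (s - u) / s" using u by (simp add: x_def field_simps)
    then have "x powr (2 * \<alpha>) * (1 - x) powr (- \<alpha>) = u powr (2 * \<alpha>) * (s - u) powr (- \<alpha>) / (s powr (2 * \<alpha>) * s powr (- \<alpha>))"
      using u by (simp add: x_def powr_divide)
    also have "s powr (2 * \<alpha>) * s powr (- \<alpha>) = s powr \<alpha>" unfolding powr_add[symmetric] by simp
    finally have e: "x powr (2 * \<alpha>) * (1 - x) powr (- \<alpha>) = u powr (2 * \<alpha>) * (s - u) powr (- \<alpha>) / s powr \<alpha>" .
    have "u powr (- 2 * \<alpha>) * u powr (2 * \<alpha>) = 1" using u by (simp add: powr_add[symmetric])
    then have "u powr (- 2 * \<alpha>) * (x powr (2 * \<alpha>) * (1 - x) powr (- \<alpha>)) = (s - u) powr (- \<alpha>) / s powr \<alpha>"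
      unfolding e by (metis mult.assoc mult_1 times_divide_eq_right)
    also have "\<dots> = (s - u) powr (- \<alpha>) * s powr (- \<alpha>)" by (simp add: powr_minus_divide)
    finally have "u powr (- 2 * \<alpha>) * (x powr (2 * \<alpha>) * (1 - x) powr (- \<alpha>)) = (s - u) powr (- \<alpha>) * s powr (- \<alpha>)" .
    then show ?thesis by (simp add: ennreal_mult[symmetric])
  qed
  also have "ennreal (x powr (2 * \<alpha>) * (1 - x) powr (- \<alpha>)) = ennreal \<alpha> * inc_beta \<alpha> x + ennreal \<alpha> * (\<integral>\<^sup>+y. b y * indicator {0..x} y \<partial>lborel)"
    unfolding b_def by (rule powr_mult_eq_inc_beta[OF \<alpha> x])
  also have "(\<integral>\<^sup>+w. F w * indicator {u..s} w \<partial>lborel) = c * (\<integral>\<^sup>+y. b y * indicator {x..1} y \<partial>lborel)"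
    unfolding c_def b_def x_def nn_integral_inversion[OF \<alpha> u, symmetric]
    by (intro nn_integral_cong) (auto simp: F_def indicator_def)
  also have "ennreal (u powr (- 2 * \<alpha>)) * (ennreal \<alpha> * inc_beta \<alpha> x + ennreal \<alpha> * (\<integral>\<^sup>+y. b y * indicator {0..x} y \<partial>lborel))
     = c * (inc_beta \<alpha> x + (\<integral>\<^sup>+y. b y * indicator {0..x} y \<partial>lborel))"
    using \<alpha> by (simp add: c_def ennreal_mult distrib_left mult_ac)
  also have "c * (\<integral>\<^sup>+y. b y * indicator {x..1} y \<partial>lborel) + \<dots>
     = c * (inc_beta \<alpha> x + ((\<integral>\<^sup>+y. b y * indicator {0..x} y \<partial>lborel) + (\<integral>\<^sup>+y. b y * indicator {x..1} y \<partial>lborel)))"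
    by (simp add: distrib_left add_ac)
  also have "(\<integral>\<^sup>+y. b y * indicator {0..x} y \<partial>lborel) + (\<integral>\<^sup>+y. b y * indicator {x..1} y \<partial>lborel)
     = (\<integral>\<^sup>+y. b y * indicator {0..x} y + b y * indicator {x..1} y \<partial>lborel)"
    by (intro nn_integral_add[symmetric]) measurable
  also have "\<dots> = (\<integral>\<^sup>+y. ennreal ((y - 0) powr (2 * \<alpha> - 1) * (1 - y) powr ((1 - \<alpha>) - 1)) * indicator {0<..<1} y \<partial>lborel)"
    by (rule nn_integral_cong_AE, rule AE_mp[OF AE_lborel_singleton[of x]], rule AE_I2)
       (use x in \<open>auto simp: indicator_def b_def\<close>)
  also have "\<dots> = ennreal (Beta (2 * \<alpha>) (1 - \<alpha>))"
    using nn_integral_beta_interval[of 0 1 "2 * \<alpha>" "1 - \<alpha>"] \<alpha> by simp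
  finally show ?thesis by (simp add: c_def x_def)
qed

text \<open>Scaling by \<open>v = u * w\<close> prepares \<open>nn_integral_powr_ftc\<close>; after
  Tonelli the integral over \<open>w\<close> is \<open>nn_integral_moebius_beta\<close>. This
  evaluates the non-elementary half of the integral of \<open>kern u\<close> against
  \<open>\<rho> s\<close> in the same function \<open>inc_beta\<close> that describes
  \<open>trunc_int\<close>, which makes the two comparable.\<close>

lemma nn_integral_increment_density:
  assumes \<alpha>: "0 < \<alpha>" and u: "0 < u" "u < s"
  shows "(\<integral>\<^sup>+v. ennreal ((u - v) powr (\<alpha> - 1) * v powr \<alpha> * (s - v) powr (- 2 * \<alpha>)) * indicator {0..u} v \<partial>lborel)
     = ennreal (2 * \<alpha> * Beta (\<alpha> + 1) \<alpha>) * inc_beta \<alpha> (u / s)"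
proof -
  define x where "x = u / s"
  have x: "0 < x" "x < 1" using u by (auto simp: x_def)
  have B: "0 \<le> Beta (\<alpha> + 1) \<alpha>" using \<alpha> by (intro Beta_real_nonneg) auto
  define b where "b w = (1 - w) powr (\<alpha> - 1) * w powr \<alpha>" for w
  have "(\<integral>\<^sup>+v. ennreal ((u - v) powr (\<alpha> - 1) * v powr \<alpha> * (s - v) powr (- 2 * \<alpha>)) * indicator {0..u} v \<partial>lborel)
     = ennreal \<bar>u\<bar> * (\<integral>\<^sup>+w. ennreal ((u - (0 + u * w)) powr (\<alpha> - 1) * (0 + u * w) powr \<alpha> * (s - (0 + u * w)) powr (- 2 * \<alpha>)) * indicator {0..u} (0 + u * w) \<partial>lborel)"
    using u by (intro nn_integral_real_affine) auto
  also have "\<dots> = (\<integral>\<^sup>+w. ennreal \<bar>u\<bar> * (ennreal ((u - (0 + u * w)) powr (\<alpha> - 1) * (0 + u * w) powr \<alpha> * (s - (0 + u * w)) powr (- 2 * \<alpha>)) * indicator {0..u} (0 + u * w)) \<partial>lborel)"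
    by (intro nn_integral_cmult[symmetric]) measurable
  also have "\<dots> = (\<integral>\<^sup>+w. ennreal (b w) * indicator {0..1} w * ennreal (x powr (2 * \<alpha>) * (1 - x * w) powr (- 2 * \<alpha>)) \<partial>lborel)"
  proof (intro nn_integral_cong)
    fix w
    have ind: "0 + u * w \<in> {0..u} \<longleftrightarrow> w \<in> {0..1}" using u by (auto simp: zero_le_mult_iff)
    show "ennreal \<bar>u\<bar> * (ennreal ((u - (0 + u * w)) powr (\<alpha> - 1) * (0 + u * w) powr \<alpha> * (s - (0 + u * w)) powr (- 2 * \<alpha>)) * indicator {0..u} (0 + u * w))
      = ennreal (b w) * indicator {0..1} w * ennreal (x powr (2 * \<alpha>) * (1 - x * w) powr (- 2 * \<alpha>))"
    proof (cases "w \<in> {0..1}")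
      case True
      have xw: "0 \<le> 1 - x * w" using True x mult_le_one[of x w] by auto
      have e: "u - u * w = u * (1 - w)" "s - u * w = s * (1 - x * w)" using u by (simp_all add: x_def algebra_simps)
      have "u * ((u - u * w) powr (\<alpha> - 1) * (u * w) powr \<alpha> * (s - u * w) powr (- 2 * \<alpha>))
        = b w * (u powr 1 * u powr (\<alpha> - 1) * u powr \<alpha>) * s powr (- 2 * \<alpha>) * (1 - x * w) powr (- 2 * \<alpha>)"
        unfolding e using True u xw by (simp add: powr_mult b_def)
      also have "u powr 1 * u powr (\<alpha> - 1) * u powr \<alpha> = u powr (2 * \<alpha>)"
        unfolding powr_add[symmetric] by (intro arg_cong2[where f = "(powr)"]) auto
      also have "b w * u powr (2 * \<alpha>) * s powr (- 2 * \<alpha>) * (1 - x * w) powr (- 2 * \<alpha>)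
        = b w * (x powr (2 * \<alpha>) * (1 - x * w) powr (- 2 * \<alpha>))"
        using u by (simp add: x_def powr_divide powr_minus field_simps)
      finally show ?thesis using True ind u by (simp add: ennreal_mult[symmetric] b_def)
    next
      case False
      then have i0: "indicator {0..u} (0 + u * w) = (0 :: ennreal)" using ind by (intro indicator_simps(2)) blast
      have i1: "indicator {0..1} w = (0 :: ennreal)" using False by (intro indicator_simps(2))
      show ?thesis unfolding i0 i1 by simp
    qed
  qed
  also have "\<dots> = (\<integral>\<^sup>+w. \<integral>\<^sup>+y. ennreal (b w) * indicator {0..1} w *
      (ennreal (2 * \<alpha> * (y powr (2 * \<alpha> - 1) * (1 - y * w) powr (- 2 * \<alpha> - 1))) * indicator {0..x} y) \<partial>lborel \<partial>lborel)"
  proof (intro nn_integral_cong)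
    fix w
    show "ennreal (b w) * indicator {0..1} w * ennreal (x powr (2 * \<alpha>) * (1 - x * w) powr (- 2 * \<alpha>))
      = (\<integral>\<^sup>+y. ennreal (b w) * indicator {0..1} w * (ennreal (2 * \<alpha> * (y powr (2 * \<alpha> - 1) * (1 - y * w) powr (- 2 * \<alpha> - 1))) * indicator {0..x} y) \<partial>lborel)"
      using nn_integral_powr_ftc[OF \<alpha> x, of w]
      by (subst nn_integral_cmult) (auto simp: indicator_def[of "{0..1}"])
  qed
  also have "\<dots> = (\<integral>\<^sup>+y. \<integral>\<^sup>+w. ennreal (b w) * indicator {0..1} w *
      (ennreal (2 * \<alpha> * (y powr (2 * \<alpha> - 1) * (1 - y * w) powr (- 2 * \<alpha> - 1))) * indicator {0..x} y) \<partial>lborel \<partial>lborel)"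
    unfolding b_def by (rule lborel_pair.Fubini') measurable
  also have "\<dots> = (\<integral>\<^sup>+y. ennreal (2 * \<alpha> * Beta (\<alpha> + 1) \<alpha>) * (ennreal (y powr (2 * \<alpha> - 1) * (1 - y) powr (- \<alpha> - 1)) * indicator {0..x} y) \<partial>lborel)"
  proof (intro nn_integral_cong)
    fix y
    show "(\<integral>\<^sup>+w. ennreal (b w) * indicator {0..1} w *
      (ennreal (2 * \<alpha> * (y powr (2 * \<alpha> - 1) * (1 - y * w) powr (- 2 * \<alpha> - 1))) * indicator {0..x} y) \<partial>lborel)
      = ennreal (2 * \<alpha> * Beta (\<alpha> + 1) \<alpha>) * (ennreal (y powr (2 * \<alpha> - 1) * (1 - y) powr (- \<alpha> - 1)) * indicator {0..x} y)"
    proof (cases "y \<in> {0..x}")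
      case True
      have "(\<integral>\<^sup>+w. ennreal (b w) * indicator {0..1} w *
         (ennreal (2 * \<alpha> * (y powr (2 * \<alpha> - 1) * (1 - y * w) powr (- 2 * \<alpha> - 1))) * indicator {0..x} y) \<partial>lborel)
        = (\<integral>\<^sup>+w. ennreal (2 * \<alpha> * y powr (2 * \<alpha> - 1)) * (ennreal (b w * (1 - y * w) powr (- 2 * \<alpha> - 1)) * indicator {0..1} w) \<partial>lborel)"
        using True \<alpha> by (intro nn_integral_cong) (auto simp: indicator_def b_def ennreal_mult[symmetric] mult_ac)
      also have "\<dots> = ennreal (2 * \<alpha> * y powr (2 * \<alpha> - 1)) * ennreal (Beta (\<alpha> + 1) \<alpha> * (1 - y) powr (- \<alpha> - 1))"
        using nn_integral_moebius_beta[OF \<alpha>, of y] True x by (simp add: nn_integral_cmult b_def)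
      finally show ?thesis using True B \<alpha> by (simp add: ennreal_mult[symmetric] mult_ac)
    qed simp
  qed
  also have "\<dots> = ennreal (2 * \<alpha> * Beta (\<alpha> + 1) \<alpha>) * inc_beta \<alpha> x"
    by (simp add: nn_integral_cmult inc_beta_def)
  finally show ?thesis by (simp add: x_def)
qed

subsection \<open>The Volterra kernel of fractional Brownian motion\<close>

locale hurst =
  fixes H :: real
  assumes H_pos: "0 < H" and H_less: "H < 1 / 2"
begin

definition \<alpha> :: real where "\<alpha> = 1 / 2 - H"

definition ck :: real where "ck = inverse (C1 H) * (1 / Gamma \<alpha>)"

text \<open>The factor is forced by comparing \<open>nn_integral_increment_density\<close> with
  \<open>trunc_int_eq_inc_beta\<close> in \<open>nn_integral_kern_\<rho>\<close>.\<close>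

definition cm :: real where "cm = ck * (2 * H * Beta (\<alpha> + 1) \<alpha>)"

text \<open>The kernel of \<open>K0 H\<close>. Its support, the open triangle, agrees with the
  convention \<open>0 powr a = 0\<close> at \<open>u = 0\<close> and \<open>u = t\<close>.\<close>

definition kern :: "real \<Rightarrow> real \<Rightarrow> real" where
  "kern t u = (if 0 < u \<and> u < t then ck * t powr (- \<alpha>) * ((t - u) powr (\<alpha> - 1) * u powr \<alpha>) else 0)"

text \<open>For \<open>0 < v < s\<close> this is the derivative of \<open>fbm_cov H v s\<close> in \<open>v\<close>.\<close>

definition \<rho> :: "real \<Rightarrow> real \<Rightarrow> real" where
  "\<rho> s v = H * (v powr (- 2 * \<alpha>) + (s - v) powr (- 2 * \<alpha>))"

text \<open>The Molchan--Golosov kernel: splitting \<open>trunc_int\<close> at \<open>w = s\<close>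
  gives, up to the factor \<open>cm\<close>,
  \<open>(s / u) powr (- \<alpha>) * (s - u) powr (- \<alpha>)\<close> plus
  \<open>\<alpha> * u powr \<alpha>\<close> times the integral of
  \<open>w powr (- \<alpha> - 1) * (w - u) powr (- \<alpha>)\<close> over
  \<open>[u, s]\<close>.\<close>

definition m :: "real \<Rightarrow> real \<Rightarrow> real" where
  "m s u = (if 0 < u \<and> u < s then cm * u powr \<alpha> * enn2real (trunc_int \<alpha> s u) else 0)"

lemma \<alpha>: "0 < \<alpha>" "\<alpha> < 1" "\<alpha> < 1 / 2" "H = 1 / 2 - \<alpha>"
  using H_pos H_less by (auto simp: \<alpha>_def)

lemma C1_sq: "(C1 H)\<^sup>2 = 2 * H * Gamma (\<alpha> + 1) * Gamma (1 - \<alpha>) / Gamma (2 * \<alpha> + 1)"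
  and C1_pos: "0 < C1 H"
proof -
  have a: "H + 1/2 = 1 - \<alpha>" "3/2 - H = \<alpha> + 1" "2 - 2 * H = 2 * \<alpha> + 1" by (auto simp: \<alpha>_def)
  have p: "0 < 2 * H * Gamma (1 - \<alpha>) * Gamma (\<alpha> + 1) / Gamma (2 * \<alpha> + 1)"
    using \<alpha> H_pos by (intro divide_pos_pos mult_pos_pos Gamma_real_pos) auto
  then show "0 < C1 H" unfolding C1_def a by simp
  show "(C1 H)\<^sup>2 = 2 * H * Gamma (\<alpha> + 1) * Gamma (1 - \<alpha>) / Gamma (2 * \<alpha> + 1)"
    unfolding C1_def a using p by (simp add: mult_ac)
qed

lemma Gamma_nonzero: "Gamma x \<noteq> 0" if "0 < x" for x :: real
  using less_imp_neq[OF Gamma_real_pos[OF that]] by (rule not_sym)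

lemma Gamma_pos: "0 < Gamma \<alpha>" using \<alpha> by (intro Gamma_real_pos) auto

lemma ck_pos: "0 < ck" using C1_pos Gamma_pos by (simp add: ck_def)

lemma cm_nonneg: "0 \<le> cm"
  using ck_pos H_pos \<alpha> by (simp add: cm_def Beta_real_nonneg)

lemma C2_eq: "C2 H = ck\<^sup>2"
  by (simp add: C2_def ck_def \<alpha>_def power_mult_distrib power_divide power_inverse divide_simps)

lemma kern_nonneg: "0 \<le> kern t u"
  using ck_pos by (simp add: kern_def)

lemma m_nonneg: "0 \<le> m s u"
  using cm_nonneg by (simp add: m_def)

lemma kern_measurable[measurable]: "case_prod kern \<in> borel_measurable (borel \<Otimes>\<^sub>M borel)"
  unfolding kern_def by measurable

lemma m_measurable[measurable]: "m s \<in> borel_measurable borel"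
  unfolding m_def[abs_def] by measurable

lemma trunc_int_finite:
  assumes "0 < u" "u < s" shows "trunc_int \<alpha> s u < \<infinity>"
proof -
  have x: "0 < u / s" "u / s < 1" using assms by auto
  have "ennreal \<alpha> * inc_beta \<alpha> (u / s) \<le> ennreal ((u / s) powr (2 * \<alpha>) * (1 - u / s) powr (- \<alpha>))"
    unfolding powr_mult_eq_inc_beta[OF \<alpha>(1,2) x] by simp
  also have "\<dots> < \<infinity>" by simp
  finally have "inc_beta \<alpha> (u / s) \<noteq> \<infinity>" using \<alpha> by (auto simp: ennreal_mult_top)
  then show ?thesis unfolding trunc_int_eq_inc_beta[OF \<alpha>(1,2) assms]
    by (auto simp: ennreal_mult_less_top less_top)
qed

lemma ennreal_m:
  assumes "0 < u" "u < s" shows "ennreal (m s u) = ennreal (cm * u powr \<alpha>) * trunc_int \<alpha> s u"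
proof -
  have "ennreal (enn2real (trunc_int \<alpha> s u)) = trunc_int \<alpha> s u" using trunc_int_finite[OF assms] by (intro ennreal_enn2real) simp
  then show ?thesis using assms cm_nonneg by (simp add: m_def ennreal_mult)
qed

text \<open>The one place where the value of \<open>C1 H\<close> matters: \<open>2 * H\<close> times
  the beta functions of \<open>cm\<close> and of Abel's inversion is
  \<open>(C1 H)\<^sup>2 * (Gamma \<alpha>)\<^sup>2\<close>, the inverse of
  \<open>ck\<^sup>2\<close>.\<close>

lemma constants_eq_1: "cm * ck * Beta \<alpha> (1 - \<alpha>) = 1"
proof -
  have G: "Gamma \<alpha> \<noteq> 0" "Gamma (2 * \<alpha> + 1) \<noteq> 0" "Gamma (\<alpha> + 1) \<noteq> 0" "Gamma (1 - \<alpha>) \<noteq> 0" "C1 H \<noteq> 0"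
    using C1_pos \<alpha> by (auto simp: Gamma_nonzero)
  have B: "Beta (\<alpha> + 1) \<alpha> = Gamma (\<alpha> + 1) * Gamma \<alpha> / Gamma (2 * \<alpha> + 1)"
    by (simp add: Beta_def algebra_simps)
  have B': "Beta \<alpha> (1 - \<alpha>) = Gamma \<alpha> * Gamma (1 - \<alpha>)" by (simp add: Beta_def)
  have "cm * ck * Beta \<alpha> (1 - \<alpha>) = (2 * H * Gamma (\<alpha> + 1) * Gamma (1 - \<alpha>) / Gamma (2 * \<alpha> + 1)) / (C1 H)\<^sup>2"
    unfolding cm_def ck_def B B' using G by (simp add: power2_eq_square field_simps)
  also have "\<dots> = 1" using G unfolding C1_sq[symmetric] by simp
  finally show ?thesis .
qed

text \<open>Matches the two complete beta integrals that meet in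
  \<open>nn_integral_kern_\<rho>\<close>: the one from the part
  \<open>v powr (- 2 * \<alpha>)\<close> of \<open>\<rho>\<close> and the one in
  \<open>trunc_int_eq_inc_beta\<close>.\<close>

lemma Beta_product: "2 * \<alpha> * Beta (\<alpha> + 1) \<alpha> * Beta (2 * \<alpha>) (1 - \<alpha>) = Beta (1 - \<alpha>) \<alpha>"
proof -
  have G: "Gamma (2 * \<alpha> + 1) \<noteq> 0" "Gamma (\<alpha> + 1) \<noteq> 0"
    using \<alpha> by (auto simp: Gamma_nonzero)
  have P: "Gamma (2 * \<alpha> + 1) = 2 * \<alpha> * Gamma (2 * \<alpha>)"
    using \<alpha> by (intro Gamma_plus1) (auto elim!: nonpos_Ints_cases)
  have B1: "Beta (\<alpha> + 1) \<alpha> = Gamma (\<alpha> + 1) * Gamma \<alpha> / Gamma (2 * \<alpha> + 1)"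
    by (simp add: Beta_def algebra_simps)
  have B2: "Beta (2 * \<alpha>) (1 - \<alpha>) = Gamma (2 * \<alpha>) * Gamma (1 - \<alpha>) / Gamma (\<alpha> + 1)"
    by (simp add: Beta_def algebra_simps)
  have "2 * \<alpha> * Beta (\<alpha> + 1) \<alpha> * Beta (2 * \<alpha>) (1 - \<alpha>)
     = (2 * \<alpha> * Gamma (2 * \<alpha>)) * (Gamma \<alpha> * Gamma (1 - \<alpha>)) / Gamma (2 * \<alpha> + 1)"
    unfolding B1 B2 using G by simp
  also have "\<dots> = Gamma \<alpha> * Gamma (1 - \<alpha>)" unfolding P[symmetric] using G by simp
  finally show ?thesis by (simp add: Beta_def mult.commute)
qed

text \<open>The adjoint of \<open>kern\<close> maps \<open>m s\<close> to the indicator of \<open>(0,s)\<close>.\<close>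

lemma nn_integral_m_kern:
  assumes v: "0 < v" "v < s"
  shows "(\<integral>\<^sup>+u. ennreal (m s u * kern u v) \<partial>lborel) = 1"
proof -
  have "(\<integral>\<^sup>+u. ennreal (m s u * kern u v) \<partial>lborel)
     = (\<integral>\<^sup>+u. ennreal (cm * ck * v powr \<alpha>) * (ennreal ((u - v) powr (\<alpha> - 1)) * indicator {v<..<s} u * trunc_int \<alpha> s u) \<partial>lborel)"
  proof (intro nn_integral_cong)
    fix u
    show "ennreal (m s u * kern u v) = ennreal (cm * ck * v powr \<alpha>) * (ennreal ((u - v) powr (\<alpha> - 1)) * indicator {v<..<s} u * trunc_int \<alpha> s u)"
    proof (cases "v < u \<and> u < s")
      case True
      then have u: "0 < u" "u < s" using v by auto
      have "u powr \<alpha> * u powr (- \<alpha>) = 1" using u by (simp add: powr_add[symmetric])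
      then have e: "cm * u powr \<alpha> * kern u v = cm * ck * v powr \<alpha> * (u - v) powr (\<alpha> - 1)"
        using True v by (simp add: kern_def)
      have "ennreal (m s u * kern u v) = ennreal (m s u) * ennreal (kern u v)"
        by (intro ennreal_mult m_nonneg kern_nonneg)
      also have "\<dots> = ennreal (cm * u powr \<alpha>) * ennreal (kern u v) * trunc_int \<alpha> s u"
        unfolding ennreal_m[OF u] by (simp add: mult_ac)
      also have "ennreal (cm * u powr \<alpha>) * ennreal (kern u v) = ennreal (cm * ck * v powr \<alpha>) * ennreal ((u - v) powr (\<alpha> - 1))"
        using cm_nonneg ck_pos kern_nonneg e by (simp add: ennreal_mult[symmetric])
      finally show ?thesis using True by (simp add: mult.assoc)
    next
      case False
      then have "m s u * kern u v = 0" by (auto simp: m_def kern_def)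
      then show ?thesis using False by auto
    qed
  qed
  also have "\<dots> = ennreal (cm * ck * v powr \<alpha>) * ennreal (Beta \<alpha> (1 - \<alpha>) * v powr (- \<alpha>))"
    by (simp add: nn_integral_cmult nn_integral_trunc_int[OF \<alpha>(1,2) v])
  also have "\<dots> = ennreal ((cm * ck * Beta \<alpha> (1 - \<alpha>)) * (v powr \<alpha> * v powr (- \<alpha>)))"
    using cm_nonneg ck_pos \<alpha> Beta_real_nonneg[of \<alpha> "1 - \<alpha>"] by (simp add: ennreal_mult[symmetric] mult_ac)
  also have "\<dots> = 1" using v by (simp add: constants_eq_1 powr_add[symmetric])
  finally show ?thesis .
qed

text \<open>The formula fails for \<open>u > s\<close>, where \<open>\<rho> s\<close> would need a different sign; \<open>u < s\<close> suffices because
  the covariance is symmetric and \<open>m r\<close> vanishes beyond \<open>r\<close>.\<close>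

lemma nn_integral_kern_\<rho>:
  assumes u: "0 < u" "u < s"
  shows "(\<integral>\<^sup>+v. ennreal (kern u v * \<rho> s v) \<partial>lborel) = ennreal (m s u)"
proof -
  have B0: "0 \<le> Beta (1 - \<alpha>) \<alpha>" "0 \<le> Beta (\<alpha> + 1) \<alpha>" "0 \<le> Beta (2 * \<alpha>) (1 - \<alpha>)"
    using \<alpha> by (auto intro!: Beta_real_nonneg)
  define c where "c = ck * u powr (- \<alpha>) * H"
  have c: "0 \<le> c" using ck_pos H_pos by (simp add: c_def)
  have "(\<integral>\<^sup>+v. ennreal (kern u v * \<rho> s v) \<partial>lborel)
    = (\<integral>\<^sup>+v. ennreal c * (ennreal ((v - 0) powr ((1 - \<alpha>) - 1) * (u - v) powr (\<alpha> - 1)) * indicator {0<..<u} v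
       + ennreal ((u - v) powr (\<alpha> - 1) * v powr \<alpha> * (s - v) powr (- 2 * \<alpha>)) * indicator {0..u} v) \<partial>lborel)"
  proof (intro nn_integral_cong)
    fix v
    show "ennreal (kern u v * \<rho> s v) = ennreal c * (ennreal ((v - 0) powr ((1 - \<alpha>) - 1) * (u - v) powr (\<alpha> - 1)) * indicator {0<..<u} v
       + ennreal ((u - v) powr (\<alpha> - 1) * v powr \<alpha> * (s - v) powr (- 2 * \<alpha>)) * indicator {0..u} v)"
    proof (cases "0 < v \<and> v < u")
      case True
      have "v powr \<alpha> * v powr (- 2 * \<alpha>) = v powr (- \<alpha>)" unfolding powr_add[symmetric] by simp
      then have "kern u v * \<rho> s v = c * (v powr (- \<alpha>) * (u - v) powr (\<alpha> - 1) + (u - v) powr (\<alpha> - 1) * v powr \<alpha> * (s - v) powr (- 2 * \<alpha>))"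
        using True by (simp add: kern_def \<rho>_def c_def algebra_simps)
      then show ?thesis using True c by (simp add: ennreal_mult)
    next
      case False
      then have "kern u v = 0" by (auto simp: kern_def)
      moreover have "(u - v) powr (\<alpha> - 1) * v powr \<alpha> * (s - v) powr (- 2 * \<alpha>) = 0 \<or> v \<notin> {0..u}"
        using False by (cases "v = 0 \<or> v = u") auto
      ultimately show ?thesis using False by auto
    qed
  qed
  also have "\<dots> = ennreal c * ((\<integral>\<^sup>+v. ennreal ((v - 0) powr ((1 - \<alpha>) - 1) * (u - v) powr (\<alpha> - 1)) * indicator {0<..<u} v \<partial>lborel)
       + (\<integral>\<^sup>+v. ennreal ((u - v) powr (\<alpha> - 1) * v powr \<alpha> * (s - v) powr (- 2 * \<alpha>)) * indicator {0..u} v \<partial>lborel))"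
    by (subst nn_integral_cmult, measurable) (simp add: nn_integral_add)
  also have "(\<integral>\<^sup>+v. ennreal ((v - 0) powr ((1 - \<alpha>) - 1) * (u - v) powr (\<alpha> - 1)) * indicator {0<..<u} v \<partial>lborel) = ennreal (Beta (1 - \<alpha>) \<alpha>)"
    using nn_integral_beta_interval[of 0 u "1 - \<alpha>" \<alpha>] \<alpha> u by simp
  also have "(\<integral>\<^sup>+v. ennreal ((u - v) powr (\<alpha> - 1) * v powr \<alpha> * (s - v) powr (- 2 * \<alpha>)) * indicator {0..u} v \<partial>lborel)
      = ennreal (2 * \<alpha> * Beta (\<alpha> + 1) \<alpha>) * inc_beta \<alpha> (u / s)"
    by (rule nn_integral_increment_density[OF \<alpha>(1) u])
  also have "ennreal (Beta (1 - \<alpha>) \<alpha>) = ennreal (2 * \<alpha> * Beta (\<alpha> + 1) \<alpha>) * ennreal (Beta (2 * \<alpha>) (1 - \<alpha>))"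
    using B0 \<alpha> by (simp add: ennreal_mult[symmetric] Beta_product)
  also have "ennreal c * (ennreal (2 * \<alpha> * Beta (\<alpha> + 1) \<alpha>) * ennreal (Beta (2 * \<alpha>) (1 - \<alpha>)) + ennreal (2 * \<alpha> * Beta (\<alpha> + 1) \<alpha>) * inc_beta \<alpha> (u / s))
     = ennreal (c * (2 * \<alpha> * Beta (\<alpha> + 1) \<alpha>)) * (inc_beta \<alpha> (u / s) + ennreal (Beta (2 * \<alpha>) (1 - \<alpha>)))"
    using c B0 \<alpha> by (simp add: ennreal_mult distrib_left mult_ac add.commute)
  also have "c * (2 * \<alpha> * Beta (\<alpha> + 1) \<alpha>) = cm * u powr \<alpha> * (\<alpha> * u powr (- 2 * \<alpha>))"
  proof -
    have "u powr \<alpha> * u powr (- 2 * \<alpha>) = u powr (- \<alpha>)" unfolding powr_add[symmetric] by simp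
    then show ?thesis by (simp add: c_def cm_def mult_ac)
  qed
  also have "ennreal (cm * u powr \<alpha> * (\<alpha> * u powr (- 2 * \<alpha>))) * (inc_beta \<alpha> (u / s) + ennreal (Beta (2 * \<alpha>) (1 - \<alpha>))) = ennreal (m s u)"
    unfolding ennreal_m[OF u] trunc_int_eq_inc_beta[OF \<alpha>(1,2) u] using cm_nonneg \<alpha> by (simp add: ennreal_mult mult_ac)
  finally show ?thesis .
qed

lemma \<rho>_nonneg: "0 \<le> \<rho> s v" using H_pos by (simp add: \<rho>_def)

lemma nn_integral_\<rho>:
  assumes "0 \<le> r" "r \<le> s"
  shows "(\<integral>\<^sup>+v. ennreal (\<rho> s v) * indicator {0..r} v \<partial>lborel) = ennreal (fbm_cov H r s)"
proof -
  have a: "- 2 * \<alpha> = 2 * H - 1" by (simp add: \<alpha>_def)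
  have "(\<rho> s has_integral ((r powr (2 * H) - (s - r) powr (2 * H)) / 2 - (0 powr (2 * H) - (s - 0) powr (2 * H)) / 2)) {0..r}"
  proof (rule fundamental_theorem_of_calculus_interior)
    show "continuous_on {0..r} (\<lambda>v. (v powr (2 * H) - (s - v) powr (2 * H)) / 2)"
      using assms H_pos by (intro continuous_intros continuous_on_powr') auto
    fix v assume v: "v \<in> {0<..<r}"
    have "((\<lambda>v. (s - v) powr (2 * H)) has_real_derivative - (2 * H * (s - v) powr (2 * H - 1))) (at v)"
      using v assms by (auto intro!: derivative_eq_intros)
    moreover have "((\<lambda>v. v powr (2 * H)) has_real_derivative 2 * H * v powr (2 * H - 1)) (at v)"
      using v by (intro has_real_derivative_powr) auto
    ultimately have "((\<lambda>v. (v powr (2 * H) - (s - v) powr (2 * H)) / 2) has_real_derivative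
       (2 * H * v powr (2 * H - 1) - - (2 * H * (s - v) powr (2 * H - 1))) / 2) (at v)"
      by (intro DERIV_cdivide DERIV_diff)
    also have "(2 * H * v powr (2 * H - 1) - - (2 * H * (s - v) powr (2 * H - 1))) / 2 = \<rho> s v"
      unfolding \<rho>_def a by (simp add: distrib_left)
    finally show "((\<lambda>v. (v powr (2 * H) - (s - v) powr (2 * H)) / 2) has_vector_derivative \<rho> s v) (at v)"
      by (simp add: has_real_derivative_iff_has_vector_derivative)
  qed (use assms in auto)
  moreover have "(r powr (2 * H) - (s - r) powr (2 * H)) / 2 - (0 powr (2 * H) - (s - 0) powr (2 * H)) / 2 = fbm_cov H r s"
    using assms by (simp add: fbm_cov_def field_simps)
  ultimately have "(\<rho> s has_integral fbm_cov H r s) {0..r}" by (simp only:)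
  then show ?thesis by (intro nn_integral_has_integral_lebesgue' \<rho>_nonneg)
qed

text \<open>As \<open>r \<le> s\<close>, the support of \<open>m r\<close> lies where
  \<open>m s\<close> is the image of \<open>\<rho> s\<close> under \<open>kern\<close>. Tonelli
  moves \<open>kern\<close> over to \<open>m r\<close>, where it produces the indicator of
  \<open>(0, r)\<close>.\<close>

lemma nn_integral_m_m:
  assumes "0 \<le> r" "r \<le> s"
  shows "(\<integral>\<^sup>+u. ennreal (m r u * m s u) \<partial>lborel) = ennreal (fbm_cov H r s)"
proof -
  have [measurable]: "\<rho> s \<in> borel_measurable borel" unfolding \<rho>_def[abs_def] by measurable
  have "(\<integral>\<^sup>+u. ennreal (m r u * m s u) \<partial>lborel) = (\<integral>\<^sup>+u. \<integral>\<^sup>+v. ennreal (m r u) * ennreal (kern u v * \<rho> s v) \<partial>lborel \<partial>lborel)"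
  proof (intro nn_integral_cong)
    fix u
    show "ennreal (m r u * m s u) = (\<integral>\<^sup>+v. ennreal (m r u) * ennreal (kern u v * \<rho> s v) \<partial>lborel)"
    proof (cases "0 < u \<and> u < r")
      case True
      then show ?thesis using assms m_nonneg
        by (subst nn_integral_cmult) (auto simp: nn_integral_kern_\<rho> ennreal_mult)
    next
      case False
      then have "m r u = 0" by (auto simp: m_def)
      then show ?thesis by simp
    qed
  qed
  also have "\<dots> = (\<integral>\<^sup>+v. \<integral>\<^sup>+u. ennreal (m r u) * ennreal (kern u v * \<rho> s v) \<partial>lborel \<partial>lborel)"
    by (rule lborel_pair.Fubini') measurable
  also have "\<dots> = (\<integral>\<^sup>+v. ennreal (\<rho> s v) * indicator {0..r} v \<partial>lborel)"
  proof (rule nn_integral_cong_AE, rule AE_mp[OF AE_conjI[OF AE_lborel_singleton[of 0] AE_lborel_singleton[of r]]], rule AE_I2, rule impI)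
    fix v assume v: "v \<noteq> 0 \<and> v \<noteq> r"
    have "(\<integral>\<^sup>+u. ennreal (m r u) * ennreal (kern u v * \<rho> s v) \<partial>lborel)
       = (\<integral>\<^sup>+u. ennreal (\<rho> s v) * ennreal (m r u * kern u v) \<partial>lborel)"
      using m_nonneg kern_nonneg \<rho>_nonneg by (intro nn_integral_cong) (simp add: ennreal_mult mult_ac)
    also have "\<dots> = ennreal (\<rho> s v) * (\<integral>\<^sup>+u. ennreal (m r u * kern u v) \<partial>lborel)"
      by (intro nn_integral_cmult) measurable
    also have "(\<integral>\<^sup>+u. ennreal (m r u * kern u v) \<partial>lborel) = indicator {0..r} v"
    proof (cases "0 < v \<and> v < r")
      case True
      then show ?thesis by (simp add: nn_integral_m_kern)
    next
      case False
      then have z: "m r u * kern u v = 0" for u by (auto simp: m_def kern_def)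
      have "indicator {0..r} v = (0 :: ennreal)" using False v by (intro indicator_simps(2)) auto
      then show ?thesis unfolding z by simp
    qed
    finally show "(\<integral>\<^sup>+u. ennreal (m r u) * ennreal (kern u v * \<rho> s v) \<partial>lborel) = ennreal (\<rho> s v) * indicator {0..r} v" .
  qed
  also have "\<dots> = ennreal (fbm_cov H r s)" by (rule nn_integral_\<rho>[OF assms])
  finally show ?thesis .
qed

end

section \<open>Borel functions under Lebesgue measure on an interval\<close>

lemma nn_integral_lebesgue_on_borel:
  assumes "S \<in> sets borel" and f: "f \<in> borel_measurable borel"
  shows "(\<integral>\<^sup>+x. f x \<partial>lebesgue_on S) = (\<integral>\<^sup>+x. f x * indicator S (x::real) \<partial>lborel)"
  using assms by (subst nn_integral_restrict_space) (auto simp: nn_integral_completion)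

lemma borel_measurable_lebesgue_onI:
  assumes "f \<in> borel_measurable borel" shows "f \<in> borel_measurable (lebesgue_on (S :: real set))"
  using assms by (intro measurable_restrict_space1 measurable_completion) simp

lemma AE_lebesgue_on_neq: "AE z in lebesgue_on S. z \<noteq> (t :: real)" if "S \<in> sets lebesgue"
proof -
  have "AE z in lebesgue. z \<noteq> t"
    by (rule AE_I[where N = "{t}"]) auto
  then show ?thesis using that by (subst AE_restrict_space_iff) auto
qed

section \<open>\<open>K0\<close> as a Schur operator on \<open>[0, T]\<close>\<close>

locale hurst_interval = hurst +
  fixes T :: real
  assumes T_pos: "0 < T"
begin

abbreviation \<mu> :: "real measure" where "\<mu> \<equiv> lebesgue_on {0..T}"

text \<open>Equal to \<open>ck * T powr \<alpha> / \<alpha>\<close>, the integral of the majorant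
  from \<open>kern_le\<close> over an interval of length \<open>T\<close>. That majorant depends on
  \<open>t - u\<close> only, so rows and columns obey the same bound.\<close>

definition A :: real where "A = ck * T powr \<alpha> * Beta 1 \<alpha>"

lemma A_nonneg: "0 \<le> A"
  using ck_pos \<alpha> by (simp add: A_def Beta_real_nonneg)

lemma kern_le: "kern t u \<le> ck * (t - u) powr (\<alpha> - 1)"
proof (cases "0 < u \<and> u < t")
  case True
  have "t powr (- \<alpha>) * u powr \<alpha> \<le> t powr (- \<alpha>) * t powr \<alpha>"
    using True \<alpha> by (intro mult_left_mono powr_mono2) auto
  also have "\<dots> = 1" using True by (simp add: powr_add[symmetric])
  finally have "(ck * (t - u) powr (\<alpha> - 1)) * (t powr (- \<alpha>) * u powr \<alpha>) \<le> (ck * (t - u) powr (\<alpha> - 1)) * 1"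
    using ck_pos by (intro mult_left_mono) auto
  then show ?thesis using True by (simp add: kern_def mult_ac)
next
  case False
  then show ?thesis using ck_pos by (auto simp: kern_def)
qed

sublocale schur_kernel \<mu> kern A
proof
  interpret finite_measure \<mu> by (intro finite_measure_lebesgue_on) simp
  show "\<exists>A. countable A \<and> A \<subseteq> sets \<mu> \<and> \<Union> A = space \<mu> \<and> (\<forall>a\<in>A. emeasure \<mu> a \<noteq> \<infinity>)"
    by (rule sigma_finite_countable)
  have "(\<lambda>x. (fst x, snd x)) \<in> \<mu> \<Otimes>\<^sub>M \<mu> \<rightarrow>\<^sub>M borel \<Otimes>\<^sub>M (borel :: real measure)"
  proof (rule measurable_Pair)
    have "(\<lambda>x. x) \<in> \<mu> \<rightarrow>\<^sub>M (borel :: real measure)" by (rule borel_measurable_lebesgue_onI) simp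
    then show "fst \<in> \<mu> \<Otimes>\<^sub>M \<mu> \<rightarrow>\<^sub>M (borel :: real measure)" "snd \<in> \<mu> \<Otimes>\<^sub>M \<mu> \<rightarrow>\<^sub>M (borel :: real measure)"
      by (auto intro: measurable_compose[OF measurable_fst] measurable_compose[OF measurable_snd])
  qed
  from measurable_compose[OF this kern_measurable]
  show "case_prod kern \<in> borel_measurable (\<mu> \<Otimes>\<^sub>M \<mu>)" by (simp add: case_prod_beta')
  show "0 \<le> kern x y" for x y by (rule kern_nonneg)
  show "0 \<le> A" by (rule A_nonneg)
  fix x assume "x \<in> space \<mu>"
  then have x: "0 \<le> x" "x \<le> T" by auto
  have B: "0 \<le> Beta 1 \<alpha>" using \<alpha> by (intro Beta_real_nonneg) auto
  have le: "ck * (z powr \<alpha> * Beta 1 \<alpha>) \<le> A" if "0 \<le> z" "z \<le> T" for z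
  proof -
    have "z powr \<alpha> \<le> T powr \<alpha>" using that \<alpha> by (intro powr_mono2) auto
    then have "ck * (z powr \<alpha> * Beta 1 \<alpha>) \<le> ck * (T powr \<alpha> * Beta 1 \<alpha>)"
      using ck_pos B by (intro mult_left_mono mult_right_mono) auto
    then show ?thesis by (simp add: A_def mult.assoc)
  qed
  show "(\<integral>\<^sup>+y. ennreal (kern x y) \<partial>\<mu>) \<le> ennreal A"
  proof (cases "x = 0")
    case True
    then have "kern x y = 0" for y by (simp add: kern_def)
    then show ?thesis by simp
  next
    case False
    then have xp: "0 < x" using x by simp
    have "(\<integral>\<^sup>+y. ennreal (kern x y) \<partial>\<mu>) = (\<integral>\<^sup>+y. ennreal (kern x y) * indicator {0..T} y \<partial>lborel)"
      by (rule nn_integral_lebesgue_on_borel) auto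
    also have "\<dots> \<le> (\<integral>\<^sup>+y. ennreal ck * (ennreal ((y - 0) powr (1 - 1) * (x - y) powr (\<alpha> - 1)) * indicator {0<..<x} y) \<partial>lborel)"
    proof (intro nn_integral_mono)
      fix y
      show "ennreal (kern x y) * indicator {0..T} y \<le> ennreal ck * (ennreal ((y - 0) powr (1 - 1) * (x - y) powr (\<alpha> - 1)) * indicator {0<..<x} y)"
      proof (cases "0 < y \<and> y < x")
        case True
        then show ?thesis using kern_le[of x y] x ck_pos by (simp add: ennreal_mult[symmetric] ennreal_leI)
      next
        case False
        then have "kern x y = 0" by (auto simp: kern_def)
        then show ?thesis by simp
      qed
    qed
    also have "\<dots> = ennreal ck * ennreal ((x - 0) powr (1 + \<alpha> - 1) * Beta 1 \<alpha>)"
      using xp \<alpha> by (subst nn_integral_cmult, measurable) (subst nn_integral_beta_interval, auto)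
    also have "\<dots> = ennreal (ck * (x powr \<alpha> * Beta 1 \<alpha>))" using ck_pos by (simp add: ennreal_mult')
    also have "\<dots> \<le> ennreal A" by (intro ennreal_leI le x)
    finally show ?thesis .
  qed
  show "(\<integral>\<^sup>+y. ennreal (kern y x) \<partial>\<mu>) \<le> ennreal A"
  proof (cases "x = T")
    case True
    have "(\<integral>\<^sup>+y. ennreal (kern y x) \<partial>\<mu>) = (\<integral>\<^sup>+y. 0 \<partial>\<mu>)"
      by (intro nn_integral_cong) (auto simp: kern_def True)
    then show ?thesis by simp
  next
    case False
    then have xp: "x < T" using x by simp
    have "(\<integral>\<^sup>+y. ennreal (kern y x) \<partial>\<mu>) = (\<integral>\<^sup>+y. ennreal (kern y x) * indicator {0..T} y \<partial>lborel)"
      by (rule nn_integral_lebesgue_on_borel) auto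
    also have "\<dots> \<le> (\<integral>\<^sup>+y. ennreal ck * (ennreal ((y - x) powr (\<alpha> - 1) * (T - y) powr (1 - 1)) * indicator {x<..<T} y) \<partial>lborel)"
    proof (rule nn_integral_mono_AE, rule AE_mp[OF AE_lborel_singleton[of T]], rule AE_I2, rule impI)
      fix y assume "y \<noteq> T"
      show "ennreal (kern y x) * indicator {0..T} y \<le> ennreal ck * (ennreal ((y - x) powr (\<alpha> - 1) * (T - y) powr (1 - 1)) * indicator {x<..<T} y)"
      proof (cases "x < y \<and> y < T")
        case True
        then show ?thesis using kern_le[of y x] x ck_pos by (simp add: ennreal_mult[symmetric] ennreal_leI)
      next
        case False
        then have "kern y x = 0 \<or> y \<notin> {0..T}" using \<open>y \<noteq> T\<close> by (auto simp: kern_def)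
        then show ?thesis by auto
      qed
    qed
    also have "\<dots> = ennreal ck * ennreal ((T - x) powr (\<alpha> + 1 - 1) * Beta \<alpha> 1)"
      using xp \<alpha> by (subst nn_integral_cmult, measurable) (subst nn_integral_beta_interval, auto)
    also have "\<dots> = ennreal (ck * ((T - x) powr \<alpha> * Beta 1 \<alpha>))" using ck_pos by (simp add: ennreal_mult' Beta_commute)
    also have "\<dots> \<le> ennreal A" using x by (intro ennreal_leI le) auto
    finally show ?thesis .
  qed
qed

section \<open>The notions of the statement in operator form\<close>

lemma L2_iff: "\<phi> \<in> L2 T \<longleftrightarrow> sq_integrable \<mu> \<phi>"
  by (simp add: L2_def sq_integrable_def)

lemma op_eq_K0:
  assumes "t \<in> {0..T}" shows "op \<phi> t = K0 H \<phi> t"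
proof -
  have e: "- 1/2 - H = \<alpha> - 1" "1/2 - H = \<alpha>" "H - 1/2 = - \<alpha>" by (auto simp: \<alpha>_def)
  have "op \<phi> t = (\<integral>u. indicator {0..T} u *\<^sub>R (kern t u * \<phi> u) \<partial>lebesgue)"
    unfolding op_def by (rule integral_restrict_space) simp
  also have "\<dots> = (\<integral>u. ck * t powr (- \<alpha>) * (indicator {0..t} u *\<^sub>R ((t - u) powr (\<alpha> - 1) * u powr \<alpha> * \<phi> u)) \<partial>lebesgue)"
  proof (intro Bochner_Integration.integral_cong refl)
    fix u
    show "indicator {0..T} u *\<^sub>R (kern t u * \<phi> u) = ck * t powr (- \<alpha>) * (indicator {0..t} u *\<^sub>R ((t - u) powr (\<alpha> - 1) * u powr \<alpha> * \<phi> u))"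
    proof (cases "0 < u \<and> u < t")
      case True
      then show ?thesis using assms by (simp add: kern_def)
    next
      case False
      then have "kern t u = 0" by (auto simp: kern_def)
      moreover have "(t - u) powr (\<alpha> - 1) * u powr \<alpha> = 0 \<or> u \<notin> {0..t}" using False by (cases "u = 0 \<or> u = t") auto
      ultimately show ?thesis by auto
    qed
  qed
  also have "\<dots> = ck * t powr (- \<alpha>) * (\<integral>u. indicator {0..t} u *\<^sub>R ((t - u) powr (\<alpha> - 1) * u powr \<alpha> * \<phi> u) \<partial>lebesgue)"
    by (rule integral_mult_right_zero)
  also have "(\<integral>u. indicator {0..t} u *\<^sub>R ((t - u) powr (\<alpha> - 1) * u powr \<alpha> * \<phi> u) \<partial>lebesgue)
     = (\<integral>u. (t - u) powr (\<alpha> - 1) * u powr \<alpha> * \<phi> u \<partial>lebesgue_on {0..t})"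
    by (rule integral_restrict_space[symmetric]) simp
  finally show ?thesis unfolding K0_def e by (simp add: ck_def mult_ac)
qed

text \<open>One formula for both halves of \<open>kappa\<close>: the product of the two kernels
  lives on \<open>u > max t z\<close>, and the power \<open>2 * H - 1\<close> of \<open>u\<close>
  collects a factor \<open>u powr (- \<alpha>)\<close> from each. On the diagonal both strict
  indicators in \<open>kappa\<close> vanish, so the comparison is made off it.\<close>

lemma kappa_eq:
  assumes "t \<in> {0..T}" "z \<in> {0..T}" "z \<noteq> t"
  shows "C2 H * kappa H T z t = (\<integral>u. kern u t * kern u z \<partial>\<mu>)"
proof -
  have e: "- 1/2 - H = \<alpha> - 1" "1/2 - H = \<alpha>" "2 * H - 1 = - \<alpha> + - \<alpha>" by (auto simp: \<alpha>_def)
  define b where "b = max t z"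
  have b: "0 \<le> b" "b \<le> T" "t \<le> b" "z \<le> b" using assms by (auto simp: b_def)
  have "(\<integral>u. kern u t * kern u z \<partial>\<mu>) = (\<integral>u. indicator {0..T} u *\<^sub>R (kern u t * kern u z) \<partial>lebesgue)"
    by (rule integral_restrict_space) simp
  also have "\<dots> = (\<integral>u. ck\<^sup>2 * (t * z) powr \<alpha> * (indicator {b..T} u *\<^sub>R ((u - t) powr (\<alpha> - 1) * u powr (- \<alpha> + - \<alpha>) * (u - z) powr (\<alpha> - 1))) \<partial>lebesgue)"
  proof (intro Bochner_Integration.integral_cong refl)
    fix u
    show "indicator {0..T} u *\<^sub>R (kern u t * kern u z)
      = ck\<^sup>2 * (t * z) powr \<alpha> * (indicator {b..T} u *\<^sub>R ((u - t) powr (\<alpha> - 1) * u powr (- \<alpha> + - \<alpha>) * (u - z) powr (\<alpha> - 1)))"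
    proof (cases "0 < t \<and> 0 < z \<and> b < u \<and> u \<le> T")
      case True
      then have "t < u" "z < u" "0 < u" using b by auto
      then show ?thesis using True unfolding powr_add
        by (simp add: kern_def powr_mult power2_eq_square mult_ac)
    next
      case False
      then have "indicator {0..T} u *\<^sub>R (kern u t * kern u z) = 0"
        using assms by (auto simp: kern_def b_def indicator_def)
      moreover have "(t * z) powr \<alpha> = 0 \<or> u \<notin> {b..T} \<or> (u - t) powr (\<alpha> - 1) = 0 \<or> (u - z) powr (\<alpha> - 1) = 0"
        using False assms by (cases "u = b") (auto simp: b_def max_def split: if_splits)
      ultimately show ?thesis by auto
    qed
  qed
  also have "\<dots> = ck\<^sup>2 * (t * z) powr \<alpha> * (\<integral>u. indicator {b..T} u *\<^sub>R ((u - t) powr (\<alpha> - 1) * u powr (- \<alpha> + - \<alpha>) * (u - z) powr (\<alpha> - 1)) \<partial>lebesgue)"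
    by (rule integral_mult_right_zero)
  also have "(\<integral>u. indicator {b..T} u *\<^sub>R ((u - t) powr (\<alpha> - 1) * u powr (- \<alpha> + - \<alpha>) * (u - z) powr (\<alpha> - 1)) \<partial>lebesgue)
     = (\<integral>u. (u - t) powr (\<alpha> - 1) * u powr (- \<alpha> + - \<alpha>) * (u - z) powr (\<alpha> - 1) \<partial>lebesgue_on {b..T})"
    by (rule integral_restrict_space[symmetric]) simp
  finally show ?thesis unfolding kappa_def e C2_eq using assms by (cases "z < t") (auto simp: b_def max_def)
qed

lemma fredholm_operator_eq:
  assumes x: "sq_integrable \<mu> x"
  shows "AE t in \<mu>. x t + C2 H * (\<integral>z. kappa H T z t * x z \<partial>\<mu>) = S x t"
  using adj_op_kernel[OF x] AE_space
proof eventually_elim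
  fix t assume a: "(\<integral>z. (\<integral>u. kern u t * kern u z \<partial>\<mu>) * x z \<partial>\<mu>) = adj (op x) t" and "t \<in> space \<mu>"
  then have t[measurable]: "t \<in> space \<mu>" and t': "t \<in> {0..T}" by auto
  have [measurable]: "x \<in> borel_measurable \<mu>" using x by (simp add: sq_integrable_def)
  define k2 where "k2 z = (\<integral>u. kern u t * kern u z \<partial>\<mu>)" for z
  have [measurable]: "k2 \<in> borel_measurable \<mu>" unfolding k2_def[abs_def]
    by (rule borel_measurable_lebesgue_integral) measurable
  have st: "{z \<in> space \<mu>. z = t} \<in> sets \<mu>"
  proof -
    have "{z \<in> space \<mu>. z = t} = {t}" using t by auto
    moreover have "{t} \<in> sets \<mu>" using t' by (auto simp: sets_restrict_space_iff)
    ultimately show ?thesis by simp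
  qed
  \<comment> \<open>\<open>kappa\<close> is an integral over a varying domain; its measurability in
    \<open>z\<close> is inherited from \<open>k2\<close>, from which it differs at most in the
    single point \<open>t\<close>.\<close>
  have "(\<lambda>z. C2 H * kappa H T z t) \<in> borel_measurable \<mu> \<longleftrightarrow> (\<lambda>z. if z = t then C2 H * kappa H T t t else k2 z) \<in> borel_measurable \<mu>"
    using kappa_eq[OF t'] by (intro measurable_cong) (auto simp: k2_def)
  moreover have "(\<lambda>z. if z = t then C2 H * kappa H T t t else k2 z) \<in> borel_measurable \<mu>"
    using st by (intro measurable_If) auto
  ultimately have [measurable]: "(\<lambda>z. C2 H * kappa H T z t) \<in> borel_measurable \<mu>" by simp
  have "AE z in \<mu>. z \<noteq> t" by (rule AE_lebesgue_on_neq) simp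
  with AE_space have "AE z in \<mu>. C2 H * kappa H T z t * x z = k2 z * x z"
  proof eventually_elim
    fix z assume "z \<in> space \<mu>" "z \<noteq> t"
    then show "C2 H * kappa H T z t * x z = k2 z * x z" using kappa_eq[OF t', of z] by (simp add: k2_def)
  qed
  then have "(\<integral>z. C2 H * kappa H T z t * x z \<partial>\<mu>) = (\<integral>z. k2 z * x z \<partial>\<mu>)"
    by (intro integral_cong_AE) measurable
  moreover have "(\<integral>z. C2 H * kappa H T z t * x z \<partial>\<mu>) = C2 H * (\<integral>z. kappa H T z t * x z \<partial>\<mu>)"
    unfolding mult.assoc by (rule integral_mult_right_zero)
  ultimately show "x t + C2 H * (\<integral>z. kappa H T z t * x z \<partial>\<mu>) = S x t"
    using a by (simp add: S_def k2_def)
qed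

lemma fredholm_solution_iff:
  "fredholm_solution H T g' x \<longleftrightarrow> sq_integrable \<mu> x \<and> (AE t in \<mu>. S x t = g' t)"
proof (cases "sq_integrable \<mu> x")
  case True
  have "(AE t in \<mu>. x t + C2 H * (\<integral>z. kappa H T z t * x z \<partial>\<mu>) = g' t) \<longleftrightarrow> (AE t in \<mu>. S x t = g' t)"
    using fredholm_operator_eq[OF True] by (intro eventually_cong) (auto elim: eventually_mono)
  then show ?thesis using True by (simp add: fredholm_solution_def L2_iff)
next
  case False
  then show ?thesis by (simp add: fredholm_solution_def L2_iff)
qed

lemma expansion_cost_eq:
  assumes "sq_integrable \<mu> w" "sq_integrable \<mu> b"
  shows "expansion_cost H T w b = (sqn \<mu> w + sqn \<mu> (op b)) / 2"
proof -
  have "expansion_cost H T w b = 1/2 * (\<integral>t. (w t)\<^sup>2 + (op b t)\<^sup>2 \<partial>\<mu>)"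
    unfolding expansion_cost_def
    by (intro arg_cong2[where f = "(*)"] refl Bochner_Integration.integral_cong) (simp_all add: op_eq_K0)
  then show ?thesis using assms op_sq_integrable(2)[OF assms(2)]
    by (simp add: sq_integrable_def)
qed

lemma m_sq_integrable:
  assumes "0 \<le> s" "s \<le> T"
  shows "sq_integrable \<mu> (m s)"
    and "0 \<le> r \<Longrightarrow> r \<le> s \<Longrightarrow> (\<integral>u. m r u * m s u \<partial>\<mu>) = fbm_cov H r s"
proof -
  have mm: "(\<lambda>u. m r u * m s u) \<in> borel_measurable \<mu>" for r by (rule borel_measurable_lebesgue_onI) measurable
  have nn: "(\<integral>\<^sup>+u. ennreal (m r u * m s u) \<partial>\<mu>) = ennreal (fbm_cov H r s)" if "0 \<le> r" "r \<le> s" for r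
  proof -
    have "(\<integral>\<^sup>+u. ennreal (m r u * m s u) \<partial>\<mu>) = (\<integral>\<^sup>+u. ennreal (m r u * m s u) * indicator {0..T} u \<partial>lborel)"
      by (rule nn_integral_lebesgue_on_borel) auto
    also have "\<dots> = (\<integral>\<^sup>+u. ennreal (m r u * m s u) \<partial>lborel)"
      using assms by (intro nn_integral_cong) (auto simp: m_def indicator_def)
    finally show ?thesis using nn_integral_m_m[OF that] by simp
  qed
  show "sq_integrable \<mu> (m s)" unfolding sq_integrable_def
  proof
    show "m s \<in> borel_measurable \<mu>" by (rule borel_measurable_lebesgue_onI) measurable
    \<comment> \<open>The case \<open>r = s\<close> of the covariance formula bounds the norm of
      \<open>m s\<close>.\<close>
    have "integrable \<mu> (\<lambda>u. m s u * m s u)"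
      using mm nn[OF assms(1)] by (intro integrableI_nonneg) (auto simp: m_nonneg)
    then show "integrable \<mu> (\<lambda>u. (m s u)\<^sup>2)" by (simp add: power2_eq_square)
  qed
  assume r: "0 \<le> r" "r \<le> s"
  have c0: "0 \<le> fbm_cov H r s"
  proof -
    have "(s - r) powr (2 * H) \<le> s powr (2 * H)" using r H_pos by (intro powr_mono2) auto
    then show ?thesis using r by (simp add: fbm_cov_def add_increasing)
  qed
  have "(\<integral>u. m r u * m s u \<partial>\<mu>) = enn2real (\<integral>\<^sup>+u. ennreal (m r u * m s u) \<partial>\<mu>)"
    using mm by (intro integral_eq_nn_integral) (auto simp: m_nonneg)
  then show "(\<integral>u. m r u * m s u \<partial>\<mu>) = fbm_cov H r s" using nn[OF r] c0 by simp
qed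

text \<open>On the other side of the pairing \<open>op\<close> becomes \<open>adj\<close>, and
  \<open>adj (m s)\<close> is the indicator of \<open>(0, s)\<close> by
  \<open>nn_integral_m_kern\<close>. The value at \<open>s\<close> of the indefinite integral of
  \<open>x\<close> is thus an inner product with \<open>op x\<close>, which is why the fractional
  part of the trend is charged by the norm of \<open>op x\<close>.\<close>

lemma inner_m_op:
  assumes s: "0 \<le> s" "s \<le> T" and x: "sq_integrable \<mu> x"
  shows "(\<integral>u. m s u * op x u \<partial>\<mu>) = (\<integral>v. x v \<partial>lebesgue_on {0..s})"
proof -
  have [measurable]: "x \<in> borel_measurable \<mu>" using x by (simp add: sq_integrable_def)
  have "(\<integral>u. m s u * op x u \<partial>\<mu>) = (\<integral>v. x v * adj (m s) v \<partial>\<mu>)"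
    using adj_eq[OF x m_sq_integrable(1)[OF s]] by (simp add: mult.commute)
  also have "\<dots> = (\<integral>v. indicator {0<..<s} v * x v \<partial>\<mu>)"
  proof (intro Bochner_Integration.integral_cong refl)
    fix v assume "v \<in> space \<mu>"
    then have v: "0 \<le> v" "v \<le> T" by auto
    have "adj (m s) v = indicator {0<..<s} v"
    proof (cases "0 < v \<and> v < s")
      case True
      have "adj (m s) v = enn2real (\<integral>\<^sup>+u. ennreal (kern u v * m s u) \<partial>\<mu>)"
        unfolding adj_def by (intro integral_eq_nn_integral borel_measurable_lebesgue_onI) (auto simp: m_nonneg kern_nonneg)
      also have "(\<integral>\<^sup>+u. ennreal (kern u v * m s u) \<partial>\<mu>) = (\<integral>\<^sup>+u. ennreal (kern u v * m s u) * indicator {0..T} u \<partial>lborel)"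
        by (rule nn_integral_lebesgue_on_borel) auto
      also have "\<dots> = (\<integral>\<^sup>+u. ennreal (m s u * kern u v) \<partial>lborel)"
        using s by (intro nn_integral_cong) (auto simp: m_def indicator_def mult.commute)
      also have "\<dots> = 1" using True by (intro nn_integral_m_kern) auto
      finally show ?thesis using True by simp
    next
      case False
      then have z: "kern u v * m s u = 0" for u by (auto simp: m_def kern_def)
      have "adj (m s) v = 0" unfolding adj_def z by simp
      then show ?thesis using False by auto
    qed
    then show "x v * adj (m s) v = indicator {0<..<s} v * x v" by (simp add: mult.commute)
  qed
  also have "\<dots> = (\<integral>v. indicator {0..s} v * x v \<partial>\<mu>)"
  proof (rule integral_cong_AE)
    have [measurable]: "indicat_real S \<in> borel_measurable \<mu>" if "S \<in> sets borel" for S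
      using that by (intro borel_measurable_lebesgue_onI) auto
    show "(\<lambda>v. indicator {0<..<s} v * x v) \<in> borel_measurable \<mu>" "(\<lambda>v. indicator {0..s} v * x v) \<in> borel_measurable \<mu>"
      by (intro borel_measurable_times, auto)+
    have "AE v in \<mu>. v \<noteq> 0" "AE v in \<mu>. v \<noteq> s" by (rule AE_lebesgue_on_neq; simp)+
    then show "AE v in \<mu>. indicator {0<..<s} v * x v = indicator {0..s} v * x v"
      by eventually_elim (auto simp: indicator_def)
  qed
  also have "\<dots> = (\<integral>v. indicator {0..T} v *\<^sub>R (indicator {0..s} v * x v) \<partial>lebesgue)"
    by (rule integral_restrict_space) simp
  also have "\<dots> = (\<integral>v. indicator {0..s} v *\<^sub>R x v \<partial>lebesgue)"
    using s by (intro Bochner_Integration.integral_cong refl) (auto simp: indicator_def)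
  also have "\<dots> = (\<integral>v. x v \<partial>lebesgue_on {0..s})"
    by (rule integral_restrict_space[symmetric]) simp
  finally show ?thesis .
qed

end

subsection \<open>Indefinite integrals of square integrable functions\<close>

text \<open>Taken as densities, the positive and the negative part of \<open>\<phi>\<close> define
  finite measures that agree on all half-lines \<open>{x<..}\<close> and therefore coincide. So the
  integral over every Borel set vanishes, in particular over the sets where \<open>\<phi>\<close> is
  positive or negative.\<close>

lemma AE_zero_of_integral_Icc_zero:
  fixes \<phi> :: "real \<Rightarrow> real" and T :: real
  defines "\<mu> \<equiv> lebesgue_on {0..T}"
  assumes T: "0 \<le> T" and int: "integrable \<mu> \<phi>"
    and zero: "\<And>t. 0 \<le> t \<Longrightarrow> t \<le> T \<Longrightarrow> (\<integral>s. indicator {0..t} s * \<phi> s \<partial>\<mu>) = 0"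
  shows "AE t in \<mu>. \<phi> t = 0"
proof -
  have "(\<lambda>x. indicator {0..T} x *\<^sub>R \<phi> x) \<in> borel_measurable lebesgue"
    using int unfolding \<mu>_def by (subst borel_measurable_restrict_space_iff[symmetric]) auto
  \<comment> \<open>A Borel version of \<open>\<phi>\<close>, so that its sign sets are Borel and
    can be tested against measures on \<open>borel\<close>.\<close>
  then obtain \<psi> where \<psi>[measurable]: "\<psi> \<in> borel_measurable borel" and e: "AE x in lborel. indicator {0..T} x *\<^sub>R \<phi> x = \<psi> x"
    using completion_ex_borel_measurable_real[of _ lborel] by auto
  have eq: "AE x in \<mu>. \<phi> x = \<psi> x"
    unfolding \<mu>_def using AE_completion[OF e]
    by (subst AE_restrict_space_iff) (auto elim!: eventually_mono simp: indicator_def split: if_splits)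
  have mB[measurable (raw)]: "f \<in> borel_measurable \<mu>" if "f \<in> borel_measurable borel" for f :: "real \<Rightarrow> 'c::topological_space"
    unfolding \<mu>_def using that by (intro measurable_restrict_space1 measurable_completion) simp
  have id[measurable]: "(\<lambda>x. x) \<in> \<mu> \<rightarrow>\<^sub>M borel" by (rule mB) simp
  have [measurable]: "\<phi> \<in> borel_measurable \<mu>" using int by auto
  have \<psi>\<mu>[measurable]: "\<psi> \<in> borel_measurable \<mu>" by (rule mB) simp
  have int\<psi>: "integrable \<mu> \<psi>" using int eq by (subst integrable_cong_AE[of \<psi> \<mu> \<phi>]) (auto elim: eventually_mono)
  have indm: "indicat_real S \<in> borel_measurable \<mu>" if "S \<in> sets borel" for S using that by (intro mB) auto
  have iint: "integrable \<mu> (\<lambda>s. indicator S s * \<psi> s)" if S: "S \<in> sets borel" for S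
  proof (rule Bochner_Integration.integrable_bound[OF int\<psi>])
    show "(\<lambda>s. indicator S s * \<psi> s) \<in> borel_measurable \<mu>" by (intro borel_measurable_times indm S \<psi>\<mu>)
  qed (auto simp: indicator_def)
  have zero\<psi>: "(\<integral>s. indicator {0..t} s * \<psi> s \<partial>\<mu>) = 0" if "0 \<le> t" "t \<le> T" for t
  proof -
    have "(\<integral>s. indicator {0..t} s * \<psi> s \<partial>\<mu>) = (\<integral>s. indicator {0..t} s * \<phi> s \<partial>\<mu>)"
      using eq indm[of "{0..t}"] by (intro integral_cong_AE) (auto elim: eventually_mono)
    then show ?thesis using zero[OF that] by simp
  qed
  have tail: "(\<integral>s. indicator {x<..} s * \<psi> s \<partial>\<mu>) = 0" for x
  proof -
    consider "x < 0" | "0 \<le> x" "x \<le> T" | "T < x" by linarith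
    then show ?thesis
    proof cases
      case 1
      have "(\<integral>s. indicator {x<..} s * \<psi> s \<partial>\<mu>) = (\<integral>s. indicator {0..T} s * \<psi> s \<partial>\<mu>)"
        using 1 by (intro Bochner_Integration.integral_cong refl) (auto simp: \<mu>_def)
      then show ?thesis using zero\<psi>[of T] T by simp
    next
      case 2
      have "(\<integral>s. indicator {x<..} s * \<psi> s \<partial>\<mu>) = (\<integral>s. indicator {0..T} s * \<psi> s - indicator {0..x} s * \<psi> s \<partial>\<mu>)"
        using 2 by (intro Bochner_Integration.integral_cong refl) (auto simp: \<mu>_def indicator_def)
      also have "\<dots> = 0" using iint zero\<psi>[of T] zero\<psi>[of x] T 2 by (subst Bochner_Integration.integral_diff) auto
      finally show ?thesis .
    next
      case 3
      have "(\<integral>s. indicator {x<..} s * \<psi> s \<partial>\<mu>) = (\<integral>s. 0 \<partial>\<mu>)"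
        using 3 by (intro Bochner_Integration.integral_cong refl) (auto simp: \<mu>_def indicator_def)
      then show ?thesis by simp
    qed
  qed
  define M where "M f = distr (density \<mu> (\<lambda>x. ennreal (f x))) borel (\<lambda>x. x)" for f :: "real \<Rightarrow> real"
  have M: "emeasure (M f) S = (\<integral>\<^sup>+x. ennreal (f x) * indicator S x \<partial>\<mu>)" if [measurable]: "S \<in> sets borel" "f \<in> borel_measurable \<mu>" for f S
  proof -
    have S: "S \<inter> space \<mu> \<in> sets \<mu>" using measurable_sets[OF id, of S] by simp
    have "emeasure (M f) S = emeasure (density \<mu> (\<lambda>x. ennreal (f x))) (S \<inter> space \<mu>)"
      unfolding M_def by (subst emeasure_distr) auto
    also have "\<dots> = (\<integral>\<^sup>+x. ennreal (f x) * indicator (S \<inter> space \<mu>) x \<partial>\<mu>)"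
      using S by (intro emeasure_density) auto
    also have "\<dots> = (\<integral>\<^sup>+x. ennreal (f x) * indicator S x \<partial>\<mu>)"
      by (intro nn_integral_cong) (auto simp: indicator_def)
    finally show ?thesis .
  qed
  define p where "p x = max 0 (\<psi> x)" for x
  define n where "n x = max 0 (- \<psi> x)" for x
  have [measurable]: "p \<in> borel_measurable \<mu>" "n \<in> borel_measurable \<mu>" unfolding p_def[abs_def] n_def[abs_def] by measurable
  have ip: "integrable \<mu> (\<lambda>s. indicator S s * p s)" "integrable \<mu> (\<lambda>s. indicator S s * n s)" if S: "S \<in> sets borel" for S
  proof -
    have "(\<lambda>s. indicator S s * p s) \<in> borel_measurable \<mu>" "(\<lambda>s. indicator S s * n s) \<in> borel_measurable \<mu>"
      by (intro borel_measurable_times indm S; measurable)+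
    then show "integrable \<mu> (\<lambda>s. indicator S s * p s)" "integrable \<mu> (\<lambda>s. indicator S s * n s)"
      by (auto intro!: Bochner_Integration.integrable_bound[OF int\<psi>] AE_I2 simp: p_def n_def indicator_def)
  qed
  have nn: "(\<integral>\<^sup>+x. ennreal (f x) * indicator S x \<partial>\<mu>) = ennreal (\<integral>x. indicator S x * f x \<partial>\<mu>)"
    if "integrable \<mu> (\<lambda>s. indicator S s * f s)" "\<And>x. 0 \<le> f x" for S and f :: "real \<Rightarrow> real"
  proof -
    have "(\<integral>\<^sup>+x. ennreal (f x) * indicator S x \<partial>\<mu>) = (\<integral>\<^sup>+x. ennreal (indicator S x * f x) \<partial>\<mu>)"
      by (intro nn_integral_cong) (simp add: indicator_def)
    also have "\<dots> = ennreal (\<integral>x. indicator S x * f x \<partial>\<mu>)" using that by (intro nn_integral_eq_integral) auto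
    finally show ?thesis .
  qed
  have Mp: "emeasure (M p) S = ennreal (\<integral>x. indicator S x * p x \<partial>\<mu>)"
    and Mn: "emeasure (M n) S = ennreal (\<integral>x. indicator S x * n x \<partial>\<mu>)" if "S \<in> sets borel" for S
  proof -
    have 0: "0 \<le> p x" "0 \<le> n x" for x by (auto simp: p_def n_def)
    show "emeasure (M p) S = ennreal (\<integral>x. indicator S x * p x \<partial>\<mu>)"
      by (subst M[OF that]) (auto intro!: nn ip that 0)
    show "emeasure (M n) S = ennreal (\<integral>x. indicator S x * n x \<partial>\<mu>)"
      by (subst M[OF that]) (auto intro!: nn ip that 0)
  qed
  have "M p = M n"
  proof (rule measure_eqI_lessThan)
    show "emeasure (M p) {x<..} < \<infinity>" for x by (simp add: Mp)
    show "emeasure (M p) {x<..} = emeasure (M n) {x<..}" for x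
    proof -
      have "(\<integral>s. indicator {x<..} s * \<psi> s \<partial>\<mu>) = (\<integral>s. indicator {x<..} s * p s - indicator {x<..} s * n s \<partial>\<mu>)"
        by (intro Bochner_Integration.integral_cong refl) (auto simp: indicator_def p_def n_def)
      then have "(\<integral>s. indicator {x<..} s * p s \<partial>\<mu>) = (\<integral>s. indicator {x<..} s * n s \<partial>\<mu>)"
        using tail[of x] ip[of "{x<..}"] by (simp add: Bochner_Integration.integral_diff)
      then show ?thesis by (simp add: Mp Mn)
    qed
  qed (simp_all add: M_def)
  then have eqE: "(\<integral>x. indicator S x * \<psi> x \<partial>\<mu>) = 0" if S: "S \<in> sets borel" for S
  proof -
    assume MM: "M p = M n"
    have "0 \<le> (\<integral>x. indicator S x * p x \<partial>\<mu>)" "0 \<le> (\<integral>x. indicator S x * n x \<partial>\<mu>)"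
      by (auto intro!: Bochner_Integration.integral_nonneg simp: p_def n_def)
    then have "(\<integral>x. indicator S x * p x \<partial>\<mu>) = (\<integral>x. indicator S x * n x \<partial>\<mu>)"
      using Mp[OF S] Mn[OF S] MM by simp
    moreover have "(\<integral>s. indicator S s * \<psi> s \<partial>\<mu>) = (\<integral>s. indicator S s * p s - indicator S s * n s \<partial>\<mu>)"
      by (intro Bochner_Integration.integral_cong refl) (auto simp: indicator_def p_def n_def)
    ultimately show ?thesis using ip[OF S] by (simp add: Bochner_Integration.integral_diff)
  qed
  have "(\<integral>x. p x \<partial>\<mu>) = (\<integral>x. indicator {x. 0 < \<psi> x} x * \<psi> x \<partial>\<mu>)"
    by (intro Bochner_Integration.integral_cong refl) (auto simp: indicator_def p_def)
  then have p0: "(\<integral>x. p x \<partial>\<mu>) = 0" by (simp add: eqE)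
  have "(\<integral>x. n x \<partial>\<mu>) = (\<integral>x. - (indicator {x. \<psi> x < 0} x * \<psi> x) \<partial>\<mu>)"
    by (intro Bochner_Integration.integral_cong refl) (auto simp: indicator_def n_def)
  then have n0: "(\<integral>x. n x \<partial>\<mu>) = 0" by (simp add: eqE)
  have pn: "0 \<le> p x" "0 \<le> n x" for x by (auto simp: p_def n_def)
  have ipn: "integrable \<mu> p" "integrable \<mu> n" using ip[of UNIV] by simp_all
  have "AE x in \<mu>. p x = 0"
    by (subst integral_nonneg_eq_0_iff_AE[OF ipn(1), symmetric]) (auto simp: pn p0)
  moreover have "AE x in \<mu>. n x = 0"
    by (subst integral_nonneg_eq_0_iff_AE[OF ipn(2), symmetric]) (auto simp: pn n0)
  ultimately show ?thesis using eq by eventually_elim (auto simp: p_def n_def max_def split: if_splits)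
qed

text \<open>Puts the integrals over all intervals \<open>[0, t]\<close> on the one measure space
  over \<open>[0, T]\<close>, where facts about \<open>sq_integrable\<close> apply.\<close>

lemma LINT_Icc_eq_indicator:
  fixes \<phi> :: "real \<Rightarrow> real" and t T :: real
  assumes "t \<le> T"
  shows "(LINT s|lebesgue_on {0..t}. \<phi> s) = (\<integral>s. indicator {0..t} s * \<phi> s \<partial>lebesgue_on {0..T})"
proof -
  have "(LINT s|lebesgue_on {0..t}. \<phi> s) = (\<integral>s. indicator {0..t} s *\<^sub>R \<phi> s \<partial>lebesgue)"
    by (rule integral_restrict_space) simp
  also have "\<dots> = (\<integral>s. indicator {0..T} s *\<^sub>R (indicator {0..t} s * \<phi> s) \<partial>lebesgue)"
    using assms by (intro Bochner_Integration.integral_cong refl) (auto simp: indicator_def)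
  also have "\<dots> = (\<integral>s. indicator {0..t} s * \<phi> s \<partial>lebesgue_on {0..T})"
    by (rule integral_restrict_space[symmetric]) simp
  finally show ?thesis .
qed

lemma indicator_sq_integrable:
  assumes "S \<in> sets borel" shows "sq_integrable (lebesgue_on {0..T}) (indicator S :: real \<Rightarrow> real)"
proof -
  interpret finite_measure "lebesgue_on {0..T}" by (intro finite_measure_lebesgue_on) simp
  have m[measurable]: "indicat_real S \<in> borel_measurable (lebesgue_on {0..T})"
    using assms by (intro borel_measurable_lebesgue_onI) auto
  have "integrable (lebesgue_on {0..T}) (\<lambda>x. (indicat_real S x)\<^sup>2)"
  proof (rule integrable_const_bound[of _ 1])
    show "AE x in lebesgue_on {0..T}. norm ((indicat_real S x)\<^sup>2) \<le> 1" by (simp add: indicator_def)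
  qed measurable
  then show ?thesis using m by (simp add: sq_integrable_def)
qed

lemma sqn_indicator_le: "0 \<le> T \<Longrightarrow> sqn (lebesgue_on {0..T}) (indicator {a<..<b}) \<le> max 0 (b - a)"
proof -
  have "sqn (lebesgue_on {0..T}) (indicator {a<..<b}) = (\<integral>s. indicat_real {a<..<b} s \<partial>lebesgue_on {0..T})"
    by (intro Bochner_Integration.integral_cong refl) (simp add: indicator_def)
  also have "\<dots> = (\<integral>s. indicator {0..T} s *\<^sub>R indicat_real {a<..<b} s \<partial>lebesgue)"
    by (rule integral_restrict_space) simp
  also have "\<dots> = (\<integral>s. indicat_real ({0..T} \<inter> {a<..<b}) s \<partial>lebesgue)"
    by (simp add: indicator_inter_arith)
  also have "\<dots> = measure lebesgue ({0..T} \<inter> {a<..<b})" by simp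
  also have "\<dots> \<le> measure lebesgue {a<..<b}" by (intro measure_mono_fmeasurable) auto
  also have "\<dots> = max 0 (b - a)" by (cases "a \<le> b") auto
  finally show ?thesis .
qed

text \<open>The increments add up to at most the integral of \<open>\<bar>\<phi>\<bar>\<close> over
  the union of the intervals, hence by Cauchy--Schwarz to at most the norm of \<open>\<phi>\<close>
  times the root of the total length.\<close>

lemma absolutely_continuous_indefinite_integral:
  assumes T: "0 \<le> T" and \<phi>: "sq_integrable (lebesgue_on {0..T}) \<phi>"
    and F: "\<And>t. t \<in> {0..T} \<Longrightarrow> F t = (LINT s|lebesgue_on {0..t}. \<phi> s)"
  shows "absolutely_continuous_on_Icc T F"
  unfolding absolutely_continuous_on_Icc_def
proof (intro allI impI)
  let ?\<mu> = "lebesgue_on {0..T}"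
  fix e :: real assume e: "0 < e"
  \<comment> \<open>The added 1 keeps the divisor in \<open>e\<^sup>2 / K\<close> positive even when
    \<open>\<phi>\<close> vanishes.\<close>
  define K where "K = sqn ?\<mu> \<phi> + 1"
  have "0 \<le> sqn ?\<mu> \<phi>" by simp
  then have K: "0 < K" "sqn ?\<mu> \<phi> < K" unfolding K_def by linarith+
  have [measurable]: "\<phi> \<in> borel_measurable ?\<mu>" using \<phi> by (simp add: sq_integrable_def)
  have \<phi>abs: "sq_integrable ?\<mu> (\<lambda>s. \<bar>\<phi> s\<bar>)" using \<phi> by (auto simp: sq_integrable_def)
  have ind[measurable]: "indicat_real S \<in> borel_measurable ?\<mu>" if "S \<in> sets borel" for S
    using that by (intro borel_measurable_lebesgue_onI) auto
  show "\<exists>d>0. \<forall>(n::nat) a b. (\<forall>i<n. 0 \<le> a i \<and> a i \<le> b i \<and> b i \<le> T) \<and> disjoint_family_on (\<lambda>i. {a i<..<b i}) {..<n} \<and> (\<Sum>i<n. b i - a i) < d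
      \<longrightarrow> (\<Sum>i<n. \<bar>F (b i) - F (a i)\<bar>) < e"
  proof (intro exI[of _ "e\<^sup>2 / K"] conjI allI impI)
    show "0 < e\<^sup>2 / K" using e K by simp
    fix n :: nat and a b :: "nat \<Rightarrow> real"
    assume asm: "(\<forall>i<n. 0 \<le> a i \<and> a i \<le> b i \<and> b i \<le> T) \<and> disjoint_family_on (\<lambda>i. {a i<..<b i}) {..<n} \<and> (\<Sum>i<n. b i - a i) < e\<^sup>2 / K"
    define E where "E s = (\<Sum>i<n. indicat_real {a i<..<b i} s)" for s
    have iI: "integrable ?\<mu> (\<lambda>s. indicator S s * \<psi> s)" if "S \<in> sets borel" "sq_integrable ?\<mu> \<psi>" for S \<psi>
      using sq_integrable_mult[OF indicator_sq_integrable[OF that(1)] that(2)] .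
    have step: "\<bar>F (b i) - F (a i)\<bar> \<le> (\<integral>s. indicator {a i<..<b i} s * \<bar>\<phi> s\<bar> \<partial>?\<mu>)" if i: "i < n" for i
    proof -
      have ab: "0 \<le> a i" "a i \<le> b i" "b i \<le> T" using asm i by auto
      have "F (b i) - F (a i) = (\<integral>s. indicator {0..b i} s * \<phi> s - indicator {0..a i} s * \<phi> s \<partial>?\<mu>)"
      proof -
        have "F t = (\<integral>s. indicator {0..t} s * \<phi> s \<partial>?\<mu>)" if "t \<in> {0..T}" for t
          using F[OF that] LINT_Icc_eq_indicator[of t T \<phi>] that by simp
        then show ?thesis
          using ab by (subst Bochner_Integration.integral_diff) (auto intro!: iI \<phi>)
      qed
      also have "\<dots> = (\<integral>s. indicator {a i<..<b i} s * \<phi> s \<partial>?\<mu>)"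
      proof (rule integral_cong_AE)
        have "AE s in ?\<mu>. s \<noteq> a i" "AE s in ?\<mu>. s \<noteq> b i" by (rule AE_lebesgue_on_neq; simp)+
        then show "AE s in ?\<mu>. indicator {0..b i} s * \<phi> s - indicator {0..a i} s * \<phi> s = indicator {a i<..<b i} s * \<phi> s"
          using AE_space by eventually_elim (use ab in \<open>auto simp: indicator_def\<close>)
      qed auto
      finally have "\<bar>F (b i) - F (a i)\<bar> \<le> (\<integral>s. \<bar>indicator {a i<..<b i} s * \<phi> s\<bar> \<partial>?\<mu>)"
        by (simp add: integral_abs_bound)
      then show ?thesis by (simp add: abs_mult)
    qed
    have E2: "sq_integrable ?\<mu> E" unfolding E_def by (intro sq_integrable_sum indicator_sq_integrable) auto
    have "(\<Sum>i<n. \<bar>F (b i) - F (a i)\<bar>) \<le> (\<Sum>i<n. \<integral>s. indicator {a i<..<b i} s * \<bar>\<phi> s\<bar> \<partial>?\<mu>)"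
      by (intro sum_mono step) auto
    also have "\<dots> = (\<integral>s. E s * \<bar>\<phi> s\<bar> \<partial>?\<mu>)"
      unfolding E_def sum_distrib_right
      by (rule Bochner_Integration.integral_sum[symmetric]) (auto intro!: iI \<phi>abs)
    finally have le: "(\<Sum>i<n. \<bar>F (b i) - F (a i)\<bar>) \<le> (\<integral>s. E s * \<bar>\<phi> s\<bar> \<partial>?\<mu>)" .
    have "sqn ?\<mu> E = (\<integral>s. (\<Sum>i<n. (indicat_real {a i<..<b i} s)\<^sup>2) \<partial>?\<mu>)"
    proof (intro Bochner_Integration.integral_cong refl)
      fix s
      \<comment> \<open>By disjointness \<open>E\<close> takes only the values 0 and 1, so squaring
        commutes with the sum.\<close>
      have "E s = indicat_real (\<Union>i<n. {a i<..<b i}) s"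
        unfolding E_def using asm by (subst indicator_UN_disjoint) auto
      then have "E s = 0 \<or> E s = 1" by (auto simp: indicator_def)
      then have "(E s)\<^sup>2 = E s" by auto
      moreover have "(indicat_real S s)\<^sup>2 = indicator S s" for S by (simp add: indicator_def)
      ultimately show "(E s)\<^sup>2 = (\<Sum>i<n. (indicat_real {a i<..<b i} s)\<^sup>2)"
        by (simp only: E_def)
    qed
    also have "\<dots> = (\<Sum>i<n. sqn ?\<mu> (indicator {a i<..<b i}))"
      using indicator_sq_integrable by (intro Bochner_Integration.integral_sum) (auto simp: sq_integrable_def)
    also have "\<dots> \<le> (\<Sum>i<n. b i - a i)"
    proof (intro sum_mono)
      fix i assume "i \<in> {..<n}"
      then have "a i \<le> b i" using asm by auto
      then show "sqn ?\<mu> (indicator {a i<..<b i}) \<le> b i - a i" using sqn_indicator_le[OF T, of "a i" "b i"] by simp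
    qed
    finally have sE: "sqn ?\<mu> E < e\<^sup>2 / K" using asm by linarith
    have "(\<integral>s. E s * \<bar>\<phi> s\<bar> \<partial>?\<mu>)\<^sup>2 \<le> sqn ?\<mu> E * sqn ?\<mu> (\<lambda>s. \<bar>\<phi> s\<bar>)"
      by (rule Cauchy_Schwarz_sq_integrable[OF E2 \<phi>abs])
    also have "\<dots> \<le> sqn ?\<mu> E * K" using K by (intro mult_left_mono) auto
    also have "\<dots> < e\<^sup>2" using sE K by (simp add: field_simps)
    finally have "(\<integral>s. E s * \<bar>\<phi> s\<bar> \<partial>?\<mu>) < e" by (rule power2_less_imp_less) (use e in simp)
    then show "(\<Sum>i<n. \<bar>F (b i) - F (a i)\<bar>) < e" using le by linarith
  qed
qed

lemma continuous_on_if_absolutely_continuous: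
  assumes "absolutely_continuous_on_Icc T g" shows "continuous_on {0..T} g"
  unfolding continuous_on_iff
proof (intro ballI allI impI)
  fix x e :: real assume x: "x \<in> {0..T}" and e: "0 < e"
  from assms[unfolded absolutely_continuous_on_Icc_def, rule_format, OF e]
  obtain d where d: "0 < d" and H: "\<And>(n::nat) a b. (\<forall>i<n. 0 \<le> a i \<and> a i \<le> b i \<and> b i \<le> T) \<Longrightarrow>
     disjoint_family_on (\<lambda>i. {a i<..<b i}) {..<n} \<Longrightarrow> (\<Sum>i<n. b i - a i) < d \<Longrightarrow> (\<Sum>i<n. \<bar>g (b i) - g (a i)\<bar>) < e"
    by blast
  have "dist (g y) (g x) < e" if y: "y \<in> {0..T}" "dist y x < d" for y
    using H[of 1 "\<lambda>_. x" "\<lambda>_. y"] H[of 1 "\<lambda>_. y" "\<lambda>_. x"] x y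
    by (cases "x \<le> y") (auto simp: disjoint_family_on_def dist_real_def abs_minus_commute)
  with d show "\<exists>d>0. \<forall>y\<in>{0..T}. dist y x < d \<longrightarrow> dist (g y) (g x) < e" by blast
qed

subsection \<open>The band inequality\<close>

text \<open>A vector of length zero lies in the kernel of a semidefinite form: otherwise the form at
  \<open>t * a\<close> plus the unit vector of \<open>k\<close>, affine in \<open>t\<close>, would
  become negative. This provides the hypothesis \<open>null\<close> of
  \<open>gaussian_box_shift\<close>.\<close>

lemma psd_null_vector:
  fixes R :: "'i \<Rightarrow> 'i \<Rightarrow> real"
  assumes J: "finite J" and sym: "\<And>i j. R i j = R j i"
    and pos: "\<And>c. 0 \<le> (\<Sum>i\<in>J. \<Sum>j\<in>J. c i * c j * R i j)"
    and null: "(\<Sum>j\<in>J. a j * (\<Sum>i\<in>J. a i * R i j)) = 0" and k: "k \<in> J"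
  shows "(\<Sum>i\<in>J. a i * R i k) = 0"
proof -
  define G where "G j = (\<Sum>i\<in>J. a i * R i j)" for j
  have quad: "0 \<le> R k k + 2 * t * G k" for t
  proof -
    define d where "d j = (if j = k then 1 else 0 :: real)" for j
    have dR: "(\<Sum>i\<in>J. d i * f i) = f k" for f :: "'i \<Rightarrow> real"
      using J k by (simp add: d_def if_distrib[of "\<lambda>x. x * _"] sum.delta cong: if_cong)
    have "0 \<le> (\<Sum>i\<in>J. \<Sum>j\<in>J. (t * a i + d i) * (t * a j + d j) * R i j)" by (rule pos)
    also have "\<dots> = (\<Sum>i\<in>J. (t * a i + d i) * (\<Sum>j\<in>J. (t * a j + d j) * R j i))"
      by (simp add: sum_distrib_left mult.assoc sym)
    also have "\<dots> = (\<Sum>i\<in>J. (t * a i + d i) * (t * G i + R k i))"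
      by (simp add: distrib_right sum.distrib dR G_def sum_distrib_left mult.assoc)
    also have "\<dots> = t * t * (\<Sum>i\<in>J. a i * G i) + t * (\<Sum>i\<in>J. a i * R i k) + (\<Sum>i\<in>J. d i * (t * G i + R k i))"
      by (simp add: distrib_left distrib_right sum.distrib sum_distrib_left mult_ac sym)
    also have "\<dots> = R k k + 2 * t * G k"
      using null by (simp add: dR G_def)
    finally show ?thesis .
  qed
  show ?thesis
  proof (cases "G k = 0")
    case False
    then show ?thesis using quad[of "- (R k k + 1) / (2 * G k)"] by (simp add: field_simps)
  qed (simp add: G_def)
qed

text \<open>Both claims concern the single vector \<open>\<Sum>t\<in>J. c t * v t\<close>: its
  squared norm is the form and its inner product with \<open>h\<close> is the functional, so
  Cauchy--Schwarz applies.\<close>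

lemma Gram_bound:
  assumes v: "\<And>t. t \<in> J \<Longrightarrow> sq_integrable M (v t)" and h: "sq_integrable M h"
    and l: "\<And>t. t \<in> J \<Longrightarrow> l t = (\<integral>x. v t x * h x \<partial>M)"
    and R: "\<And>s t. s \<in> J \<Longrightarrow> t \<in> J \<Longrightarrow> R s t = (\<integral>x. v s x * v t x \<partial>M)"
  shows "(\<Sum>t\<in>J. c t * l t)\<^sup>2 \<le> sqn M h * (\<Sum>s\<in>J. \<Sum>t\<in>J. c s * c t * R s t)"
    and "0 \<le> (\<Sum>s\<in>J. \<Sum>t\<in>J. c s * c t * R s t)"
proof -
  define V where "V x = (\<Sum>t\<in>J. c t * v t x)" for x
  have V: "sq_integrable M V" unfolding V_def by (intro sq_integrable_sum sq_integrable_cmult v)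
  have "(\<integral>x. V x * h x \<partial>M) = (\<integral>x. (\<Sum>t\<in>J. c t * (v t x * h x)) \<partial>M)"
    unfolding V_def sum_distrib_right by (simp add: mult.assoc)
  also have "\<dots> = (\<Sum>t\<in>J. \<integral>x. c t * (v t x * h x) \<partial>M)"
    by (intro Bochner_Integration.integral_sum integrable_mult_right sq_integrable_mult v h)
  also have "\<dots> = (\<Sum>t\<in>J. c t * l t)" by (simp add: l)
  finally have 1: "(\<integral>x. V x * h x \<partial>M) = (\<Sum>t\<in>J. c t * l t)" .
  have "sqn M V = (\<integral>x. (\<Sum>s\<in>J. \<Sum>t\<in>J. c s * c t * (v s x * v t x)) \<partial>M)"
    unfolding V_def power2_eq_square sum_product
    by (intro Bochner_Integration.integral_cong sum.cong refl) (simp add: mult_ac)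
  also have "\<dots> = (\<Sum>s\<in>J. \<integral>x. (\<Sum>t\<in>J. c s * c t * (v s x * v t x)) \<partial>M)"
    by (intro Bochner_Integration.integral_sum Bochner_Integration.integrable_sum integrable_mult_right sq_integrable_mult v)
  also have "\<dots> = (\<Sum>s\<in>J. \<Sum>t\<in>J. \<integral>x. c s * c t * (v s x * v t x) \<partial>M)"
    by (intro sum.cong refl Bochner_Integration.integral_sum integrable_mult_right sq_integrable_mult v)
  also have "\<dots> = (\<Sum>s\<in>J. \<Sum>t\<in>J. c s * c t * R s t)" by (simp add: R)
  finally have 2: "sqn M V = (\<Sum>s\<in>J. \<Sum>t\<in>J. c s * c t * R s t)" .
  show "(\<Sum>t\<in>J. c t * l t)\<^sup>2 \<le> sqn M h * (\<Sum>s\<in>J. \<Sum>t\<in>J. c s * c t * R s t)"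
    using Cauchy_Schwarz_sq_integrable[OF V h] unfolding 1 2 by (simp add: mult.commute)
  show "0 \<le> (\<Sum>s\<in>J. \<Sum>t\<in>J. c s * c t * R s t)" unfolding 2[symmetric] by simp
qed

text \<open>Cauchy--Schwarz in the plane for \<open>(sqrt P, sqrt Q)\<close> and
  \<open>(sqrt p, sqrt q)\<close>. It combines the separate bounds for the Wiener and the fractional
  component.\<close>

lemma sum_square_bound:
  fixes a b :: real
  assumes "a\<^sup>2 \<le> P * p" "b\<^sup>2 \<le> Q * q" "0 \<le> P" "0 \<le> p" "0 \<le> Q" "0 \<le> q"
  shows "(a + b)\<^sup>2 \<le> (P + Q) * (p + q)"
proof -
  have "\<bar>a * b\<bar> \<le> sqrt (P * q) * sqrt (Q * p)"
  proof (rule power2_le_imp_le)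
    have "\<bar>a * b\<bar>\<^sup>2 = a\<^sup>2 * b\<^sup>2" by (simp add: power_mult_distrib)
    also have "\<dots> \<le> (P * p) * (Q * q)" using assms by (intro mult_mono) auto
    also have "\<dots> = (sqrt (P * q) * sqrt (Q * p))\<^sup>2" using assms by (simp add: power_mult_distrib)
    finally show "\<bar>a * b\<bar>\<^sup>2 \<le> (sqrt (P * q) * sqrt (Q * p))\<^sup>2" .
  qed (use assms in auto)
  moreover have "2 * (sqrt (P * q) * sqrt (Q * p)) \<le> P * q + Q * p"
    using sum_squares_bound[of "sqrt (P * q)" "sqrt (Q * p)"] assms by simp
  ultimately have "2 * (a * b) \<le> P * q + Q * p" by linarith
  then show ?thesis using assms(1,2) by (simp add: power2_sum algebra_simps)
qed

section \<open>The inequality for finitely many times\<close>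

context hurst_interval
begin

lemma inner_indicators:
  assumes "0 \<le> s" "s \<le> T" "0 \<le> t" "t \<le> T"
  shows "(\<integral>x. indicat_real {0..s} x * indicat_real {0..t} x \<partial>\<mu>) = min s t"
proof -
  have "(\<integral>x. indicat_real {0..s} x * indicat_real {0..t} x \<partial>\<mu>) = (\<integral>x. indicator {0..T} x *\<^sub>R (indicat_real {0..s} x * indicat_real {0..t} x) \<partial>lebesgue)"
    by (rule integral_restrict_space) simp
  also have "\<dots> = (\<integral>x. indicat_real {0..min s t} x \<partial>lebesgue)"
    using assms by (intro Bochner_Integration.integral_cong refl) (auto simp: indicator_def)
  also have "\<dots> = min s t" using assms by simp
  finally show ?thesis .
qed

lemma finite_band_inequality:
  assumes M: "prob_space M" and B: "fractional_brownian_motion M H B" and W: "wiener_process M W"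
    and ind: "independent_processes M B W" and J: "finite J" "J \<subseteq> {0..T}"
    and w: "sq_integrable \<mu> w" and x: "sq_integrable \<mu> x"
    and g: "\<And>t. t \<in> J \<Longrightarrow> g t = (LINT s|lebesgue_on {0..t}. w s) + (LINT s|lebesgue_on {0..t}. x s)"
  shows "exp (- expansion_cost H T w x) * measure M {\<omega>\<in>space M. \<forall>t\<in>J. \<bar>B t \<omega> + W t \<omega>\<bar> \<le> b t}
     \<le> measure M {\<omega>\<in>space M. \<forall>t\<in>J. \<bar>B t \<omega> + W t \<omega> + g t\<bar> \<le> b t}"
proof -
  define R where "R s t = fbm_cov H s t + min s t" for s t
  define gB where "gB t = (LINT s|lebesgue_on {0..t}. x s)" for t
  define gW where "gW t = (LINT s|lebesgue_on {0..t}. w s)" for t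
  define C where "C = sqn \<mu> w + sqn \<mu> (op x)"
  have J': "0 \<le> t" "t \<le> T" if "t \<in> J" for t using J that by auto
  have symB: "fbm_cov H s t = fbm_cov H t s" for s t by (simp add: fbm_cov_def abs_minus_commute)
  have RB: "fbm_cov H s t = (\<integral>u. m s u * m t u \<partial>\<mu>)" if "s \<in> J" "t \<in> J" for s t
  proof (cases "s \<le> t")
    case True
    then show ?thesis using m_sq_integrable(2)[of t s] J'[OF that(1)] J'[OF that(2)] by simp
  next
    case False
    then show ?thesis using m_sq_integrable(2)[of s t] J'[OF that(1)] J'[OF that(2)]
      by (simp add: symB[of s t] mult.commute)
  qed
  have lB: "gB t = (\<integral>u. m t u * op x u \<partial>\<mu>)" if "t \<in> J" for t
    using inner_m_op[OF J'[OF that] x] by (simp add: gB_def)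
  have lW: "gW t = (\<integral>u. indicat_real {0..t} u * w u \<partial>\<mu>)" if "t \<in> J" for t
    unfolding gW_def by (rule LINT_Icc_eq_indicator[OF J'(2)[OF that]])
  have RW: "min s t = (\<integral>u. indicat_real {0..s} u * indicat_real {0..t} u \<partial>\<mu>)" if "s \<in> J" "t \<in> J" for s t
    using inner_indicators[OF J'[OF that(1)] J'[OF that(2)]] by simp
  have iI: "sq_integrable \<mu> (indicat_real {0..t})" for t by (rule indicator_sq_integrable) simp
  \<comment> \<open>\<open>fbm_cov\<close> is the Gram matrix of the functions \<open>m t\<close>,
    and \<open>min\<close> that of the indicators of \<open>[0, t]\<close>; the two components of
    the trend are inner products with \<open>op x\<close> and with \<open>w\<close>.\<close>
  note GB = Gram_bound[where v = m, OF m_sq_integrable(1)[OF J'] op_sq_integrable(2)[OF x] lB RB]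
  note GW = Gram_bound[where v = "\<lambda>t. indicat_real {0..t}", OF iI w lW RW]
  have Bb: "(\<Sum>t\<in>J. c t * gB t)\<^sup>2 \<le> sqn \<mu> (op x) * (\<Sum>s\<in>J. \<Sum>t\<in>J. c s * c t * fbm_cov H s t)" for c by (rule GB(1))
  have Bp: "0 \<le> (\<Sum>s\<in>J. \<Sum>t\<in>J. c s * c t * fbm_cov H s t)" for c by (rule GB(2))
  have Wb: "(\<Sum>t\<in>J. c t * gW t)\<^sup>2 \<le> sqn \<mu> w * (\<Sum>s\<in>J. \<Sum>t\<in>J. c s * c t * min s t)" for c by (rule GW(1))
  have Wp: "0 \<le> (\<Sum>s\<in>J. \<Sum>t\<in>J. c s * c t * min s t)" for c by (rule GW(2))
  have gsum: "g t = gW t + gB t" if "t \<in> J" for t using g[OF that] by (simp add: gB_def gW_def)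
  have Rsum: "(\<Sum>s\<in>J. \<Sum>t\<in>J. c s * c t * R s t) = (\<Sum>s\<in>J. \<Sum>t\<in>J. c s * c t * min s t) + (\<Sum>s\<in>J. \<Sum>t\<in>J. c s * c t * fbm_cov H s t)" for c
    by (simp add: R_def distrib_left sum.distrib)
  have bound: "(\<Sum>t\<in>J. c t * g t)\<^sup>2 \<le> C * (\<Sum>s\<in>J. \<Sum>t\<in>J. c s * c t * R s t)" for c
  proof -
    have "(\<Sum>t\<in>J. c t * g t) = (\<Sum>t\<in>J. c t * gW t) + (\<Sum>t\<in>J. c t * gB t)"
      by (simp add: gsum distrib_left sum.distrib)
    then show ?thesis unfolding Rsum C_def
      using Wb[of c] Bb[of c] Wp[of c] Bp[of c] by (simp add: sum_square_bound)
  qed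
  have pos: "0 \<le> (\<Sum>s\<in>J. \<Sum>t\<in>J. c s * c t * R s t)" for c unfolding Rsum using Wp[of c] Bp[of c] by simp
  have sym: "R s t = R t s" for s t by (simp add: R_def symB[of s t] min.commute)
  obtain a where a: "\<And>t. t \<in> J \<Longrightarrow> g t = (\<Sum>s\<in>J. a s * R s t)"
    using bounded_functional_represented[OF J(1) sym pos bound] by blast
  have Qa: "(\<Sum>s\<in>J. \<Sum>t\<in>J. a s * a t * R s t) = (\<Sum>t\<in>J. a t * g t)"
    by (subst sum.swap) (simp add: a sum_distrib_left mult_ac)
  have C0: "0 \<le> C"
  proof -
    have "0 \<le> sqn \<mu> w" "0 \<le> sqn \<mu> (op x)" by simp_all
    then show ?thesis by (simp add: C_def)
  qed
  \<comment> \<open>At \<open>c = a\<close> the functional and the form have a common value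
    \<open>Q\<close>, so the bound reads \<open>Q\<^sup>2 \<le> C * Q\<close>.\<close>
  have Cle: "(\<Sum>t\<in>J. a t * g t) \<le> C"
  proof (rule ccontr)
    assume "\<not> (\<Sum>t\<in>J. a t * g t) \<le> C"
    then have lt: "C < (\<Sum>t\<in>J. a t * g t)" by simp
    have "(\<Sum>t\<in>J. a t * g t) * (\<Sum>t\<in>J. a t * g t) \<le> C * (\<Sum>t\<in>J. a t * g t)"
      using bound[of a] unfolding Qa by (simp add: power2_eq_square)
    moreover have "C * (\<Sum>t\<in>J. a t * g t) < (\<Sum>t\<in>J. a t * g t) * (\<Sum>t\<in>J. a t * g t)"
      using lt C0 by (intro mult_strict_right_mono) auto
    ultimately show False by simp
  qed
  have null: "\<forall>t\<in>J. g t = 0" if "(\<Sum>t\<in>J. a t * g t) = 0"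
  proof
    fix t assume t: "t \<in> J"
    have "(\<Sum>j\<in>J. a j * (\<Sum>i\<in>J. a i * R i j)) = 0" using that by (simp add: a)
    from psd_null_vector[OF J(1) sym pos this t] show "g t = 0" using a[OF t] by simp
  qed
  interpret prob_space M by fact
  have meas: "(\<lambda>\<omega>. B t \<omega> + W t \<omega>) \<in> borel_measurable M" if "t \<in> J" for t
  proof -
    have "(\<lambda>\<omega>. \<Sum>t\<in>{t}. 1 * B t \<omega>) \<in> borel_measurable M"
      using B J'[OF that] unfolding fractional_brownian_motion_def gaussian_process_def gaussian_rv_def
      by (elim conjE allE[of _ "{t}"] allE[of _ "\<lambda>_. 1"]) auto
    then have "B t \<in> borel_measurable M" by simp
    moreover have "W t \<in> borel_measurable M" using W J'[OF that] by (simp add: wiener_process_def)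
    ultimately show ?thesis by simp
  qed
  have J0: "J \<subseteq> {0..}" using J by auto
  have "exp (- C / 2) * measure M {\<omega>\<in>space M. \<forall>t\<in>J. \<bar>B t \<omega> + W t \<omega>\<bar> \<le> b t}
     \<le> measure M {\<omega>\<in>space M. \<forall>t\<in>J. \<bar>(B t \<omega> + W t \<omega>) + g t\<bar> \<le> b t}"
    by (rule gaussian_box_shift[where X = "\<lambda>t \<omega>. B t \<omega> + W t \<omega>", OF M J(1) meas _ sym a Cle null])
       (simp_all add: mixed_process_char[OF M B W ind J(1) J0] R_def)
  moreover have "- expansion_cost H T w x = - C / 2"
    unfolding C_def by (simp add: expansion_cost_eq[OF w x] field_simps)
  ultimately show ?thesis by (simp only:)
qed

end

text \<open>Density of \<open>D\<close> in the graph of \<open>f\<close>, not just in \<open>[0,T]\<close>, is what makes countably many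
  constraints suffice although \<open>f\<close> may be discontinuous.\<close>

lemma countable_band_reduction:
  fixes f :: "real \<Rightarrow> real"
  obtains D where "countable D" "D \<subseteq> {0..T}"
    and "\<And>y. continuous_on {0..T} y \<Longrightarrow> (\<forall>t\<in>D. \<bar>y t\<bar> \<le> \<epsilon> * f t) \<longleftrightarrow> (\<forall>t\<in>{0..T}. \<bar>y t\<bar> \<le> \<epsilon> * f t)"
proof -
  define Gr where "Gr = (\<lambda>t. (t, f t)) ` {0..T}"
  obtain G where G: "countable G" "G \<subseteq> Gr" "Gr \<subseteq> closure G" using separable[of Gr] by blast
  show thesis
  proof (rule that[of "fst ` G"])
    show "countable (fst ` G)" using G by simp
    show sub: "fst ` G \<subseteq> {0..T}" using G by (auto simp: Gr_def)
    fix y :: "real \<Rightarrow> real" assume y: "continuous_on {0..T} y"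
    show "(\<forall>t\<in>fst ` G. \<bar>y t\<bar> \<le> \<epsilon> * f t) \<longleftrightarrow> (\<forall>t\<in>{0..T}. \<bar>y t\<bar> \<le> \<epsilon> * f t)"
    proof
      assume h: "\<forall>t\<in>fst ` G. \<bar>y t\<bar> \<le> \<epsilon> * f t"
      show "\<forall>t\<in>{0..T}. \<bar>y t\<bar> \<le> \<epsilon> * f t"
      proof
        fix t assume t: "t \<in> {0..T}"
        then have "(t, f t) \<in> closure G" using G by (auto simp: Gr_def)
        then obtain p where p: "\<And>n. p n \<in> G" "p \<longlonglongrightarrow> (t, f t)" unfolding closure_sequential by blast
        have f1: "(\<lambda>n. fst (p n)) \<longlonglongrightarrow> t" using tendsto_fst[OF p(2)] by simp
        have snd_eq: "snd (p n) = f (fst (p n))" for n using p(1)[of n] G by (auto simp: Gr_def)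
        have f2: "(\<lambda>n. f (fst (p n))) \<longlonglongrightarrow> f t" using tendsto_snd[OF p(2)] by (simp add: snd_eq)
        have mem: "fst (p n) \<in> {0..T}" for n using p(1)[of n] sub by auto
        have "(\<lambda>n. y (fst (p n))) \<longlonglongrightarrow> y t"
          using continuous_on_tendsto_compose[OF y f1 t] mem by simp
        then have "(\<lambda>n. \<bar>y (fst (p n))\<bar>) \<longlonglongrightarrow> \<bar>y t\<bar>" by (rule tendsto_rabs)
        moreover have "(\<lambda>n. \<epsilon> * f (fst (p n))) \<longlonglongrightarrow> \<epsilon> * f t" by (intro tendsto_intros f2)
        ultimately show "\<bar>y t\<bar> \<le> \<epsilon> * f t"
          by (rule LIMSEQ_le) (use h p(1) in auto)
      qed
    qed (use sub in auto)
  qed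
qed

text \<open>Off the null set of discontinuous paths the band event coincides with the countable
  intersection over \<open>D\<close>, which lies in \<open>sets M\<close>. In the completion the
  band event is therefore measurable, with the same probability.\<close>

lemma band_prob_eq_countable:
  assumes M: "prob_space M" and B: "continuous_paths M B" and W: "continuous_paths M W"
    and meas: "\<And>t. t \<in> D \<Longrightarrow> (\<lambda>\<omega>. B t \<omega> + W t \<omega>) \<in> borel_measurable M"
    and g: "continuous_on {0..T} g" and D: "countable D"
    and red: "\<And>y. continuous_on {0..T} y \<Longrightarrow> (\<forall>t\<in>D. \<bar>y t\<bar> \<le> \<epsilon> * f t) \<longleftrightarrow> (\<forall>t\<in>{0..T}. \<bar>y t\<bar> \<le> \<epsilon> * f t)"
  shows "band_prob M B W f T g \<epsilon> = measure M {\<omega>\<in>space M. \<forall>t\<in>D. \<bar>B t \<omega> + W t \<omega> + g t\<bar> \<le> \<epsilon> * f t}"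
proof -
  interpret prob_space M by fact
  define E where "E = {\<omega>\<in>space M. \<forall>t\<in>D. \<bar>B t \<omega> + W t \<omega> + g t\<bar> \<le> \<epsilon> * f t}"
  have E: "E \<in> sets M" unfolding E_def
  proof (intro sets.sets_Collect_countable_All' D)
    fix t assume "t \<in> D"
    have "{x. \<bar>x + g t\<bar> \<le> \<epsilon> * f t} \<in> sets borel" by measurable
    from measurable_sets[OF meas[OF \<open>t \<in> D\<close>] this]
    show "{\<omega> \<in> space M. \<bar>B t \<omega> + W t \<omega> + g t\<bar> \<le> \<epsilon> * f t} \<in> sets M"
      by (simp add: vimage_def Int_def conj_commute)
  qed
  have "AE \<omega> in M. \<omega> \<in> E \<longleftrightarrow> \<omega> \<in> band_event M B W f T g \<epsilon>"
    using B[unfolded continuous_paths_def] W[unfolded continuous_paths_def] AE_space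
  proof eventually_elim
    fix \<omega> assume c: "continuous_on {0..} (\<lambda>t. B t \<omega>)" "continuous_on {0..} (\<lambda>t. W t \<omega>)" and \<omega>: "\<omega> \<in> space M"
    have "continuous_on {0..T} (\<lambda>t. B t \<omega> + W t \<omega> + g t)"
      using c g by (intro continuous_intros) (auto intro: continuous_on_subset)
    from red[OF this] show "\<omega> \<in> E \<longleftrightarrow> \<omega> \<in> band_event M B W f T g \<epsilon>"
      using \<omega> by (simp add: E_def band_event_def)
  qed
  then have ae: "AE \<omega> in completion M. \<omega> \<in> E \<longleftrightarrow> \<omega> \<in> band_event M B W f T g \<epsilon>" by (rule AE_completion)
  have E': "E \<in> sets (completion M)" using E by simp
  have b: "band_event M B W f T g \<epsilon> \<in> sets (completion M)"
    by (rule completion.in_sets_AE[OF ae E']) (auto simp: band_event_def)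
  have "measure (completion M) (band_event M B W f T g \<epsilon>) = measure (completion M) E"
    using ae b E' by (intro measure_eq_AE) auto
  then show ?thesis using E by (simp add: band_prob_def E_def)
qed

section \<open>Passage to the whole interval, and uniqueness of derivatives\<close>

context hurst_interval
begin

text \<open>\<open>D\<close> is chosen from \<open>f\<close>, \<open>\<epsilon>\<close> and
  \<open>T\<close> only, so it serves the trend \<open>g\<close> and the trend 0 alike. Along finite
  sets increasing to \<open>D\<close> the events decrease, and the inequality passes to the limit by
  continuity from above.\<close>

lemma band_inequality:
  assumes M: "prob_space M" and B: "fractional_brownian_motion M H B" "continuous_paths M B"
    and W: "wiener_process M W" and ind: "independent_processes M B W"
    and w: "sq_integrable \<mu> w" and x: "sq_integrable \<mu> x"
    and g: "\<And>t. t \<in> {0..T} \<Longrightarrow> g t = (LINT s|lebesgue_on {0..t}. w s) + (LINT s|lebesgue_on {0..t}. x s)"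
    and gc: "continuous_on {0..T} g"
  shows "exp (- expansion_cost H T w x) * band_prob M B W f T (\<lambda>_. 0) \<epsilon> \<le> band_prob M B W f T g \<epsilon>"
proof -
  interpret prob_space M by fact
  have Wc: "continuous_paths M W" using W by (simp add: wiener_process_def)
  have meas: "(\<lambda>\<omega>. B t \<omega> + W t \<omega>) \<in> borel_measurable M" if "0 \<le> t" for t
  proof -
    have "gaussian_rv M (\<lambda>\<omega>. \<Sum>t\<in>{t}. 1 * B t \<omega>)"
      using B(1) that unfolding fractional_brownian_motion_def gaussian_process_def
      by (elim conjE allE[of _ "{t}"] allE[of _ "\<lambda>_. 1"]) auto
    then have "B t \<in> borel_measurable M" by (simp add: gaussian_rv_def)
    moreover have "W t \<in> borel_measurable M" using W that by (simp add: wiener_process_def)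
    ultimately show ?thesis by simp
  qed
  obtain D where D: "countable D" "D \<subseteq> {0..T}"
    and red: "\<And>y. continuous_on {0..T} y \<Longrightarrow> (\<forall>t\<in>D. \<bar>y t\<bar> \<le> \<epsilon> * f t) \<longleftrightarrow> (\<forall>t\<in>{0..T}. \<bar>y t\<bar> \<le> \<epsilon> * f t)"
    by (rule countable_band_reduction[of T \<epsilon> f]) (rule that)
  have measD: "(\<lambda>\<omega>. B t \<omega> + W t \<omega>) \<in> borel_measurable M" if "t \<in> D" for t using that D by (intro meas) auto
  define E where "E \<gamma> S = {\<omega>\<in>space M. \<forall>t\<in>S. \<bar>B t \<omega> + W t \<omega> + \<gamma> t\<bar> \<le> \<epsilon> * f t}" for \<gamma> S
  have bp: "band_prob M B W f T \<gamma> \<epsilon> = measure M (E \<gamma> D)" if "continuous_on {0..T} \<gamma>" for \<gamma>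
    unfolding E_def by (rule band_prob_eq_countable[OF M B(2) Wc measD that D(1) red])
  define J where "J n = (if D = {} then {} else from_nat_into D ` {..n})" for n :: nat
  have J: "finite (J n)" "J n \<subseteq> D" for n using from_nat_into[of D] by (auto simp: J_def)
  have JD: "(\<Union>n. J n) = D"
  proof (cases "D = {}")
    case False
    have "(\<Union>n. from_nat_into D ` {..n}) = range (from_nat_into D)" by auto
    also have "\<dots> = D" using False D(1) by (rule range_from_nat_into)
    finally show ?thesis using False by (simp add: J_def)
  qed (simp add: J_def)
  have meas_E: "E \<gamma> (J n) \<in> sets M" for \<gamma> n
    unfolding E_def
  proof (intro sets.sets_Collect_finite_All J)
    fix t assume "t \<in> J n"
    then have "t \<in> D" using J by auto
    have "{x. \<bar>x + \<gamma> t\<bar> \<le> \<epsilon> * f t} \<in> sets borel" by measurable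
    from measurable_sets[OF measD[OF \<open>t \<in> D\<close>] this]
    show "{\<omega> \<in> space M. \<bar>B t \<omega> + W t \<omega> + \<gamma> t\<bar> \<le> \<epsilon> * f t} \<in> sets M"
      by (simp add: vimage_def Int_def conj_commute)
  qed
  have lim: "(\<lambda>n. measure M (E \<gamma> (J n))) \<longlonglongrightarrow> measure M (E \<gamma> D)" for \<gamma>
  proof -
    have "(\<Inter>n. E \<gamma> (J n)) = E \<gamma> D"
      unfolding JD[symmetric] E_def by auto
    moreover have "decseq (\<lambda>n. E \<gamma> (J n))"
      unfolding decseq_def E_def J_def by auto
    ultimately show ?thesis using finite_Lim_measure_decseq[of "\<lambda>n. E \<gamma> (J n)"] meas_E by auto
  qed
  have "exp (- expansion_cost H T w x) * measure M (E (\<lambda>_. 0) (J n)) \<le> measure M (E g (J n))" for n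
    unfolding E_def using finite_band_inequality[OF M B(1) W ind J(1) _ w x, of n g "\<lambda>t. \<epsilon> * f t"] J(2)[of n] D(2) g
    by (simp add: subset_iff)
  then have "exp (- expansion_cost H T w x) * measure M (E (\<lambda>_. 0) D) \<le> measure M (E g D)"
    by (intro LIMSEQ_le[OF tendsto_mult_left[OF lim] lim]) auto
  then show ?thesis using bp[OF gc] bp[of "\<lambda>_. 0"] by simp
qed

lemma has_L2_derivative_integral:
  assumes \<phi>: "sq_integrable \<mu> \<phi>" and F: "\<And>t. t \<in> {0..T} \<Longrightarrow> F t = (LINT s|lebesgue_on {0..t}. \<phi> s)"
  shows "has_L2_derivative T F \<phi>"
  using absolutely_continuous_indefinite_integral[OF _ \<phi> F] T_pos \<phi> F
  by (simp add: has_L2_derivative_def L2_iff)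

lemma indefinite_integral_lincomb:
  assumes "sq_integrable \<mu> \<phi>" "sq_integrable \<mu> \<psi>" and t: "t \<in> {0..T}"
  shows "(LINT s|lebesgue_on {0..t}. \<phi> s + c * \<psi> s) = (LINT s|lebesgue_on {0..t}. \<phi> s) + c * (LINT s|lebesgue_on {0..t}. \<psi> s)"
proof -
  have i: "integrable \<mu> (\<lambda>s. indicator {0..t} s * \<phi> s)" "integrable \<mu> (\<lambda>s. indicator {0..t} s * \<psi> s)"
    by (intro sq_integrable_mult indicator_sq_integrable assms; simp)+
  have tT: "t \<le> T" using t by simp
  have "(\<integral>s. indicator {0..t} s * (\<phi> s + c * \<psi> s) \<partial>\<mu>) = (\<integral>s. indicator {0..t} s * \<phi> s + c * (indicator {0..t} s * \<psi> s) \<partial>\<mu>)"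
    by (intro Bochner_Integration.integral_cong refl) (simp add: algebra_simps)
  also have "\<dots> = (\<integral>s. indicator {0..t} s * \<phi> s \<partial>\<mu>) + c * (\<integral>s. indicator {0..t} s * \<psi> s \<partial>\<mu>)"
    using i by simp
  finally show ?thesis unfolding LINT_Icc_eq_indicator[OF tT] .
qed

text \<open>The difference of the two functions integrates to 0 over every \<open>[0, t]\<close>.
  For a competing expansion this forces the Wiener derivative to be \<open>g'\<close> minus the
  fractional one, so that competitors are parametrised by the latter alone, as
  \<open>S_solution_minimizes\<close> expects.\<close>

lemma L2_derivative_unique:
  assumes \<phi>: "sq_integrable \<mu> \<phi>" and \<psi>: "sq_integrable \<mu> \<psi>"
    and eq: "\<And>t. t \<in> {0..T} \<Longrightarrow> (LINT s|lebesgue_on {0..t}. \<phi> s) = (LINT s|lebesgue_on {0..t}. \<psi> s)"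
  shows "AE t in \<mu>. \<phi> t = \<psi> t"
proof -
  define \<eta> where "\<eta> s = \<phi> s + (-1) * \<psi> s" for s
  have \<eta>: "sq_integrable \<mu> \<eta>" unfolding \<eta>_def by (intro sq_integrable_add sq_integrable_cmult \<phi> \<psi>)
  have "sq_integrable \<mu> (indicat_real UNIV)" by (rule indicator_sq_integrable) simp
  from sq_integrable_mult[OF this \<eta>] have "integrable \<mu> \<eta>" by simp
  then have "AE t in \<mu>. \<eta> t = 0"
  proof (rule AE_zero_of_integral_Icc_zero[rotated])
    fix t assume t: "0 \<le> t" "t \<le> T"
    have "(\<integral>s. indicator {0..t} s * \<eta> s \<partial>\<mu>) = (LINT s|lebesgue_on {0..t}. \<eta> s)"
      by (rule LINT_Icc_eq_indicator[OF t(2), symmetric])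
    also have "\<dots> = 0" unfolding \<eta>_def using t eq[of t] by (subst indefinite_integral_lincomb[OF \<phi> \<psi>]) auto
    finally show "(\<integral>s. indicator {0..t} s * \<eta> s \<partial>\<mu>) = 0" .
  qed (use T_pos in simp)
  then show ?thesis by (simp add: \<eta>_def)
qed

end

text \<open>\<open>band_inequality\<close> gives a lower bound for every square integrable split of
  \<open>g'\<close>, and the Fredholm equation selects the split of least cost. Existence and
  uniqueness of its solution are conjuncts of their own because the English statement speaks of the
  unique solution; the bound is then proved for every representative of it.\<close>

theorem theorem3p9:
  fixes M :: "'a measure" and F :: "real \<Rightarrow> 'a measure"
    and B W :: "real \<Rightarrow> 'a \<Rightarrow> real"
    and H T :: real and g g' f :: "real \<Rightarrow> real"
  assumes "0 < H" "H < 1/2" and "0 < T"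
    and "filtered_prob_space M F"
    and "fractional_brownian_motion M H B" and "continuous_paths M B"
    and "wiener_process M W"
    and "independent_processes M B W"
    and "has_L2_derivative T g g'"
    and "f \<in> borel_measurable (lebesgue_on {0..T})" and "\<forall>t\<in>{0..T}. 0 < f t"
  shows "(\<exists>x. fredholm_solution H T g' x) \<and>
    (\<forall>x y. fredholm_solution H T g' x \<and> fredholm_solution H T g' y \<longrightarrow>
       (AE t in lebesgue_on {0..T}. x t = y t)) \<and>
    (\<forall>g\<^sub>B'. fredholm_solution H T g' g\<^sub>B' \<longrightarrow>
       (let g\<^sub>B = (\<lambda>t. LINT s|lebesgue_on {0..t}. g\<^sub>B' s);
            g\<^sub>W = (\<lambda>t. g t - g\<^sub>B t);
            g\<^sub>W' = (\<lambda>t. g' t - g\<^sub>B' t)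
        in suitable_expansion T g g\<^sub>W g\<^sub>W' g\<^sub>B g\<^sub>B' \<and>
           (\<forall>\<epsilon>>0. band_prob M B W f T g \<epsilon>
              \<ge> exp (- expansion_cost H T g\<^sub>W' g\<^sub>B') * band_prob M B W f T (\<lambda>_. 0) \<epsilon>) \<and>
           (\<forall>u\<^sub>W u\<^sub>W' u\<^sub>B u\<^sub>B'. suitable_expansion T g u\<^sub>W u\<^sub>W' u\<^sub>B u\<^sub>B' \<longrightarrow>
              expansion_cost H T u\<^sub>W' u\<^sub>B' \<ge> expansion_cost H T g\<^sub>W' g\<^sub>B')))"
proof -
  interpret hurst_interval H T by unfold_locales (use assms in auto)
  have g': "sq_integrable \<mu> g'" and gint: "\<And>t. t \<in> {0..T} \<Longrightarrow> g t = (LINT s|lebesgue_on {0..t}. g' s)"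
    and gc: "continuous_on {0..T} g"
    using assms(9) by (auto simp: has_L2_derivative_def L2_iff intro: continuous_on_if_absolutely_continuous)
  have M: "prob_space M" using assms(4) by (simp add: filtered_prob_space_def)
  have "\<exists>x. fredholm_solution H T g' x"
    using S_surjective[OF g'] by (simp add: fredholm_solution_iff)
  moreover have "AE t in lebesgue_on {0..T}. x t = y t"
    if "fredholm_solution H T g' x" "fredholm_solution H T g' y" for x y
  proof (rule S_injective)
    show "sq_integrable \<mu> x" "sq_integrable \<mu> y" using that by (auto simp: fredholm_solution_iff)
    have "AE t in \<mu>. S x t = g' t" "AE t in \<mu>. S y t = g' t" using that by (auto simp: fredholm_solution_iff)
    then show "AE t in \<mu>. S x t = S y t" by eventually_elim simp
  qed
  moreover have "suitable_expansion T g (\<lambda>t. g t - (LINT s|lebesgue_on {0..t}. x s)) (\<lambda>t. g' t - x t) (\<lambda>t. LINT s|lebesgue_on {0..t}. x s) x \<and>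
      (\<forall>\<epsilon>>0. exp (- expansion_cost H T (\<lambda>t. g' t - x t) x) * band_prob M B W f T (\<lambda>_. 0) \<epsilon> \<le> band_prob M B W f T g \<epsilon>) \<and>
      (\<forall>u\<^sub>W u\<^sub>W' u\<^sub>B u\<^sub>B'. suitable_expansion T g u\<^sub>W u\<^sub>W' u\<^sub>B u\<^sub>B' \<longrightarrow>
          expansion_cost H T (\<lambda>t. g' t - x t) x \<le> expansion_cost H T u\<^sub>W' u\<^sub>B')"
    if sol: "fredholm_solution H T g' x" for x
  proof (intro conjI allI impI)
    have x: "sq_integrable \<mu> x" and eq: "AE t in \<mu>. S x t = g' t" using sol by (auto simp: fredholm_solution_iff)
    have w: "sq_integrable \<mu> (\<lambda>t. g' t - x t)" by (intro sq_integrable_diff g' x)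
    have gW: "(LINT s|lebesgue_on {0..t}. g' s - x s) = g t - (LINT s|lebesgue_on {0..t}. x s)" if "t \<in> {0..T}" for t
      using indefinite_integral_lincomb[OF g' x that, of "-1"] gint[OF that] by simp
    show "suitable_expansion T g (\<lambda>t. g t - (LINT s|lebesgue_on {0..t}. x s)) (\<lambda>t. g' t - x t) (\<lambda>t. LINT s|lebesgue_on {0..t}. x s) x"
      unfolding suitable_expansion_def
      by (intro conjI has_L2_derivative_integral w x) (simp_all add: gW)
    show "exp (- expansion_cost H T (\<lambda>t. g' t - x t) x) * band_prob M B W f T (\<lambda>_. 0) \<epsilon> \<le> band_prob M B W f T g \<epsilon>" for \<epsilon>
      by (rule band_inequality[OF M assms(5,6,7,8) w x _ gc]) (simp add: gW)
    fix u\<^sub>W u\<^sub>W' u\<^sub>B u\<^sub>B' assume u: "suitable_expansion T g u\<^sub>W u\<^sub>W' u\<^sub>B u\<^sub>B'"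
    then have uW: "sq_integrable \<mu> u\<^sub>W'" and uB: "sq_integrable \<mu> u\<^sub>B'"
      by (auto simp: suitable_expansion_def has_L2_derivative_def L2_iff)
    have "AE t in \<mu>. u\<^sub>W' t = g' t - u\<^sub>B' t"
    proof (rule L2_derivative_unique[OF uW])
      show "sq_integrable \<mu> (\<lambda>t. g' t - u\<^sub>B' t)" by (intro sq_integrable_diff g' uB)
      fix t assume t: "t \<in> {0..T}"
      have "g t = (LINT s|lebesgue_on {0..t}. u\<^sub>W' s) + (LINT s|lebesgue_on {0..t}. u\<^sub>B' s)"
        using u t by (simp add: suitable_expansion_def has_L2_derivative_def)
      then show "(LINT s|lebesgue_on {0..t}. u\<^sub>W' s) = (LINT s|lebesgue_on {0..t}. g' s - u\<^sub>B' s)"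
        using indefinite_integral_lincomb[OF g' uB t, of "-1"] gint[OF t] by simp
    qed
    then have "sqn \<mu> u\<^sub>W' = sqn \<mu> (\<lambda>t. g' t - u\<^sub>B' t)"
      using uW uB g' by (intro sqn_cong_AE) (auto simp: sq_integrable_def)
    then show "expansion_cost H T (\<lambda>t. g' t - x t) x \<le> expansion_cost H T u\<^sub>W' u\<^sub>B'"
      using S_solution_minimizes[OF g' x uB eq] by (simp add: expansion_cost_eq[OF w x] expansion_cost_eq[OF uW uB])
  qed
  ultimately show ?thesis unfolding Let_def by blast
qed

end
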